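(* For a rational solution of Type A of $A_5^{(1)}(\alpha_j)_{0\leq j\leq 5}$, by some B\"acklund transformations, the parameters and the solution can be transformed so that one of the following occurs: (a-1) $(\alpha_0,\dots,\alpha_5)=(\alpha_0,1-\alpha_0,0,0,0,0)$ and $(f_0,\dots,f_5)=(t,t,0,0,0,0)$; (a-2) $(\alpha_0,\dots,\alpha_5)=(\alpha_0,0,0,1-\alpha_0,0,0)$ and $(f_0,\dots,f_5)=(t,0,0,t,0,0)$; (a-3) $(\alpha_0,\dots,\alpha_5)=(0,1,0,0,0,0)$ and $(f_0,\dots,f_5)$ is one of $(t,t,0,0,0,0)$, $(0,t,t,0,0,0)$, $(0,t,0,0,t,0)$, $(t,t,t,0,-t,0)$. Moreover, the orbit of the parameters in cases (a-1), (a-2) and (a-3) under the B\"acklund transformation group $\tilde W(A_5^{(1)})$ consists of the parameters which satisfy one of the following five conditions: (1) for some $i\in\{0,1,2,3,4,5\}$, $\alpha_{i+2},\alpha_{i+3},\alpha_{i+4},\alpha_{i+5}\in\mathbb{Z}$; (2) for some $i\in\{0,1,2,3,4,5\}$, $\alpha_{i+1},\alpha_{i+2},\alpha_{i+4},\alpha_{i+5}\in\mathbb{Z}$; (3) for some $i\in\{0,1,2,3,4,5\}$, $\alpha_{i+3},\ \alpha_{i+5},\ \alpha_i+\alpha_{i+4},\ \alpha_i-\alpha_{i+2}\in\mathbb{Z}$; (4) for some $i\in\{0,1,2,3,4,5\}$, $\alpha_{i+3}+\alpha_{i+4},\ \alpha_{i+4}+\alpha_{i+5},\ \alpha_i+\alpha_{i+1},\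 \alpha_i-\alpha_{i+4}\in\mathbb{Z}$; (5) for some $i\in\{0,1,2,3,4,5\}$, $\alpha_i+\alpha_{i+1},\ \alpha_i+\alpha_{i+5},\ \alpha_{i+2}+\alpha_{i+3},\ \alpha_{i+3}+\alpha_{i+4},\ \alpha_i+\alpha_{i+3}\in\mathbb{Z}$.
   Context: Indices of $f_i$ and $\alpha_i$ are taken in $\mathbb{Z}/6\mathbb{Z}$. For complex parameters $\alpha_0,\dots,\alpha_5$ with $\alpha_0+\cdots+\alpha_5=1$, $A_5^{(1)}(\alpha_j)_{0\leq j\leq 5}$ denotes the following system for functions $f_0,\dots,f_5$ of $t$ (with ${}'=d/dt$): for every $i\in\mathbb{Z}/6\mathbb{Z}$, $$\tfrac{t}{2}f_i'=f_i\left(f_{i+1}f_{i+2}+f_{i+1}f_{i+4}+f_{i+3}f_{i+4}-f_{i+2}f_{i+3}-f_{i+2}f_{i+5}-f_{i+4}f_{i+5}\right)+\left(\tfrac12-\alpha_{i+2}-\alpha_{i+4}\right)f_i+\alpha_i(f_{i+2}+f_{i+4}),$$ together with $f_0+f_2+f_4=f_1+f_3+f_5=t$. A rational solution is a solution with all $f_i$ rational functions of $t$. A solution meromorphic at $t=\infty$ is of Type A if, for some $i\in\mathbb{Z}/6\mathbb{Z}$, the set of those $f_j$ having a pole at $t=\infty$ is exactly $\{f_i,f_{i+1}\}$ (Type A (1)), or $\{f_i,f_{i+3}\}$ (Type A (2)), or $\{f_i,f_{i+1},f_{i+2},f_{i+4}\}$ (Type A (3)), the remaining $f_j$ being holomorphic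 at $t=\infty$. B\"acklund transformations: these are the finite compositions of $s_0,\dots,s_5,\pi$ (and inverses), each of which sends parameters and a solution to new parameters and a solution of the system with the new parameters: $s_i(f_i)=f_i$, $s_i(f_{i+1})=f_{i+1}+\alpha_i/f_i$, $s_i(f_{i-1})=f_{i-1}-\alpha_i/f_i$, $s_i(f_j)=f_j$ for the other $j$; $s_i(\alpha_i)=-\alpha_i$, $s_i(\alpha_{i\pm1})=\alpha_{i\pm1}+\alpha_i$, $s_i(\alpha_j)=\alpha_j$ for the other $j$; $\pi(f_i)=f_{i+1}$, $\pi(\alpha_i)=\alpha_{i+1}$. If $f_i\equiv0$ (which implies $\alpha_i=0$), $s_i$ is taken to be the identity. The group $\langle s_0,\dots,s_5,\pi\rangle$ is isomorphic to the extended affine Weyl group $\tilde W(A_5^{(1)})$ and acts on the parameters by the formulas above. In the claim, after the transformation, $\alpha_j,f_j$ denote the new parameters and solution, and the free parameter in each form is an arbitrary complex number. *)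

theory Defs
  imports
    "HOL-Library.Numeral_Type"
    "HOL-Computational_Algebra.Computational_Algebra"
    "HOL-Computational_Algebra.Field_as_Ring"
begin

section \<open>Rational functions of one complex variable\<close>

type_synonym ratfun = "complex poly fract"

definition fract_deriv :: "ratfun \<Rightarrow> ratfun" where
  "fract_deriv r = (case quot_of_fract r of (p, q) \<Rightarrow>
     Fract (pderiv p * q - p * pderiv q) (q * q))"

definition pole_at_infinity :: "ratfun \<Rightarrow> bool" where
  "pole_at_infinity r = (case quot_of_fract r of (p, q) \<Rightarrow> degree q < degree p)"

text \<open>Neither notion depends on the chosen representation of the fraction.\<close>

lemma fract_deriv_Fract:
  assumes q: "q \<noteq> 0"
  shows "fract_deriv (Fract p q) = Fract (pderiv p * q - p * pderiv q) (q * q)"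
proof -
  obtain r s where rs: "quot_of_fract (Fract p q) = (r, s)" by (cases "quot_of_fract (Fract p q)")
  have s: "s \<noteq> 0" using snd_quot_of_fract_nonzero[of "Fract p q"] rs by simp
  have "Fract p q = Fract r s" using Fract_quot_of_fract[of "Fract p q"] rs by simp
  then have eq: "p * s = r * q" using q s by (simp add: eq_fract)
  have eq': "pderiv p * s + p * pderiv s = pderiv r * q + r * pderiv q"
    using arg_cong[OF eq, of pderiv] by (simp add: pderiv_mult algebra_simps)
  have "(pderiv p * q - p * pderiv q) * (s * s) - (pderiv r * s - r * pderiv s) * (q * q)
      = (pderiv p * s + p * pderiv s) * (q * s) - p * s * (pderiv s * q + pderiv q * s)
        - (pderiv r * q + r * pderiv q) * (q * s) + r * q * (pderiv q * s + pderiv s * q)"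
    by (simp add: algebra_simps)
  also have "\<dots> = 0"
    by (simp only: eq eq') (simp add: algebra_simps)
  finally have "(pderiv p * q - p * pderiv q) * (s * s) = (pderiv r * s - r * pderiv s) * (q * q)"
    by (simp only: right_minus_eq)
  moreover have "q * q \<noteq> 0" "s * s \<noteq> 0" using q s by simp_all
  ultimately show ?thesis
    unfolding fract_deriv_def rs prod.case by (subst eq_fract(1)) simp_all
qed

lemma pole_at_infinity_Fract:
  assumes q: "q \<noteq> 0"
  shows "pole_at_infinity (Fract p q) \<longleftrightarrow> degree q < degree p"
proof -
  obtain r s where rs: "quot_of_fract (Fract p q) = (r, s)" by (cases "quot_of_fract (Fract p q)")
  have s: "s \<noteq> 0" using snd_quot_of_fract_nonzero[of "Fract p q"] rs by simp
  have "Fract p q = Fract r s" using Fract_quot_of_fract[of "Fract p q"] rs by simp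
  then have eq: "p * s = r * q" using q s by (simp add: eq_fract)
  show ?thesis
  proof (cases "p = 0")
    case True
    with eq q have "r = 0" by simp
    with True show ?thesis unfolding pole_at_infinity_def rs prod.case by simp
  next
    case False
    with eq s have r: "r \<noteq> 0" by auto
    have "degree p + degree s = degree r + degree q"
      using arg_cong[OF eq, of degree] False q r s by (simp add: degree_mult_eq)
    then show ?thesis by (simp add: pole_at_infinity_def rs) linarith
  qed
qed

definition rconst :: "complex \<Rightarrow> ratfun" where
  "rconst c = to_fract [:c:]"

definition tvar :: ratfun where
  "tvar = to_fract [:0, 1:]"


section \<open>The system\<close>

text \<open>Indices live in the type \<open>6\<close> of integers modulo 6, so index arithmetic is cyclic.\<close>

definition hexad :: "'a \<Rightarrow> 'a \<Rightarrow> 'a \<Rightarrow> 'a \<Rightarrow> 'a \<Rightarrow> 'a \<Rightarrow> 6 \<Rightarrow> 'a" where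
  "hexad a0 a1 a2 a3 a4 a5 = (\<lambda>i.
     if i = 0 then a0 else if i = 1 then a1 else if i = 2 then a2
     else if i = 3 then a3 else if i = 4 then a4 else a5)"

definition parameters :: "(6 \<Rightarrow> complex) set" where
  "parameters = {\<alpha>. (\<Sum>i\<in>UNIV. \<alpha> i) = 1}"

definition rational_solution :: "(6 \<Rightarrow> complex) \<Rightarrow> (6 \<Rightarrow> ratfun) \<Rightarrow> bool" where
  "rational_solution \<alpha> f \<longleftrightarrow>
     (\<forall>i. tvar / 2 * fract_deriv (f i) =
        f i * (f (i+1) * f (i+2) + f (i+1) * f (i+4) + f (i+3) * f (i+4)
               - f (i+2) * f (i+3) - f (i+2) * f (i+5) - f (i+4) * f (i+5))
        + rconst (1/2 - \<alpha> (i+2) - \<alpha> (i+4)) * f i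
        + rconst (\<alpha> i) * (f (i+2) + f (i+4))) \<and>
     f 0 + f 2 + f 4 = tvar \<and> f 1 + f 3 + f 5 = tvar"

definition type_A :: "(6 \<Rightarrow> ratfun) \<Rightarrow> bool" where
  "type_A f \<longleftrightarrow> (\<exists>i.
     {j. pole_at_infinity (f j)} = {i, i+1} \<or>
     {j. pole_at_infinity (f j)} = {i, i+3} \<or>
     {j. pole_at_infinity (f j)} = {i, i+1, i+2, i+4})"


section \<open>Baecklund transformations\<close>

definition s_param :: "6 \<Rightarrow> (6 \<Rightarrow> complex) \<Rightarrow> (6 \<Rightarrow> complex)" where
  "s_param i \<alpha> = \<alpha>(i := - \<alpha> i, i+1 := \<alpha> (i+1) + \<alpha> i, i-1 := \<alpha> (i-1) + \<alpha> i)"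

definition pi_param :: "(6 \<Rightarrow> complex) \<Rightarrow> (6 \<Rightarrow> complex)" where
  "pi_param \<alpha> = (\<lambda>i. \<alpha> (i+1))"

type_synonym state = "(6 \<Rightarrow> complex) \<times> (6 \<Rightarrow> ratfun)"

text \<open>If \<open>(\<alpha>, f)\<close> is a solution with \<open>f i = 0\<close> then \<open>\<alpha> i = 0\<close>, so that \<open>s_param i\<close> fixes \<open>\<alpha>\<close>
  and the identity convention below agrees with the action on parameters.\<close>

definition s_state :: "6 \<Rightarrow> state \<Rightarrow> state" where
  "s_state i = (\<lambda>(\<alpha>, f).
     if f i = 0 then (\<alpha>, f)
     else (s_param i \<alpha>,
           f(i+1 := f (i+1) + rconst (\<alpha> i) / f i, i-1 := f (i-1) - rconst (\<alpha> i) / f i)))"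

definition pi_state :: "state \<Rightarrow> state" where
  "pi_state = (\<lambda>(\<alpha>, f). (pi_param \<alpha>, \<lambda>i. f (i+1)))"

text \<open>The group of transformations of a set generated by a set of bijections of it.\<close>

inductive_set generated :: "('a \<Rightarrow> 'a) set \<Rightarrow> ('a \<Rightarrow> 'a) set" for G where
  one: "id \<in> generated G"
| gen: "g \<in> G \<Longrightarrow> w \<in> generated G \<Longrightarrow> g \<circ> w \<in> generated G"
| inv: "g \<in> G \<Longrightarrow> w \<in> generated G \<Longrightarrow> inv g \<circ> w \<in> generated G"

definition baecklund :: "(state \<Rightarrow> state) set" where
  "baecklund = generated (insert pi_state (range s_state))"

definition weyl_param :: "((6 \<Rightarrow> complex) \<Rightarrow> (6 \<Rightarrow> complex)) set" where
  "weyl_param = generated (insert pi_param (range s_param))"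

text \<open>The generators are bijections, so that \<^const>\<open>inv\<close> above is the two-sided inverse.\<close>

lemma index_neq:
  fixes i :: 6
  shows "i + 1 \<noteq> i" "i - 1 \<noteq> i" "i + 1 \<noteq> i - 1"
proof -
  show "i + 1 \<noteq> i" "i - 1 \<noteq> i" by simp_all
  show "i + 1 \<noteq> i - 1"
  proof
    assume "i + 1 = i - 1"
    then have "(i + 1) - (i - 1) = 0" by (simp only: right_minus_eq)
    then have "(2::6) = 0" by (simp only: algebra_simps) simp
    then show False by simp
  qed
qed

lemma s_param_s_param: "s_param i (s_param i \<alpha>) = \<alpha>"
  using index_neq[of i] index_neq[of i, symmetric] by (auto simp: s_param_def fun_eq_iff)

lemma s_state_s_state: "s_state i (s_state i x) = x"
proof (cases x)
  case (Pair \<alpha> f)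
  have "rconst (- c) = - rconst c" for c
    by (simp add: rconst_def flip: to_fract_uminus)
  then show ?thesis
    using index_neq[of i] index_neq[of i, symmetric] s_param_s_param[of i \<alpha>]
    by (auto simp: Pair s_state_def fun_eq_iff s_param_def)
qed

lemma bij_s_param: "bij (s_param i)"
  by (rule o_bij[of "s_param i"]) (auto simp: s_param_s_param)

lemma bij_s_state: "bij (s_state i)"
  by (rule o_bij[of "s_state i"]) (auto simp: s_state_s_state)

lemma bij_pi_param: "bij pi_param"
  by (rule o_bij[of "\<lambda>\<alpha> i. \<alpha> (i - 1)"]) (auto simp: pi_param_def)

lemma bij_pi_state: "bij pi_state"
  by (rule o_bij[of "\<lambda>(\<alpha>, f). (\<lambda>i. \<alpha> (i - 1), \<lambda>i. f (i - 1))"])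
    (auto simp: pi_state_def pi_param_def)

end

theory Submission
  imports Defs
begin

text \<open>
  The system is a closed chain of Riccati equations in disguise.  Let \<open>Q i\<close> be the quadratic factor
  that multiplies \<open>f i\<close> in the \<open>i\<close>-th equation and \<open>A i = \<alpha> i + \<alpha> (i+2) + \<alpha> (i+4)\<close>.  The functions
  \<open>u i = f i - (Q i + 1/2 - A i) / t\<close> satisfy \<open>u i + u (i+1) = 2 f i\<close> and \<open>\<Sum>i. u i = 2 t\<close>, and the
  system turns into
  \<open>u (i+1)\<^sup>2 - u (i+1)' = u i\<^sup>2 + u i' - 4 \<alpha> i\<close>,
  a dressing chain of six Schroedinger operators (\<open>rational_solution_dressing_chain\<close>).
  Type A means that \<open>u i = \<sigma> i t + O(1)\<close> with signs \<open>\<sigma> i\<close>, four of them positive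
  (\<open>type_A_infinity_signs\<close>).  The transformation \<open>s\<^sub>i\<close> exchanges the signs of \<open>u i\<close> and \<open>u (i+1)\<close>
  whenever it acts nontrivially (\<open>s_state_chain\<close>), so this class of solutions is preserved, and a
  solution can follow its parameters to any point of their orbit (\<open>lift_to_solutions\<close>).

  One mechanism drives all the rest: if neighbours \<open>u i\<close>, \<open>u (i+1)\<close> of the chain have opposite
  leading terms at some point, their sum is negligible there and they can be removed, because the
  outer neighbours are then again linked (\<open>cancel_opposites\<close>).  At a finite point, removing as many
  pairs as possible shows that all poles are simple, and that the residues at points other than
  \<open>0\<close> are integers; otherwise everything would cancel although the sum \<open>2 t\<close> does not vanish there.
  At infinity the expansion is determined by \<open>\<alpha>\<close> and \<open>\<sigma>\<close>, hence each \<open>u i\<close> is odd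
  (\<open>chain_odd\<close>) and the residue theorem gives its coefficient of \<open>1/t\<close> at infinity, modulo 2, as
  the residue at \<open>0\<close>.  The parameters are
  differences of these coefficients (\<open>parameters_at_infinity\<close>), and the residues at \<open>0\<close> obey
  \<open>\<mu> (i+1) \<in> {- \<mu> i, \<mu> i - 1}\<close>.  Writing \<open>\<alpha> i = \<epsilon> i - \<epsilon> (i+1)\<close> modulo integers, it follows that
  the six \<open>\<epsilon> i\<close> lie in at most two classes modulo integers, split as \<open>5 + 1\<close> or \<open>3 + 3\<close>
  (\<open>chain_two_classes\<close>).  The affine Weyl group permutes the \<open>\<epsilon> i\<close> and translates them by integers,
  so these patterns are the orbits of the parameters of the three normal forms, and spelling them
  out in terms of \<open>\<alpha>\<close> gives the five conditions (\<open>orbit_of_seeds\<close>).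

  At the parameters of a normal form most \<open>\<alpha> i\<close> vanish, and the cancellation becomes exact.  It
  leaves two functions of the form \<open>t + \<kappa>/t\<close>, from which the remaining \<open>u i\<close> are recovered one after
  the other as rational solutions of Riccati equations with an explicit potential.  Counting
  their poles (\<open>riccati_pole_count\<close>) excludes all signs but those of the normal forms.
\<close>

unbundle fps_syntax

section \<open>Rational functions as a differential field, and their expansions\<close>

lemma fract_deriv_add: "fract_deriv (a + b) = fract_deriv a + fract_deriv b"
proof (cases a; cases b)
  fix p q r s :: "complex poly"
  assume "a = Fract p q" "q \<noteq> 0" "b = Fract r s" "s \<noteq> 0"
  then show ?thesis
    by (simp add: fract_deriv_Fract eq_fract pderiv_add pderiv_mult algebra_simps)
qed

lemma fract_deriv_mult: "fract_deriv (a * b) = fract_deriv a * b + a * fract_deriv b"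
proof (cases a; cases b)
  fix p q r s :: "complex poly"
  assume "a = Fract p q" "q \<noteq> 0" "b = Fract r s" "s \<noteq> 0"
  then show ?thesis
    by (simp add: fract_deriv_Fract eq_fract pderiv_mult algebra_simps)
qed

lemma fract_deriv_to_fract: "fract_deriv (to_fract p) = to_fract (pderiv p)"
  by (simp add: to_fract_def fract_deriv_Fract)

lemma fract_deriv_rconst [simp]: "fract_deriv (rconst c) = 0"
  by (simp add: rconst_def fract_deriv_to_fract pderiv_pCons)

lemma rconst_0 [simp]: "rconst 0 = 0"
  and rconst_1 [simp]: "rconst 1 = 1"
  and rconst_add: "rconst (a + b) = rconst a + rconst b"
  and rconst_mult: "rconst (a * b) = rconst a * rconst b"
  and rconst_minus: "rconst (- a) = - rconst a"
  and rconst_diff: "rconst (a - b) = rconst a - rconst b"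
  by (simp_all add: rconst_def to_fract_def One_fract_def one_pCons Zero_fract_def mult.commute)

lemma rconst_of_nat: "rconst (of_nat n) = of_nat n"
  by (induction n) (simp_all add: rconst_add)

lemma rconst_numeral [simp]: "rconst (numeral n) = numeral n"
  using rconst_of_nat[of "numeral n"] by simp

lemma rconst_eq_0_iff [simp]: "rconst c = 0 \<longleftrightarrow> c = 0"
  by (simp add: rconst_def)

lemma numeral_ratfun_neq_0 [simp]: "(numeral n :: ratfun) \<noteq> 0"
  using rconst_eq_0_iff[of "numeral n"] by simp

lemma rconst_inverse: "rconst (inverse c) = inverse (rconst c)"
proof (cases "c = 0")
  case False
  then have "rconst (inverse c) * rconst c = 1"
    by (simp flip: rconst_mult)
  then show ?thesis by (metis inverse_unique mult.commute)
qed simp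

lemma rconst_divide: "rconst (a / b) = rconst a / rconst b"
  by (simp add: field_class.field_divide_inverse rconst_mult rconst_inverse)

lemma tvar_nonzero [simp]: "tvar \<noteq> 0"
  by (simp add: tvar_def)

lemma fract_deriv_tvar [simp]: "fract_deriv tvar = 1"
  by (simp add: tvar_def fract_deriv_to_fract pderiv_pCons flip: one_pCons)

lemma fract_deriv_0 [simp]: "fract_deriv 0 = 0"
  using fract_deriv_rconst[of 0] by (simp only: rconst_0)

lemma fract_deriv_minus: "fract_deriv (- a) = - fract_deriv a"
  using fract_deriv_add[of a "- a"] by (simp add: minus_unique)

lemma fract_deriv_diff: "fract_deriv (a - b) = fract_deriv a - fract_deriv b"
  using fract_deriv_add[of a "- b"] by (simp add: fract_deriv_minus)

lemma fract_deriv_numeral [simp]: "fract_deriv (numeral n) = 0"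
  using fract_deriv_rconst[of "numeral n"] by simp

lemma fract_deriv_inverse:
  assumes "a \<noteq> 0"
  shows "fract_deriv (inverse a) = - (fract_deriv a * inverse a * inverse a)"
proof -
  have "fract_deriv a * inverse a + a * fract_deriv (inverse a) = fract_deriv (a * inverse a)"
    by (simp only: fract_deriv_mult)
  also have "\<dots> = 0"
    using assms fract_deriv_rconst[of 1] by (metis right_inverse rconst_1)
  finally have "inverse a * (fract_deriv a * inverse a + a * fract_deriv (inverse a)) = 0"
    by simp
  then have "fract_deriv a * inverse a * inverse a + (inverse a * a) * fract_deriv (inverse a) = 0"
    by (simp only: algebra_simps)
  then show ?thesis
    using assms by (simp only: left_inverse not_False_eq_True mult_1_left) (metis add_eq_0_iff)
qed

definition poly_value :: "(complex \<Rightarrow> 'b::comm_ring_1) \<Rightarrow> 'b \<Rightarrow> complex poly \<Rightarrow> 'b" where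
  "poly_value \<kappa> x p = fold_coeffs (\<lambda>a b. \<kappa> a + x * b) p 0"

text \<open>The Laurent expansion at a finite point, the Laurent expansion at infinity and the reflection
  \<open>t \<mapsto> - t\<close> all substitute a transcendental element for \<open>t\<close>; treating them at once gives the
  homomorphism and derivation laws for the three of them.\<close>

locale transcendental_substitution =
  fixes \<kappa> :: "complex \<Rightarrow> 'b::field" and x :: 'b and D :: "'b \<Rightarrow> 'b"
  assumes hom_add: "\<And>a b. \<kappa> (a + b) = \<kappa> a + \<kappa> b"
    and hom_mult: "\<And>a b. \<kappa> (a * b) = \<kappa> a * \<kappa> b"
    and hom_one: "\<kappa> 1 = 1"
    and D_add: "\<And>a b. D (a + b) = D a + D b"
    and D_mult: "\<And>a b. D (a * b) = D a * b + a * D b"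
    and D_const: "\<And>a. D (\<kappa> a) = 0"
    and D_x: "D x = 1"
    and transcendental: "\<And>p. p \<noteq> 0 \<Longrightarrow> poly_value \<kappa> x p \<noteq> 0"
begin

lemma hom_zero: "\<kappa> 0 = 0"
  using hom_add[of 0 0] by (metis add.right_neutral add_left_cancel)

abbreviation pv :: "complex poly \<Rightarrow> 'b" where
  "pv \<equiv> poly_value \<kappa> x"

definition subst :: "ratfun \<Rightarrow> 'b" where
  "subst r = (case quot_of_fract r of (p, q) \<Rightarrow> pv p / pv q)"

lemma pv_0 [simp]: "pv 0 = 0"
  by (simp add: poly_value_def)

lemma pv_pCons [simp]: "pv (pCons a p) = \<kappa> a + x * pv p"
  by (cases "p = 0 \<and> a = 0") (auto simp: poly_value_def hom_zero)

lemma pv_1 [simp]: "pv 1 = 1"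
  by (simp add: one_pCons hom_one)

lemma pv_add [simp]: "pv (p + q) = pv p + pv q"
  by (induction p q rule: poly_induct2) (simp_all add: hom_add algebra_simps)

lemma pv_smult [simp]: "pv (smult c p) = \<kappa> c * pv p"
  by (induction p) (simp_all add: hom_mult algebra_simps)

lemma pv_mult [simp]: "pv (p * q) = pv p * pv q"
  by (induction p) (simp_all add: hom_zero algebra_simps)

lemma D_0: "D 0 = 0"
  using D_add[of 0 0] by (metis add.right_neutral add_left_cancel)

lemma pv_minus [simp]: "pv (- p) = - pv p"
  using pv_add[of p "- p"] by (simp add: minus_unique del: pv_add)

lemma pv_diff [simp]: "pv (p - q) = pv p - pv q"
  using pv_add[of p "- q"] by simp

lemma D_pv: "D (pv p) = pv (pderiv p)"
  by (induction p) (simp_all add: D_0 D_add D_mult D_const D_x pderiv_pCons hom_zero algebra_simps)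

lemma subst_Fract:
  assumes "q \<noteq> 0"
  shows "subst (Fract p q) = pv p / pv q"
proof -
  obtain r s where rs: "quot_of_fract (Fract p q) = (r, s)" by (cases "quot_of_fract (Fract p q)")
  have s: "s \<noteq> 0" using snd_quot_of_fract_nonzero[of "Fract p q"] rs by simp
  have "Fract p q = Fract r s" using Fract_quot_of_fract[of "Fract p q"] rs by simp
  then have "p * s = r * q" using assms s by (simp add: eq_fract)
  then have "pv p * pv s = pv r * pv q" by (metis pv_mult)
  then show ?thesis
    using transcendental[OF assms] transcendental[OF s] by (simp add: subst_def rs field_simps)
qed

lemma subst_to_fract [simp]: "subst (to_fract p) = pv p"
  by (simp add: to_fract_def subst_Fract)

lemma subst_rconst [simp]: "subst (rconst c) = \<kappa> c"
  by (simp add: rconst_def)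

lemma subst_tvar [simp]: "subst tvar = x"
  by (simp add: tvar_def hom_zero hom_one)

lemma subst_0 [simp]: "subst 0 = 0"
  using subst_rconst[of 0] by (simp add: hom_zero del: subst_rconst)

lemma subst_1 [simp]: "subst 1 = 1"
  using subst_rconst[of 1] by (simp add: hom_one del: subst_rconst)

lemma subst_add [simp]: "subst (a + b) = subst a + subst b"
proof (cases a; cases b)
  fix p q r s :: "complex poly"
  assume "a = Fract p q" "q \<noteq> 0" "b = Fract r s" "s \<noteq> 0"
  then show ?thesis
    using transcendental[of q] transcendental[of s] by (simp add: subst_Fract field_simps)
qed

lemma subst_mult [simp]: "subst (a * b) = subst a * subst b"
proof (cases a; cases b)
  fix p q r s :: "complex poly"
  assume "a = Fract p q" "q \<noteq> 0" "b = Fract r s" "s \<noteq> 0"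
  then show ?thesis
    using transcendental[of q] transcendental[of s] by (simp add: subst_Fract)
qed

lemma subst_minus [simp]: "subst (- a) = - subst a"
  using subst_add[of a "- a"] by (simp add: minus_unique del: subst_add)

lemma subst_diff [simp]: "subst (a - b) = subst a - subst b"
  using subst_add[of a "- b"] by simp

lemma subst_power [simp]: "subst (a ^ n) = subst a ^ n"
  by (induction n) simp_all

lemma subst_sum [simp]: "subst (sum f A) = (\<Sum>i\<in>A. subst (f i))"
  by (induction A rule: infinite_finite_induct) simp_all

lemma subst_of_nat [simp]: "subst (of_nat n) = of_nat n"
  by (induction n) simp_all

lemma subst_numeral [simp]: "subst (numeral n) = numeral n"
  using subst_of_nat[of "numeral n"] by simp

lemma subst_eq_0_iff [simp]: "subst a = 0 \<longleftrightarrow> a = 0"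
proof (cases a)
  case (Fract p q)
  then show ?thesis
    using transcendental[of q] transcendental[of p]
    by (cases "p = 0") (auto simp: subst_Fract eq_fract Zero_fract_def)
qed

lemma subst_eq_iff [simp]: "subst a = subst b \<longleftrightarrow> a = b"
  using subst_eq_0_iff[of "a - b"] by (simp del: subst_eq_0_iff)

lemma subst_inverse [simp]: "subst (inverse a) = inverse (subst a)"
proof (cases "a = 0")
  case False
  then have "subst a * subst (inverse a) = 1" by (simp flip: subst_mult)
  then show ?thesis by (simp add: inverse_unique)
qed simp

lemma subst_divide [simp]: "subst (a / b) = subst a / subst b"
  by (simp add: field_class.field_divide_inverse)

lemma subst_deriv: "D (subst a) = subst (fract_deriv a)"
proof (cases a)
  case (Fract p q)
  let ?P = "pv p" and ?Q = "pv q"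
  have q: "?Q \<noteq> 0" using Fract transcendental by blast
  have "D ?P = D (subst a * ?Q)" using Fract q by (simp add: subst_Fract)
  then have "D (subst a) * ?Q = (pv (pderiv p) - subst a * pv (pderiv q))"
    by (simp add: D_mult D_pv algebra_simps)
  then show ?thesis
    using Fract q by (simp add: subst_Fract fract_deriv_Fract field_simps)
qed

end

text \<open>The expansion at \<open>c\<close>, in powers of \<open>X = t - c\<close>.\<close>

lemma poly_value_fls_at:
  "poly_value fls_const (fls_const c + fls_X) p = fps_to_fls (fps_of_poly (pcompose p [:c, 1:]))"
proof (induction p)
  case (pCons a p)
  have "poly_value fls_const (fls_const c + fls_X) (pCons a p)
      = fls_const a + (fls_const c + fls_X) * poly_value fls_const (fls_const c + fls_X) p"
    by (cases "p = 0 \<and> a = 0") (auto simp: poly_value_def)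
  also have "\<dots> = fps_to_fls (fps_of_poly [:a:])
      + fps_to_fls (fps_of_poly [:c, 1:]) * fps_to_fls (fps_of_poly (pcompose p [:c, 1:]))"
    by (simp only: pCons.IH) (simp add: fps_of_poly_pCons)
  also have "\<dots> = fps_to_fls (fps_of_poly (pcompose (pCons a p) [:c, 1:]))"
    by (simp only: pcompose_pCons fps_of_poly_add fps_of_poly_mult fls_times_fps_to_fls
        fps_to_fls_plus)
  finally show ?case .
qed (simp add: poly_value_def)

global_interpretation at: transcendental_substitution fls_const "fls_const c + fls_X" fls_deriv for c
  defines expand = at.subst
proof
  fix p :: "complex poly" assume "p \<noteq> 0"
  then show "poly_value fls_const (fls_const c + fls_X) p \<noteq> 0"
    by (simp add: poly_value_fls_at pcompose_eq_0_iff)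
qed (simp_all add: fls_plus_const)

text \<open>The expansion at infinity, in powers of \<open>X = 1 / t\<close>, for which \<open>d/dt = - X\<^sup>2 d/dX\<close>.\<close>

definition deriv_infty :: "complex fls \<Rightarrow> complex fls" where
  "deriv_infty F = - fls_shift (- 2) (fls_deriv F)"

lemma deriv_infty_nth [simp]: "deriv_infty F $$ n = of_int (1 - n) * F $$ (n - 1)"
  by (simp add: deriv_infty_def algebra_simps)

lemma poly_value_fls_infty:
  "poly_value fls_const fls_X_inv p $$ n = (if n \<le> 0 then coeff p (nat (- n)) else 0)"
proof (induction p arbitrary: n)
  case (pCons a p)
  have "poly_value fls_const fls_X_inv (pCons a p)
      = fls_const a + fls_X_inv * poly_value fls_const fls_X_inv p"
    by (cases "p = 0 \<and> a = 0") (auto simp: poly_value_def)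
  moreover have "nat (- n) = Suc (nat (- n - 1))" if "n < 0" using that by linarith
  ultimately show ?case
    by (auto simp: pCons.IH fls_X_inv_times_conv_shift coeff_pCons)
qed (simp add: poly_value_def)

global_interpretation infty: transcendental_substitution fls_const fls_X_inv deriv_infty
  defines expand_infty = infty.subst
proof
  fix p :: "complex poly" assume "p \<noteq> 0"
  then have "poly_value fls_const fls_X_inv p $$ (- int (degree p)) \<noteq> 0"
    by (simp add: poly_value_fls_infty)
  then show "poly_value fls_const fls_X_inv p \<noteq> 0" by auto
next
  fix F G
  show "deriv_infty (F * G) = deriv_infty F * G + F * deriv_infty G"
    by (simp add: deriv_infty_def fls_shifted_times_simps)
  show "deriv_infty (F + G) = deriv_infty F + deriv_infty G"
    by (simp add: deriv_infty_def)
  show "deriv_infty fls_X_inv = 1"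
    by (intro fls_eqI) auto
qed (simp_all add: fls_plus_const deriv_infty_def)

text \<open>The reflection \<open>t \<mapsto> - t\<close>.\<close>

lemma poly_value_reflection: "poly_value rconst (- tvar) p = to_fract (pcompose p [:0, - 1:])"
proof (induction p)
  case (pCons a p)
  have "poly_value rconst (- tvar) (pCons a p)
      = rconst a + (- tvar) * poly_value rconst (- tvar) p"
    by (cases "p = 0 \<and> a = 0") (auto simp: poly_value_def)
  also have "\<dots> = to_fract [:a:] + to_fract [:0, - 1:] * to_fract (pcompose p [:0, - 1:])"
    by (simp only: pCons.IH) (simp add: tvar_def rconst_def flip: to_fract_uminus)
  also have "\<dots> = to_fract (pcompose (pCons a p) [:0, - 1:])"
    by (simp only: pcompose_pCons to_fract_mult to_fract_add)
  finally show ?case .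
qed (simp add: poly_value_def)

global_interpretation refl: transcendental_substitution rconst "- tvar" "\<lambda>r. - fract_deriv r"
  defines reflect = refl.subst
proof
  fix p :: "complex poly" assume "p \<noteq> 0"
  then show "poly_value rconst (- tvar) p \<noteq> 0"
    by (simp add: poly_value_reflection pcompose_eq_0_iff)
qed (simp_all add: rconst_add rconst_mult fract_deriv_add fract_deriv_mult fract_deriv_minus)

section \<open>Orders of Laurent series\<close>

definition order_ge :: "complex fls \<Rightarrow> int \<Rightarrow> bool" where
  "order_ge F k \<longleftrightarrow> (\<forall>n<k. F $$ n = 0)"

lemma order_geD: "order_ge F k \<Longrightarrow> n < k \<Longrightarrow> F $$ n = 0"
  by (simp add: order_ge_def)

lemma order_ge_mono: "order_ge F k \<Longrightarrow> l \<le> k \<Longrightarrow> order_ge F l"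
  by (simp add: order_ge_def)

lemma order_ge_0 [simp]: "order_ge 0 k"
  by (simp add: order_ge_def)

lemma order_ge_add: "order_ge F k \<Longrightarrow> order_ge G k \<Longrightarrow> order_ge (F + G) k"
  by (simp add: order_ge_def)

lemma order_ge_diff: "order_ge F k \<Longrightarrow> order_ge G k \<Longrightarrow> order_ge (F - G) k"
  by (simp add: order_ge_def)

lemma order_ge_minus: "order_ge F k \<Longrightarrow> order_ge (- F) k"
  by (simp add: order_ge_def)

lemma order_ge_const: "k \<le> 0 \<Longrightarrow> order_ge (fls_const c) k"
  by (simp add: order_ge_def)

lemma order_ge_sum: "(\<And>i. i \<in> A \<Longrightarrow> order_ge (f i) k) \<Longrightarrow> order_ge (sum f A) k"
  by (induction A rule: infinite_finite_induct) (simp_all add: order_ge_add)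

lemma order_ge_deriv: "order_ge F k \<Longrightarrow> order_ge (fls_deriv F) (k - 1)"
  by (simp add: order_ge_def)

lemma order_ge_deriv_infty: "order_ge F k \<Longrightarrow> order_ge (deriv_infty F) (k + 1)"
  by (simp add: order_ge_def)

lemma order_ge_subdegree: "order_ge F (fls_subdegree F)"
  by (simp add: order_ge_def)

lemma order_ge_shift_fps:
  assumes "order_ge F k"
  shows "F = fls_shift (- k) (fps_to_fls (fls_regpart (fls_shift k F)))"
  using assms by (intro fls_eqI) (auto simp: order_ge_def)

lemma order_ge_times_nth:
  assumes "order_ge F k" "order_ge G l"
  shows "(F * G) $$ n
    = (if n < k + l then 0 else (fls_regpart (fls_shift k F) * fls_regpart (fls_shift l G)) $ nat (n - (k + l)))"
proof -
  have "F * G = fls_shift (- k) (fps_to_fls (fls_regpart (fls_shift k F)))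
      * fls_shift (- l) (fps_to_fls (fls_regpart (fls_shift l G)))"
    using assms by (simp flip: order_ge_shift_fps)
  also have "\<dots> = fls_shift (- (k + l)) (fps_to_fls (fls_regpart (fls_shift k F) * fls_regpart (fls_shift l G)))"
    by (simp add: fls_shifted_times_simps fls_times_fps_to_fls)
  finally show ?thesis
    by (auto simp: fls_shift_nth algebra_simps)
qed

lemma order_ge_mult: "order_ge F k \<Longrightarrow> order_ge G l \<Longrightarrow> order_ge (F * G) (k + l)"
  by (subst order_ge_def) (simp add: order_ge_times_nth)

lemma lead_mult:
  assumes "order_ge F k" "order_ge G l"
  shows "(F * G) $$ (k + l) = F $$ k * G $$ l"
    and "(F * G) $$ (k + l + 1) = F $$ k * G $$ (l + 1) + F $$ (k + 1) * G $$ l"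
    and "(F * G) $$ (k + l + 2)
      = F $$ k * G $$ (l + 2) + F $$ (k + 1) * G $$ (l + 1) + F $$ (k + 2) * G $$ l"
proof -
  have *: "nat (k + l + 1 - (k + l)) = 1" "nat (k + l + 2 - (k + l)) = 2" by simp_all
  show "(F * G) $$ (k + l) = F $$ k * G $$ l"
    and "(F * G) $$ (k + l + 1) = F $$ k * G $$ (l + 1) + F $$ (k + 1) * G $$ l"
    and "(F * G) $$ (k + l + 2)
      = F $$ k * G $$ (l + 2) + F $$ (k + 1) * G $$ (l + 1) + F $$ (k + 2) * G $$ l"
    unfolding order_ge_times_nth[OF assms] *
    by (simp_all add: fps_mult_nth add.commute numeral_2_eq_2 atLeast0AtMost)
qed

lemma pole_at_infinity_iff: "pole_at_infinity r \<longleftrightarrow> \<not> order_ge (expand_infty r) 0"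
proof (cases r)
  case (Fract p q)
  let ?P = "poly_value fls_const fls_X_inv p" and ?Q = "poly_value fls_const fls_X_inv q"
  have sub: "fls_subdegree (poly_value fls_const fls_X_inv s) = - int (degree s)" if "s \<noteq> 0" for s
    using that by (intro fls_subdegree_eqI) (auto simp: poly_value_fls_infty coeff_eq_0)
  have r: "expand_infty r = ?P / ?Q" using Fract by (simp add: infty.subst_Fract)
  show ?thesis
  proof (cases "p = 0")
    case True
    then show ?thesis using Fract r pole_at_infinity_Fract[of q p] by simp
  next
    case False
    then have "fls_subdegree (?P / ?Q) = int (degree q) - int (degree p)" "?P / ?Q \<noteq> 0"
      using Fract sub infty.transcendental by (simp_all add: fls_divide_subdegree)
    then have "(\<exists>n<0. (?P / ?Q) $$ n \<noteq> 0) \<longleftrightarrow> int (degree q) - int (degree p) < 0"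
      by (metis fls_eq0_below_subdegree linorder_not_le nth_fls_subdegree_nonzero order_less_le_trans
          order_le_less_trans)
    then show ?thesis using Fract r by (auto simp: pole_at_infinity_Fract order_ge_def)
  qed
qed

section \<open>The dressing chain\<close>

lemma UNIV_6: "(UNIV :: 6 set) = {0, 1, 2, 3, 4, 5}"
proof
  show "(UNIV :: 6 set) \<subseteq> {0, 1, 2, 3, 4, 5}"
  proof
    fix i :: 6
    show "i \<in> {0, 1, 2, 3, 4, 5}"
    proof (cases i)
      case (of_int z)
      then have "z = 0 \<or> z = 1 \<or> z = 2 \<or> z = 3 \<or> z = 4 \<or> z = 5" by auto
      then show ?thesis using of_int(1) by auto
    qed
  qed
qed simp

lemma all_6: "(\<forall>i::6. P i) \<longleftrightarrow> P 0 \<and> P 1 \<and> P 2 \<and> P 3 \<and> P 4 \<and> P 5"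
proof -
  have "(\<forall>i::6. P i) \<longleftrightarrow> (\<forall>i\<in>UNIV. P i)" by simp
  then show ?thesis by (simp only: UNIV_6) simp
qed

lemma ex_6: "(\<exists>i::6. P i) \<longleftrightarrow> P 0 \<or> P 1 \<or> P 2 \<or> P 3 \<or> P 4 \<or> P 5"
  using all_6[of "\<lambda>i. \<not> P i"] by blast

lemma sum_6: "(\<Sum>i\<in>(UNIV :: 6 set). f i) = f 0 + f 1 + f 2 + f 3 + f 4 + f 5"
  unfolding UNIV_6 by (simp add: add.assoc)

lemma numerals_6 [simp]:
  "(6::6) = 0" "(7::6) = 1" "(8::6) = 2" "(9::6) = 3" "(10::6) = 4"
  by simp_all

lemma cycle_induct:
  fixes i j :: 6
  assumes "P i" and step: "\<And>k. P k \<Longrightarrow> P (k + 1)"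
  shows "P j"
proof -
  have "P (i + 1)" using assms by blast
  then have "P (i + 2)" using step[of "i + 1"] by (simp add: add.assoc)
  then have "P (i + 3)" using step[of "i + 2"] by (simp add: add.assoc)
  then have "P (i + 4)" using step[of "i + 3"] by (simp add: add.assoc)
  then have "P (i + 5)" using step[of "i + 4"] by (simp add: add.assoc)
  then have "\<forall>d. P (i + d)"
    using assms \<open>P (i + 1)\<close> \<open>P (i + 2)\<close> \<open>P (i + 3)\<close> \<open>P (i + 4)\<close> by (simp add: all_6)
  from this[rule_format, of "j - i"] show ?thesis by simp
qed

text \<open>For \<open>D = d/dt\<close>, \<open>lower\<close> and \<open>upper\<close> are the two partner potentials of a superpotential \<open>u\<close>.  The
  derivation is a parameter so that the chain can also be read in Laurent series.\<close>

definition lower :: "('a::comm_ring_1 \<Rightarrow> 'a) \<Rightarrow> 'a \<Rightarrow> 'a" where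
  "lower D u = u\<^sup>2 - D u"

definition upper :: "('a::comm_ring_1 \<Rightarrow> 'a) \<Rightarrow> 'a \<Rightarrow> 'a" where
  "upper D u = u\<^sup>2 + D u"

definition dressing_chain :: "(6 \<Rightarrow> complex) \<Rightarrow> (6 \<Rightarrow> ratfun) \<Rightarrow> bool" where
  "dressing_chain \<alpha> u \<longleftrightarrow>
     (\<forall>i. lower fract_deriv (u (i+1)) = upper fract_deriv (u i) - 4 * rconst (\<alpha> i)) \<and>
     (\<Sum>i\<in>UNIV. u i) = 2 * tvar"

lemma chain_link:
  assumes "dressing_chain \<alpha> u"
  shows "lower fract_deriv (u (i+1)) = upper fract_deriv (u i) - 4 * rconst (\<alpha> i)"
  by (rule assms[unfolded dressing_chain_def, THEN conjunct1, rule_format])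

lemma chain_sum:
  assumes "dressing_chain \<alpha> u"
  shows "(\<Sum>i\<in>UNIV. u i) = 2 * tvar"
  by (rule assms[unfolded dressing_chain_def, THEN conjunct2])

text \<open>The solution \<open>f\<close> of the system that belongs to a chain.\<close>

definition sols :: "(6 \<Rightarrow> ratfun) \<Rightarrow> 6 \<Rightarrow> ratfun" where
  "sols u i = (u i + u (i+1)) / 2"

text \<open>The identity \<open>Q i + Q (i+1) = t (f (i+1) - f i)\<close>, a consequence of the two sum conditions, makes the
  sums \<open>u i + u (i+1)\<close> come out as \<open>2 f i\<close>; the chain equations are then the differential equations
  with \<open>u (i+1) - u i\<close> as logarithmic factor.\<close>

lemma rational_solution_dressing_chain:
  assumes par: "\<alpha> \<in> parameters" and sol: "rational_solution \<alpha> f"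
  obtains u where "dressing_chain \<alpha> u" "f = sols u"
proof -
  define Q where "Q i = f (i+1) * f (i+2) + f (i+1) * f (i+4) + f (i+3) * f (i+4)
               - f (i+2) * f (i+3) - f (i+2) * f (i+5) - f (i+4) * f (i+5)" for i
  define A where "A i = \<alpha> i + \<alpha> (i+2) + \<alpha> (i+4)" for i
  define d where "d i = (Q i + rconst (1/2 - A i)) / tvar" for i
  define u where "u i = f i - d i" for i
  have even: "f 0 + f 2 + f 4 = tvar" and odd: "f 1 + f 3 + f 5 = tvar"
    using sol by (simp_all add: rational_solution_def)
  have "\<forall>i. f i + f (i+2) + f (i+4) = tvar"
    unfolding all_6 using even odd by (simp add: ac_simps)
  then have sums: "f i + f (i+2) + f (i+4) = tvar" for i by blast
  have sums': "f (i+1) + f (i+3) + f (i+5) = tvar" for i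
    using sums[of "i+1"] by (simp add: add.assoc)
  have "\<forall>i. A i + A (i+1) = 1"
    unfolding all_6 A_def using par by (simp add: parameters_def sum_6 ac_simps)
  then have A: "A i + A (i+1) = 1" for i by blast
  have dd: "d i + d (i+1) = f (i+1) - f i" for i
  proof -
    have i: "i+1+1 = i+2" "i+1+2 = i+3" "i+1+3 = i+4" "i+1+4 = i+5" "i+1+5 = i"
      by (simp_all add: add.assoc)
    have e: "f (i+2) + f (i+4) = tvar - f i" "f (i+3) + f (i+5) = tvar - f (i+1)"
      using sums[of i] sums'[of i] by (simp_all add: eq_diff_eq ac_simps)
    have "Q i + Q (i+1) = f (i+1) * (f (i+2) + f (i+4)) - f i * (f (i+3) + f (i+5))"
      unfolding Q_def i by algebra
    also have "\<dots> = f (i+1) * (tvar - f i) - f i * (tvar - f (i+1))"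
      by (simp only: e)
    also have "\<dots> = tvar * (f (i+1) - f i)"
      by algebra
    finally have Q: "Q i + Q (i+1) = tvar * (f (i+1) - f i)" .
    have R: "rconst (1/2 - A i) + rconst (1/2 - A (i+1)) = 0"
      using A[of i] by (simp flip: rconst_add add: algebra_simps)
    have "d i + d (i+1) = (Q i + Q (i+1) + (rconst (1/2 - A i) + rconst (1/2 - A (i+1)))) / tvar"
      unfolding d_def add_divide_distrib by (simp only: ac_simps)
    then show ?thesis unfolding Q R by simp
  qed
  have df: "fract_deriv (f i) = 2 * f i * d i + 2 * rconst (\<alpha> i)" for i
  proof -
    have td: "tvar * d i = Q i + rconst (1/2 - A i)" by (simp add: d_def)
    have "tvar * fract_deriv (f i) = 2 * (tvar / 2 * fract_deriv (f i))" by simp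
    also have "tvar / 2 * fract_deriv (f i)
        = f i * Q i + rconst (1/2 - \<alpha> (i+2) - \<alpha> (i+4)) * f i + rconst (\<alpha> i) * (f (i+2) + f (i+4))"
      using sol[unfolded rational_solution_def, THEN conjunct1, rule_format, of i]
      by (simp only: Q_def)
    also have "f (i+2) + f (i+4) = tvar - f i"
      using sums[of i] by (simp add: eq_diff_eq ac_simps)
    also have "rconst (1/2 - \<alpha> (i+2) - \<alpha> (i+4)) = rconst (1/2 - A i) + rconst (\<alpha> i)"
      by (simp only: A_def rconst_add[symmetric]) (simp add: algebra_simps)
    also have "2 * (f i * Q i + (rconst (1/2 - A i) + rconst (\<alpha> i)) * f i
        + rconst (\<alpha> i) * (tvar - f i)) = 2 * f i * (tvar * d i) + tvar * (2 * rconst (\<alpha> i))"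
      unfolding td by algebra
    finally have "tvar * fract_deriv (f i) = tvar * (2 * f i * d i + 2 * rconst (\<alpha> i))"
      by algebra
    then show ?thesis using tvar_nonzero mult_left_cancel by blast
  qed
  have sum_u: "u i + u (i+1) = 2 * f i" for i
    using dd[of i] unfolding u_def by algebra
  have diff_u: "u (i+1) - u i = 2 * d i" for i
    using dd[of i] unfolding u_def by algebra
  show thesis
  proof
    have "lower fract_deriv (u (i+1)) = upper fract_deriv (u i) - 4 * rconst (\<alpha> i)" for i
    proof -
      have "fract_deriv (u i) + fract_deriv (u (i+1)) = 2 * fract_deriv (f i)"
        using arg_cong[OF sum_u[of i], of fract_deriv]
        by (simp only: fract_deriv_add fract_deriv_mult fract_deriv_numeral mult_zero_left add_0)
      moreover have "(u (i+1))\<^sup>2 - (u i)\<^sup>2 = 2 * f i * (2 * d i)"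
        unfolding sum_u[symmetric] diff_u[symmetric] by algebra
      ultimately show ?thesis
        unfolding lower_def upper_def df by algebra
    qed
    moreover have "(\<Sum>i\<in>UNIV. u i) = 2 * tvar"
      using sum_u[of 0] sum_u[of 2] sum_u[of 4] even by (simp add: sum_6) algebra
    ultimately show "dressing_chain \<alpha> u" unfolding dressing_chain_def by blast
    show "f = sols u" by (simp add: fun_eq_iff sols_def sum_u)
  qed
qed

section \<open>Cancelling opposite neighbours\<close>

text \<open>A list of superpotentials leading from the potential \<open>X\<close> to the potential \<open>Y\<close>.  The relation \<open>E\<close> is
  equality for exact chains, and equality up to regular terms near a point.\<close>

fun linked :: "('b \<Rightarrow> 'b \<Rightarrow> bool) \<Rightarrow> ('a \<Rightarrow> 'b) \<Rightarrow> ('a \<Rightarrow> 'b) \<Rightarrow> 'b \<Rightarrow> 'a list \<Rightarrow> 'b \<Rightarrow> bool" where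
  "linked E W V X [] Y \<longleftrightarrow> E X Y"
| "linked E W V X (u # us) Y \<longleftrightarrow> E X (W u) \<and> linked E W V (V u) us Y"

lemma linked_equiv:
  assumes "equivp E" "E X X'" "linked E W V X us Y"
  shows "linked E W V X' us Y"
proof -
  have "E X' Z" if "E X Z" for Z
    using equivp_transp[OF assms(1) equivp_symp[OF assms(1) assms(2)] that] .
  then show ?thesis using assms(3) by (cases us) simp_all
qed

text \<open>When opposite neighbours \<open>u\<close>, \<open>w\<close> add up to something negligible, the potential behind \<open>w\<close> is again
  the one in front of \<open>u\<close>, so the pair can be taken out of the list.  Here \<open>I\<close> says what counts as
  negligible, and \<open>g\<close> is an additive quantity, such as the sign at infinity, that takes opposite
  values on opposite elements.\<close>

lemma cancel_opposites:
  fixes us :: "'a::ab_group_add list" and g :: "'a \<Rightarrow> int"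
  assumes E: "equivp E"
    and opp: "\<And>u w. u \<in> S \<Longrightarrow> w \<in> S \<Longrightarrow> E (V u) (W w) \<Longrightarrow> opp u w \<Longrightarrow>
      I (u + w) \<and> E (V w) (W u) \<and> g u + g w = 0"
    and I: "I 0" "\<And>a b. I a \<Longrightarrow> I b \<Longrightarrow> I (a + b)"
    and us: "linked E W V X us Y" "set us \<subseteq> S"
  shows "\<exists>us'. linked E W V X us' Y \<and> set us' \<subseteq> S \<and> I (sum_list us - sum_list us')
    \<and> (even (length us') \<longleftrightarrow> even (length us)) \<and> successively (\<lambda>u w. \<not> opp u w) us'
    \<and> sum_list (map g us') = sum_list (map g us)"
  using us
proof (induction us arbitrary: X)
  case Nil
  then show ?case using I by (intro exI[of _ "[]"]) auto
next
  case (Cons u us)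
  have "linked E W V (V u) us Y" "set us \<subseteq> S" using Cons.prems by simp_all
  from Cons.IH[OF this] obtain us' where us': "linked E W V (V u) us' Y" "set us' \<subseteq> S" "I (sum_list us - sum_list us')"
      "even (length us') \<longleftrightarrow> even (length us)" "successively (\<lambda>u w. \<not> opp u w) us'"
      "sum_list (map g us') = sum_list (map g us)"
    by (elim exE conjE) (rule that)
  have X: "E X (W u)" using Cons.prems by simp
  show ?case
  proof (cases "\<exists>w ws. us' = w # ws \<and> opp u w")
    case True
    then obtain w ws where w: "us' = w # ws" "opp u w" by blast
    have "E (V u) (W w)" "linked E W V (V w) ws Y" using us' w by auto
    then have o: "I (u + w)" "E (V w) (W u)" "g u + g w = 0"
      using opp[of u w] w us' Cons.prems by auto
    have "E (V w) X" using o(2) X by (meson E equivp_symp equivp_transp)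
    then have "linked E W V X ws Y"
      using \<open>linked E W V (V w) ws Y\<close> by (rule linked_equiv[OF E])
    moreover have "I (sum_list (u # us) - sum_list ws)"
      using I(2)[OF o(1) us'(3)] by (simp add: w algebra_simps)
    ultimately show ?thesis
      using us' w o(3) by (intro exI[of _ ws]) (auto simp: successively_Cons)
  next
    case False
    then show ?thesis
      using us' X Cons.prems by (intro exI[of _ "u # us'"]) (auto simp: successively_Cons neq_Nil_conv)
  qed
qed


section \<open>The chain near a finite point\<close>

definition fls_equiv :: "complex fls \<Rightarrow> complex fls \<Rightarrow> bool" where
  "fls_equiv F G \<longleftrightarrow> order_ge (F - G) 0"

lemma equivp_fls_equiv: "equivp fls_equiv"
proof (rule equivpI)
  show "reflp fls_equiv" by (simp add: reflp_def fls_equiv_def)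
  show "symp fls_equiv" by (simp add: symp_def fls_equiv_def order_ge_def)
  show "transp fls_equiv" by (simp add: transp_def fls_equiv_def order_ge_def)
qed

text \<open>For \<open>F = u + w\<close> the hypothesis reads \<open>F' = F (w - u) + O(1)\<close>; since \<open>w - u\<close> has a pole of
  order \<open>n\<close>, the derivative is negligible and \<open>F\<close> has to vanish to order \<open>n\<close>.\<close>

lemma opposite_poles_cancel:
  assumes n: "n \<ge> 1" and u: "order_ge u (- n)" and w: "order_ge w (- n)"
    and u_lead: "u $$ (- n) \<noteq> 0" and opp: "u $$ (- n) + w $$ (- n) = 0"
    and link: "fls_equiv (upper fls_deriv u) (lower fls_deriv w)"
  shows "order_ge (u + w) n" "fls_equiv (upper fls_deriv w) (lower fls_deriv u)"
proof -
  define F where "F = u + w"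
  define H where "H = upper fls_deriv u - lower fls_deriv w"
  have H: "order_ge H 0" using link by (simp add: H_def fls_equiv_def)
  have eq: "fls_deriv F = F * (w - u) + H"
    by (simp add: F_def H_def upper_def lower_def algebra_simps power2_eq_square)
  have d: "order_ge (w - u) (- n)" using u w order_ge_diff by blast
  have d_lead: "(w - u) $$ (- n) \<noteq> 0" using u_lead opp by (simp add: add_eq_0_iff)
  have F: "order_ge F (1 - n)"
    unfolding order_ge_def
  proof (intro allI impI)
    fix k assume "k < 1 - n"
    then have "k = - n \<or> k < - n" by linarith
    then show "F $$ k = 0" using opp u w by (auto simp: F_def order_ge_def)
  qed
  show Fn: "order_ge (u + w) n"
  proof (rule ccontr)
    assume no: "\<not> order_ge (u + w) n"
    define m where "m = fls_subdegree F"
    have "F \<noteq> 0" using no by (auto simp: F_def)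
    then have m: "F $$ m \<noteq> 0" by (simp add: m_def)
    have Fm: "order_ge F m" by (simp add: m_def order_ge_subdegree)
    have "m < n" using no order_ge_mono[OF Fm] unfolding F_def by (metis linorder_not_le)
    moreover have "1 - n \<le> m" using F m by (metis order_geD linorder_not_le)
    ultimately have "n = 1 \<and> m = 0 \<or> m - n + 1 < m" using n by linarith
    then have "fls_deriv F $$ (m - n) = 0"
      using Fm by (auto simp: order_ge_def)
    moreover have "H $$ (m - n) = 0" using H \<open>m < n\<close> by (simp add: order_ge_def)
    moreover have "fls_deriv F $$ (m - n) = (F * (w - u)) $$ (m - n) + H $$ (m - n)"
      by (simp only: eq fls_plus_nth)
    ultimately have "(F * (w - u)) $$ (m - n) = 0" by (simp only: add_0_right)
    moreover have "(F * (w - u)) $$ (m - n) = F $$ m * (w - u) $$ (- n)"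
      using lead_mult(1)[OF Fm d] by simp
    ultimately show False using m d_lead by simp
  qed
  have "upper fls_deriv w - lower fls_deriv u = fls_deriv F + fls_deriv F - H"
    using eq by (simp add: F_def H_def upper_def lower_def algebra_simps power2_eq_square)
  moreover have "order_ge (fls_deriv F) 0"
    using order_ge_deriv[OF Fn] n by (auto simp: F_def intro: order_ge_mono)
  ultimately show "fls_equiv (upper fls_deriv w) (lower fls_deriv u)"
    using H by (simp only: fls_equiv_def order_ge_add order_ge_diff)
qed

lemma chain_linked:
  assumes "dressing_chain \<alpha> u"
  shows "fls_equiv (upper fls_deriv (expand c (u i))) (lower fls_deriv (expand c (u (i+1))))"
proof -
  have "lower fract_deriv (u (i+1)) = upper fract_deriv (u i) - 4 * rconst (\<alpha> i)"
    using assms by (rule chain_link)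
  also have "4 * rconst (\<alpha> i) = rconst (4 * \<alpha> i)" by (simp add: rconst_mult)
  finally have "expand c (lower fract_deriv (u (i+1)))
      = expand c (upper fract_deriv (u i) - rconst (4 * \<alpha> i))"
    by (rule arg_cong)
  then have "upper fls_deriv (expand c (u i)) - lower fls_deriv (expand c (u (i+1)))
     = fls_const (4 * \<alpha> i)"
    by (simp add: lower_def upper_def at.subst_deriv)
  then show ?thesis by (simp add: fls_equiv_def order_ge_const)
qed

definition cycle :: "6 list" where
  "cycle = [0, 1, 2, 3, 4, 5]"

lemma chain_linked_list:
  assumes "dressing_chain \<alpha> u"
  shows "linked fls_equiv (lower fls_deriv) (upper fls_deriv)
    (lower fls_deriv (expand c (u 0))) (map (\<lambda>i. expand c (u i)) cycle)
    (upper fls_deriv (expand c (u 5)))"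
  using chain_linked[OF assms, of c 0] chain_linked[OF assms, of c 1] chain_linked[OF assms, of c 2]
    chain_linked[OF assms, of c 3] chain_linked[OF assms, of c 4]
  by (simp add: cycle_def equivp_reflp[OF equivp_fls_equiv])

lemma sum_cycle: "sum_list (map f cycle) = (\<Sum>i\<in>UNIV. f i)"
  by (simp add: cycle_def sum_6 add.assoc)

lemma chain_sum_at:
  assumes "dressing_chain \<alpha> u"
  shows "sum_list (map (\<lambda>i. expand c (u i)) cycle) = 2 * (fls_const c + fls_X)"
proof -
  have "expand c (\<Sum>i\<in>UNIV. u i) = expand c (2 * tvar)"
    using chain_sum[OF assms] by (rule arg_cong)
  then show ?thesis by (simp add: sum_cycle)
qed

lemma common_order:
  fixes F :: "'i::finite \<Rightarrow> complex fls"
  assumes "F j $$ m \<noteq> 0"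
  obtains k where "k \<le> m" "\<And>i. order_ge (F i) k" "\<exists>i. F i $$ k \<noteq> 0"
proof
  let ?A = "{i. F i \<noteq> 0}"
  let ?k = "Min ((\<lambda>i. fls_subdegree (F i)) ` ?A)"
  have j: "j \<in> ?A" using assms by auto
  have "?k \<le> fls_subdegree (F j)" using j by (intro Min_le) auto
  also have "\<dots> \<le> m" using assms by (rule fls_subdegree_leI)
  finally show "?k \<le> m" .
  show "order_ge (F i) ?k" for i
  proof (cases "F i = 0")
    case False
    then have "?k \<le> fls_subdegree (F i)" by (intro Min_le) auto
    then show ?thesis using order_ge_subdegree order_ge_mono by blast
  qed simp
  have "?k \<in> (\<lambda>i. fls_subdegree (F i)) ` ?A" using j by (intro Min_in) auto
  then obtain i where "F i \<noteq> 0" "?k = fls_subdegree (F i)" by auto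
  then show "\<exists>i. F i $$ ?k \<noteq> 0" by (intro exI[of _ i]) simp
qed

lemma successively_same_lead:
  fixes f :: "'a \<Rightarrow> complex"
  assumes "successively (\<lambda>u w. f u + f w \<noteq> 0) us" "\<forall>u\<in>set us. (f u)\<^sup>2 = b"
  shows "\<exists>a. \<forall>u\<in>set us. f u = a"
  using assms
proof (induction us)
  case (Cons u us)
  then obtain a where a: "\<forall>w\<in>set us. f w = a" by (auto simp: successively_Cons)
  show ?case
  proof (cases us)
    case (Cons w ws)
    then have "(f u)\<^sup>2 = a\<^sup>2" "f u + a \<noteq> 0" using Cons.prems a by (auto simp: successively_Cons)
    then have "f u = a" by (auto simp: power2_eq_iff)
    then show ?thesis using a by auto
  qed auto
qed simp

lemma sum_list_nth_fls:
  fixes us :: "complex fls list"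
  shows "sum_list us $$ k = sum_list (map (\<lambda>u. u $$ k) us)"
  by (induction us) auto

lemma two_shift_nth:
  "(2 * (fls_const c + fls_X) :: complex fls) $$ k = (if k = 0 then 2 * c else if k = 1 then 2 else 0)"
  by (simp only: mult_2 fls_plus_nth fls_const_nth fls_X_nth) simp

lemma cancel_opposite_poles:
  assumes n: "n \<ge> 1"
    and us: "linked fls_equiv (lower fls_deriv) (upper fls_deriv) X us Y" "set us \<subseteq> S"
    and S: "\<forall>x\<in>S. order_ge x (- n) \<and> x $$ (- n) \<noteq> 0"
  obtains us' where "linked fls_equiv (lower fls_deriv) (upper fls_deriv) X us' Y" "set us' \<subseteq> S"
    "order_ge (sum_list us - sum_list us') n" "even (length us') \<longleftrightarrow> even (length us)"
    "successively (\<lambda>x y. x $$ (- n) + y $$ (- n) \<noteq> 0) us'"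
proof -
  have opp: "order_ge (x + y) n \<and> fls_equiv (upper fls_deriv y) (lower fls_deriv x) \<and> (0::int) + 0 = 0"
    if "x \<in> S" "y \<in> S" "fls_equiv (upper fls_deriv x) (lower fls_deriv y)"
      "x $$ (- n) + y $$ (- n) = 0" for x y
    using opposite_poles_cancel[of n x y] that S n by simp
  have "\<exists>us'. linked fls_equiv (lower fls_deriv) (upper fls_deriv) X us' Y \<and> set us' \<subseteq> S
    \<and> order_ge (sum_list us - sum_list us') n \<and> (even (length us') \<longleftrightarrow> even (length us))
    \<and> successively (\<lambda>x y. \<not> x $$ (- n) + y $$ (- n) = 0) us'
    \<and> sum_list (map (\<lambda>_. 0::int) us') = sum_list (map (\<lambda>_. 0) us)"
    by (rule cancel_opposites[where I = "\<lambda>x. order_ge x n", OF equivp_fls_equiv _ _ _ us])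
      (use opp order_ge_add in auto)
  then show thesis using that by blast
qed

text \<open>If the poles had order \<open>n > 1\<close>, neighbours would have equal or opposite leading coefficients,
  opposite neighbours would cancel up to order \<open>n\<close>, and what survives has all its leading
  coefficients equal. As the sum \<open>2t\<close> has no pole nothing survives; but then \<open>2t\<close> would vanish at
  \<open>c\<close> to order at least two.\<close>

lemma chain_simple_poles:
  assumes chain: "dressing_chain \<alpha> u"
  shows "order_ge (expand c (u i)) (- 1)"
proof (rule ccontr)
  assume "\<not> order_ge (expand c (u i)) (- 1)"
  then obtain m where m: "m < - 1" "expand c (u i) $$ m \<noteq> 0" by (auto simp: order_ge_def)
  define F where "F j = expand c (u j)" for j
  have "F i $$ m \<noteq> 0" using m by (simp add: F_def)
  then obtain k where km: "k \<le> m" and Fk: "\<And>j. order_ge (F j) k" and "\<exists>j. F j $$ k \<noteq> 0"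
    by (rule common_order) (rule that)
  then obtain j0 where j0: "F j0 $$ k \<noteq> 0" by blast
  \<comment> \<open>\<open>k\<close> is the exponent of the leading terms, so the poles have order \<open>n = - k\<close>\<close>
  define n where "n = - k"
  have n: "n \<ge> 2" "k = - n" using km m(1) unfolding n_def by linarith+
  have link: "fls_equiv (upper fls_deriv (F j)) (lower fls_deriv (F (j+1)))" for j
    unfolding F_def by (rule chain_linked[OF chain])
  have sq: "(F j $$ k)\<^sup>2 = (F j0 $$ k)\<^sup>2" for j
  proof (rule cycle_induct[where P = "\<lambda>j. (F j $$ k)\<^sup>2 = (F j0 $$ k)\<^sup>2" and i = j0])
    fix j assume IH: "(F j $$ k)\<^sup>2 = (F j0 $$ k)\<^sup>2"
    have der: "fls_deriv (F l) $$ (k + k) = 0" for l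
      using Fk[of l] n by (simp add: order_ge_def)
    have "(upper fls_deriv (F j) - lower fls_deriv (F (j+1))) $$ (k + k) = 0"
      using link[of j] n by (simp add: fls_equiv_def order_ge_def)
    then have "(F j * F j) $$ (k + k) = (F (j+1) * F (j+1)) $$ (k + k)"
      using der by (simp add: upper_def lower_def power2_eq_square del: fls_deriv_nth)
    then show "(F (j + 1) $$ k)\<^sup>2 = (F j0 $$ k)\<^sup>2"
      using IH by (simp only: lead_mult(1)[OF Fk Fk] power2_eq_square)
  qed simp
  define S where "S = {x. order_ge x k \<and> (x $$ k)\<^sup>2 = (F j0 $$ k)\<^sup>2}"
  let ?us = "map F cycle"
  have linked: "linked fls_equiv (lower fls_deriv) (upper fls_deriv) (lower fls_deriv (F 0)) ?us
      (upper fls_deriv (F 5))"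
    unfolding F_def using chain_linked_list[OF chain] by (simp add: comp_def)
  have us: "set ?us \<subseteq> S" using Fk sq by (auto simp: S_def)
  have S: "\<forall>x\<in>S. order_ge x (- n) \<and> x $$ (- n) \<noteq> 0"
    using j0 n by (auto simp: S_def)
  have "1 \<le> n" using n by simp
  from this linked us S obtain us' where us': "set us' \<subseteq> S" "order_ge (sum_list ?us - sum_list us') n"
    "successively (\<lambda>x y. x $$ (- n) + y $$ (- n) \<noteq> 0) us'"
    by (rule cancel_opposite_poles) (rule that)
  obtain a where a: "\<forall>x\<in>set us'. x $$ k = a"
    using successively_same_lead[OF us'(3)[folded n(2)], of "(F j0 $$ k)\<^sup>2"] us'(1)
    by (auto simp: S_def)
  have sum: "sum_list ?us = 2 * (fls_const c + fls_X)"
    using chain_sum_at[OF chain, of c] by (simp only: F_def[abs_def])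
  have "(sum_list ?us - sum_list us') $$ k = 0" using us'(2) n by (simp add: order_ge_def)
  then have "sum_list us' $$ k = 0" using n by (simp add: sum two_shift_nth)
  moreover have "sum_list us' $$ k = of_nat (length us') * a"
    unfolding sum_list_nth_fls using a by (induction us') (auto simp: algebra_simps)
  moreover have "a \<noteq> 0" if "us' \<noteq> []"
    using that a us'(1) j0 by (cases us') (auto simp: S_def)
  ultimately have "us' = []" by auto
  then have "sum_list ?us $$ 1 = 0" using us'(2) n by (simp add: order_ge_def)
  then show False by (simp add: sum two_shift_nth)
qed

text \<open>The coefficients of \<open>(t - c)\<^sup>-\<^sup>2\<close> on the two sides of a link.\<close>

lemma residue_link:
  assumes "order_ge x (- 1)" "order_ge y (- 1)" "fls_equiv (upper fls_deriv x) (lower fls_deriv y)"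
  shows "(x $$ - 1) * (x $$ - 1) - x $$ - 1 = (y $$ - 1) * (y $$ - 1) + y $$ - 1"
proof -
  have "(upper fls_deriv x - lower fls_deriv y) $$ (- 1 + - 1) = 0"
    using assms(3) unfolding fls_equiv_def order_ge_def by simp
  then have "(x * x) $$ (- 1 + - 1) - (y * y) $$ (- 1 + - 1) = x $$ - 1 + y $$ - 1"
    by (simp add: upper_def lower_def power2_eq_square algebra_simps)
  then show ?thesis
    unfolding lead_mult(1)[OF assms(1) assms(1)] lead_mult(1)[OF assms(2) assms(2)]
    by (simp add: algebra_simps)
qed

lemma residue_step:
  fixes r s :: complex
  assumes "r * r - r = s * s + s"
  shows "s = - r \<or> s = r - 1"
proof -
  have "(s + r) * (s - (r - 1)) = 0" using assms by (simp add: algebra_simps)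
  then show ?thesis by (auto simp: add_eq_0_iff)
qed

lemma chain_residue_step:
  assumes chain: "dressing_chain \<alpha> u"
  shows "expand c (u (i+1)) $$ - 1 = - (expand c (u i) $$ - 1)
    \<or> expand c (u (i+1)) $$ - 1 = expand c (u i) $$ - 1 - 1"
  using residue_link[of "expand c (u i)" "expand c (u (i+1))", OF chain_simple_poles[OF chain] chain_simple_poles[OF chain] chain_linked[OF chain]]
  by (rule residue_step)

lemma residue_step_Ints:
  fixes r s :: complex
  assumes "s = - r \<or> s = r - 1"
  shows "s \<in> \<int> \<longleftrightarrow> r \<in> \<int>"
  using assms
proof
  assume "s = r - 1"
  then show ?thesis using Ints_add[of s 1] Ints_diff[of r 1] by auto
qed (simp add: minus_in_Ints_iff)

lemma successively_decreasing:
  fixes f :: "'a \<Rightarrow> complex"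
  assumes "successively (\<lambda>u w. f w = f u - 1) us" "k < length us"
  shows "f (us ! k) = f (hd us) - of_nat k"
  using assms(2)
proof (induction k)
  case (Suc k)
  then have "f (us ! Suc k) = f (us ! k) - 1"
    using assms(1) by (simp add: successively_conv_nth)
  then show ?case using Suc by simp
qed (simp add: hd_conv_nth)

text \<open>At a point \<open>c \<noteq> 0\<close>, non-integral residues would all cancel in the same way.  What survives has
  only steps \<open>r \<mapsto> r - 1\<close>; an even number of such residues that closes up is symmetric about \<open>0\<close>
  and contains \<open>1/2\<close> next to \<open>- 1/2\<close>, a pair that cancels.  So nothing survives and \<open>2 t\<close> would
  vanish at \<open>c\<close>.\<close>

lemma chain_residues_integral:
  assumes chain: "dressing_chain \<alpha> u" and c: "c \<noteq> 0"
  shows "expand c (u i) $$ - 1 \<in> \<int>"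
proof (rule ccontr)
  assume no: "expand c (u i) $$ - 1 \<notin> \<int>"
  define F where "F j = expand c (u j)" for j
  have Fo: "order_ge (F j) (- 1)" for j
    unfolding F_def by (rule chain_simple_poles[OF chain])
  have link: "fls_equiv (upper fls_deriv (F j)) (lower fls_deriv (F (j+1)))" for j
    unfolding F_def by (rule chain_linked[OF chain])
  have nonint: "F j $$ - 1 \<notin> \<int>" for j
  proof (rule cycle_induct[where P = "\<lambda>j. F j $$ - 1 \<notin> \<int>" and i = i])
    show "F i $$ - 1 \<notin> \<int>" using no by (simp add: F_def)
    fix j assume "F j $$ - 1 \<notin> \<int>"
    then show "F (j+1) $$ - 1 \<notin> \<int>"
      using residue_step_Ints[OF chain_residue_step[OF chain, of c j]] by (simp add: F_def)
  qed
  define S where "S = {x. order_ge x (- 1) \<and> x $$ - 1 \<notin> \<int>}"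
  let ?us = "map F cycle" and ?X = "lower fls_deriv (F 0)" and ?Y = "upper fls_deriv (F 5)"
  have linked: "linked fls_equiv (lower fls_deriv) (upper fls_deriv) ?X ?us ?Y"
    unfolding F_def using chain_linked_list[OF chain] by (simp add: comp_def)
  have us: "set ?us \<subseteq> S" using Fo nonint by (auto simp: S_def)
  have S: "\<forall>x\<in>S. order_ge x (- 1) \<and> x $$ (- 1) \<noteq> 0"
    by (auto simp: S_def)
  from order_refl linked us S obtain us' where us': "linked fls_equiv (lower fls_deriv) (upper fls_deriv) ?X us' ?Y"
    "set us' \<subseteq> S" "order_ge (sum_list ?us - sum_list us') 1"
    "even (length us') \<longleftrightarrow> even (length ?us)"
    "successively (\<lambda>x y. x $$ - 1 + y $$ - 1 \<noteq> 0) us'"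
    by (rule cancel_opposite_poles) (rule that)
  have sum: "sum_list ?us = 2 * (fls_const c + fls_X)"
    using chain_sum_at[OF chain, of c] by (simp only: F_def[abs_def])
  show False
  proof (cases us')
    case Nil
    then have "sum_list ?us $$ 0 = 0" using us'(3) by (simp add: order_ge_def)
    then show False using c by (simp add: sum two_shift_nth)
  next
    case (Cons x xs)
    have step: "successively (\<lambda>x y. y $$ - 1 = x $$ - 1 - 1) us'"
      if "linked fls_equiv (lower fls_deriv) (upper fls_deriv) Z us' Y" for Z Y
      using that us'(2,5)
    proof (induction us' arbitrary: Z)
      case (Cons x xs)
      show ?case
      proof (cases xs)
        case (Cons y ys)
        then have "fls_equiv (upper fls_deriv x) (lower fls_deriv y)" "x \<in> S" "y \<in> S"
          "x $$ - 1 + y $$ - 1 \<noteq> 0"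
          using Cons.prems by auto
        then have "y $$ - 1 = x $$ - 1 - 1"
          using residue_step[OF residue_link[of x y]] by (auto simp: S_def)
        then show ?thesis using Cons Cons.prems Cons.IH[of "upper fls_deriv x"] by auto
      qed simp
    qed simp
    have last: "fls_equiv (upper fls_deriv (last us')) ?Y"
      if "linked fls_equiv (lower fls_deriv) (upper fls_deriv) Z us' Y" "us' \<noteq> []" "Y = ?Y" for Z Y
      using that by (induction us' arbitrary: Z) auto
    define r where "r = hd us' $$ - 1"
    define m where "m = length us'"
    have m: "m > 0" "even m" using us'(4) Cons by (auto simp: m_def cycle_def)
    have nth: "us' ! k $$ - 1 = r - of_nat k" if "k < m" for k
      using successively_decreasing[OF step[OF us'(1)]] that by (simp add: r_def m_def)
    have "fls_equiv (upper fls_deriv (last us')) (lower fls_deriv (hd us'))"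
    proof -
      have "fls_equiv (upper fls_deriv (last us')) ?Y" using last[OF us'(1)] Cons by simp
      moreover have "fls_equiv ?Y ?X" using link[of 5] by simp
      moreover have "fls_equiv ?X (lower fls_deriv (hd us'))" using us'(1) Cons by simp
      ultimately show ?thesis using equivp_fls_equiv by (meson equivp_transp)
    qed
    moreover have "order_ge (last us') (- 1)" "order_ge (hd us') (- 1)"
      using us'(2) Cons last_in_set[of us'] hd_in_set[of us'] by (auto simp: S_def simp del: last.simps)
    ultimately have "(last us' $$ - 1) * (last us' $$ - 1) - last us' $$ - 1 = r * r + r"
      using residue_link r_def by blast
    moreover have "last us' $$ - 1 = r - of_nat (m - 1)"
    proof -
      have "us' \<noteq> []" using Cons by simp
      then have "last us' = us' ! (m - 1)" by (simp add: last_conv_nth m_def)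
      moreover have "m - 1 < m" using m(1) by simp
      ultimately show ?thesis using nth[of "m - 1"] by (simp only:)
    qed
    \<comment> \<open>the residues are \<open>r, r - 1, \<dots>, r - (m - 1)\<close>, and the link from the last to the first closes up\<close>
    ultimately have "of_nat m * (of_nat m - 1 - 2 * r) = 0"
      using m by (simp add: of_nat_diff algebra_simps)
    then have "(of_nat m :: complex) = 0 \<or> of_nat m - 1 - 2 * r = 0" by (simp only: mult_eq_0_iff)
    then have "of_nat m - 1 - 2 * r = 0" using m(1) by simp
    then have r: "r = (of_nat m - 1) / 2" by (simp add: algebra_simps)
    obtain l where l: "m = 2 * l" using m by blast
    have "us' ! (l - 1) $$ - 1 + us' ! l $$ - 1 = 0"
    proof -
      have l1: "l - 1 < m" "l < m" and "1 \<le> l" using m(1) l by linarith+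
      then have "of_nat (l - 1) = (of_nat l - 1 :: complex)" by (simp add: of_nat_diff)
      moreover have "(of_nat m :: complex) = 2 * of_nat l" using l by simp
      ultimately have "r - of_nat (l - 1) + (r - of_nat l) = 0" by (simp only: r) simp
      then show ?thesis using nth[OF l1(1)] nth[OF l1(2)] by (simp only:)
    qed
    moreover have "us' ! (l - 1) $$ - 1 + us' ! Suc (l - 1) $$ - 1 \<noteq> 0"
      using us'(5)[unfolded successively_conv_nth, rule_format, of "l - 1"] m l
      unfolding m_def by linarith
    moreover have "Suc (l - 1) = l" using m(1) l by linarith
    ultimately show False by simp
  qed
qed

section \<open>Partial fractions and residues\<close>

lemma order_ge_divide:
  assumes "order_ge F 0" "order_ge G 0" "G $$ 0 \<noteq> 0"
  shows "order_ge (F / G) 0"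
proof (cases "F / G = 0")
  case False
  let ?H = "F / G"
  have "G \<noteq> 0" using assms(3) by auto
  then have FH: "F = ?H * G" by simp
  have "(?H * G) $$ (fls_subdegree ?H + 0) = ?H $$ fls_subdegree ?H * G $$ 0"
    by (rule lead_mult(1)[OF order_ge_subdegree assms(2)])
  then have "F $$ fls_subdegree ?H \<noteq> 0"
    using False assms(3) FH by simp
  then have "0 \<le> fls_subdegree ?H" using assms(1) by (meson order_geD not_le)
  then show ?thesis using order_ge_subdegree order_ge_mono by blast
qed (simp only: order_ge_0)

lemma order_ge_expand_poly: "order_ge (expand c (to_fract p)) 0"
  by (simp add: poly_value_fls_at order_ge_def)

lemma expand_poly_nth_0: "expand c (to_fract p) $$ 0 = poly p c"
  by (simp add: poly_value_fls_at poly_pcompose flip: poly_0_coeff_0)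

lemma order_ge_expand_Fract:
  assumes "poly q c \<noteq> 0"
  shows "order_ge (expand c (Fract p q)) 0"
proof -
  have "q \<noteq> 0" using assms by auto
  then have "Fract p q = to_fract p / to_fract q" by (simp add: to_fract_def)
  then have "expand c (Fract p q) = expand c (to_fract p) / expand c (to_fract q)"
    by (simp only: at.subst_divide)
  moreover have "order_ge (expand c (to_fract p) / expand c (to_fract q)) 0"
    by (intro order_ge_divide order_ge_expand_poly) (simp only: expand_poly_nth_0 assms not_False_eq_True)
  ultimately show ?thesis by simp
qed

lemma finite_poles: "finite {c. \<not> order_ge (expand c r) 0}"
proof (cases r)
  case (Fract p q)
  then have "{c. \<not> order_ge (expand c r) 0} \<subseteq> {c. poly q c = 0}"
    using order_ge_expand_Fract by blast
  then show ?thesis using Fract poly_roots_finite finite_subset by blast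
qed

text \<open>A root of the denominator in lowest terms is a pole, so the denominator has none.\<close>

lemma polynomial_if_no_poles:
  assumes reg: "\<And>c. order_ge (expand c r) 0"
  obtains p where "r = to_fract p"
proof -
  obtain p q where pq: "quot_of_fract r = (p, q)" by (cases "quot_of_fract r")
  have q: "q \<noteq> 0" using snd_quot_of_fract_nonzero[of r] pq by simp
  have r: "r = to_fract p / to_fract q"
    using Fract_quot_of_fract[of r] pq q by (simp add: to_fract_def)
  have cop: "coprime p q" using coprime_quot_of_fract[of r] pq by simp
  have "poly q c \<noteq> 0" for c
  proof
    assume c: "poly q c = 0"
    have "expand c (to_fract q) \<noteq> 0" using q by (simp del: at.subst_to_fract)
    then have "expand c (to_fract p) = expand c r * expand c (to_fract q)"
      unfolding r by simp
    moreover have "(expand c r * expand c (to_fract q)) $$ (0 + 0) = 0"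
      unfolding lead_mult(1)[OF reg order_ge_expand_poly] by (simp only: expand_poly_nth_0 c mult_zero_right)
    ultimately have "poly p c = 0" using expand_poly_nth_0[of c p] by simp
    then have "[:- c, 1:] dvd p" "[:- c, 1:] dvd q" using c by (simp_all add: poly_eq_0_iff_dvd)
    then have "is_unit [:- c, 1:]" using cop by (rule coprime_common_divisor[rotated])
    then show False by (simp add: is_unit_iff_degree)
  qed
  then have "constant (poly q)" using fundamental_theorem_of_algebra by blast
  then have "degree q = 0" by (simp add: constant_degree)
  then obtain a where a: "q = [:a:]" by (rule degree_eq_zeroE)
  have "r = to_fract (smult (inverse a) p)"
    using a q unfolding r to_fract_def by (simp add: eq_fract)
  then show thesis by (rule that)
qed

lemma expand_simple_fraction:
  "order_ge (expand d (rconst a / (tvar - rconst c))) (- 1)"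
  "expand d (rconst a / (tvar - rconst c)) $$ - 1 = (if d = c then a else 0)"
proof -
  let ?F = "expand d (rconst a / (tvar - rconst c))"
  have F: "?F = fls_const a / (fls_const (d - c) + fls_X)"
    by (simp add: fls_minus_const[symmetric] algebra_simps)
  have "order_ge ?F (- 1) \<and> ?F $$ - 1 = (if d = c then a else 0)"
  proof (cases "d = c")
    case True
    then have "?F = fls_const a * fls_X_inv"
      unfolding F by (simp add: field_class.field_divide_inverse fls_inverse_X)
    then show ?thesis using True by (auto simp: order_ge_def fls_X_inv_times_conv_shift mult.commute)
  next
    case False
    then have "order_ge ?F 0"
      unfolding F by (intro order_ge_divide order_ge_add order_ge_const) (auto simp: order_ge_def)
    then show ?thesis using False by (auto simp: order_ge_def)
  qed
  then show "order_ge ?F (- 1)" "?F $$ - 1 = (if d = c then a else 0)" by blast+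
qed

lemma expand_infty_simple_fraction:
  "expand_infty (rconst a / (tvar - rconst c)) $$ 1 = a"
proof (cases "a = 0")
  case False
  let ?F = "expand_infty (rconst a / (tvar - rconst c))" and ?G = "fls_X_inv - fls_const c"
  have G: "order_ge ?G (- 1)" "?G $$ - 1 = 1" by (auto simp: order_ge_def)
  then have "?G \<noteq> 0" by (metis fls_zero_nth zero_neq_one)
  then have FG: "?F * ?G = fls_const a" by simp
  have "?F \<noteq> 0" using FG False by auto
  have "(?F * ?G) $$ (fls_subdegree ?F + - 1) = ?F $$ fls_subdegree ?F * ?G $$ - 1"
    by (rule lead_mult(1)[OF order_ge_subdegree G(1)])
  then have "fls_const a $$ (fls_subdegree ?F + - 1) = ?F $$ fls_subdegree ?F"
    unfolding FG G(2) by simp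
  moreover have "?F $$ fls_subdegree ?F \<noteq> 0" using \<open>?F \<noteq> 0\<close> by (rule nth_fls_subdegree_nonzero)
  ultimately show ?thesis by (auto split: if_splits)
qed simp

definition poles :: "ratfun \<Rightarrow> complex set" where
  "poles r = {c. expand c r $$ - 1 \<noteq> 0}"

lemma sum_fls_nth: "(\<Sum>i\<in>A. F i) $$ k = (\<Sum>i\<in>A. (F i :: complex fls) $$ k)"
  by (induction A rule: infinite_finite_induct) auto

lemma partial_fractions:
  assumes simple: "\<And>c. order_ge (expand c r) (- 1)"
  shows "finite (poles r)"
    and "\<exists>p. r = to_fract p + (\<Sum>c\<in>poles r. rconst (expand c r $$ - 1) / (tvar - rconst c))"
proof -
  have "poles r \<subseteq> {c. \<not> order_ge (expand c r) 0}" by (auto simp: poles_def order_ge_def intro!: exI[of _ "- 1"])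
  then show fin: "finite (poles r)" using finite_poles finite_subset by blast
  define s where "s = (\<Sum>c\<in>poles r. rconst (expand c r $$ - 1) / (tvar - rconst c))"
  have "order_ge (expand d (r - s)) 0" for d
  proof -
    have "expand d s $$ - 1 = (\<Sum>c\<in>poles r. if d = c then expand c r $$ - 1 else 0)"
      by (simp only: s_def at.subst_sum sum_fls_nth expand_simple_fraction)
    also have "\<dots> = expand d r $$ - 1"
      using fin by (auto simp: poles_def)
    finally have "expand d (r - s) $$ - 1 = 0" by simp
    moreover have "order_ge (expand d s) (- 1)"
      unfolding s_def at.subst_sum by (intro order_ge_sum expand_simple_fraction)
    then have "order_ge (expand d (r - s)) (- 1)" using simple[of d] by (simp add: order_ge_diff)
    ultimately show ?thesis
      unfolding order_ge_def by (metis int_one_le_iff_zero_less le_less neg_0_less_iff_less not_le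
        zle_add1_eq_le add.commute add.right_inverse linorder_neqE)
  qed
  then obtain p where "r - s = to_fract p" using polynomial_if_no_poles by blast
  then have "r = to_fract p + s" by (simp add: diff_eq_eq)
  then show "\<exists>p. r = to_fract p + (\<Sum>c\<in>poles r. rconst (expand c r $$ - 1) / (tvar - rconst c))"
    unfolding s_def by blast
qed

lemma expand_infty_poly_nth_1: "expand_infty (to_fract p) $$ 1 = 0"
  by (simp add: poly_value_fls_infty)

lemma residue_theorem:
  assumes simple: "\<And>c. order_ge (expand c r) (- 1)"
  shows "expand_infty r $$ 1 = (\<Sum>c\<in>poles r. expand c r $$ - 1)"
proof -
  obtain p where p: "r = to_fract p + (\<Sum>c\<in>poles r. rconst (expand c r $$ - 1) / (tvar - rconst c))"
    using partial_fractions(2)[OF simple] by blast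
  show ?thesis
    by (subst p) (simp only: infty.subst_add infty.subst_sum fls_plus_nth sum_fls_nth
        expand_infty_simple_fraction expand_infty_poly_nth_1 add_0)
qed

text \<open>Substituting \<open>- t\<close> in the partial fraction decomposition moves the pole at \<open>c\<close> to \<open>- c\<close>.\<close>

lemma odd_residue:
  assumes simple: "\<And>c. order_ge (expand c r) (- 1)" and odd: "reflect r = - r"
  shows "expand (- d) r $$ - 1 = expand d r $$ - 1"
proof -
  let ?a = "\<lambda>c. expand c r $$ - 1"
  obtain p where p: "r = to_fract p + (\<Sum>c\<in>poles r. rconst (?a c) / (tvar - rconst c))"
    using partial_fractions(2)[OF simple] by blast
  have "- r = reflect (to_fract p + (\<Sum>c\<in>poles r. rconst (?a c) / (tvar - rconst c)))"
    using p odd by simp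
  also have "\<dots> = to_fract (pcompose p [:0, - 1:]) + (\<Sum>c\<in>poles r. rconst (?a c) / (- tvar - rconst c))"
    by (simp add: poly_value_reflection)
  finally have "r = - (to_fract (pcompose p [:0, - 1:])
      + (\<Sum>c\<in>poles r. rconst (?a c) / (- tvar - rconst c)))"
    by (metis minus_minus)
  then have "r = - to_fract (pcompose p [:0, - 1:]) - (\<Sum>c\<in>poles r. rconst (?a c) / (- tvar - rconst c))"
    by (simp only: minus_add_distrib diff_conv_add_uminus)
  also have "(\<Sum>c\<in>poles r. rconst (?a c) / (- tvar - rconst c))
     = - (\<Sum>c\<in>poles r. rconst (?a c) / (tvar - rconst (- c)))"
    unfolding sum_negf[symmetric]
  proof (rule sum.cong)
    fix c
    have "- tvar - rconst c = - (tvar - rconst (- c))" by (simp add: rconst_minus)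
    then show "rconst (?a c) / (- tvar - rconst c) = - (rconst (?a c) / (tvar - rconst (- c)))"
      by (simp only: minus_divide_right)
  qed simp
  finally have r: "r = to_fract (- pcompose p [:0, - 1:])
      + (\<Sum>c\<in>poles r. rconst (?a c) / (tvar - rconst (- c)))"
    by (simp add: to_fract_uminus)
  have "expand d r $$ - 1 = (\<Sum>c\<in>poles r. if d = - c then ?a c else 0)"
    by (subst r) (simp only: at.subst_add at.subst_sum fls_plus_nth sum_fls_nth
        expand_simple_fraction(2) order_geD[OF order_ge_expand_poly] neg_less_0_iff_less zero_less_one add_0)
  also have "\<dots> = (\<Sum>c\<in>poles r. if c = - d then ?a c else 0)"
    by (intro sum.cong) auto
  also have "\<dots> = ?a (- d)"
    using partial_fractions(1)[OF simple] by (auto simp: poles_def)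
  finally show ?thesis by simp
qed

text \<open>The poles of an odd function other than \<open>0\<close> come in pairs \<open>\<plusminus> c\<close> with equal residues; \<open>H\<close> picks one
  of each pair.\<close>

lemma odd_residue_theorem:
  assumes simple: "\<And>c. order_ge (expand c r) (- 1)" and odd: "reflect r = - r"
  obtains H where "finite H" "0 \<notin> H" "H \<subseteq> poles r"
    "expand_infty r $$ 1 = expand 0 r $$ - 1 + 2 * (\<Sum>c\<in>H. expand c r $$ - 1)"
proof -
  let ?a = "\<lambda>c. expand c r $$ - 1"
  define H where "H = {c \<in> poles r. Re c > 0 \<or> Re c = 0 \<and> Im c > 0}"
  have fin: "finite (poles r)" by (rule partial_fractions(1)[OF simple])
  have sym: "?a (- c) = ?a c" for c by (rule odd_residue[OF simple odd])
  have split: "poles r - {0} = H \<union> uminus ` H"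
  proof (intro equalityI subsetI)
    fix c assume c: "c \<in> poles r - {0}"
    show "c \<in> H \<union> uminus ` H"
    proof (cases "c \<in> H")
      case False
      then have "- c \<in> H" using c by (auto simp: H_def poles_def sym complex_eq_iff)
      then show ?thesis by (metis UnI2 image_eqI minus_minus)
    qed simp
  next
    fix c assume "c \<in> H \<union> uminus ` H"
    then show "c \<in> poles r - {0}" by (auto simp: H_def poles_def sym)
  qed
  have "expand_infty r $$ 1 = (\<Sum>c\<in>poles r. ?a c)" by (rule residue_theorem[OF simple])
  also have "\<dots> = ?a 0 + (\<Sum>c\<in>poles r - {0}. ?a c)"
    using fin by (cases "0 \<in> poles r") (auto simp: sum.remove poles_def)
  also have "(\<Sum>c\<in>poles r - {0}. ?a c) = sum ?a H + sum ?a (uminus ` H)"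
    unfolding split using fin by (intro sum.union_disjoint) (auto simp: H_def)
  also have "sum ?a (uminus ` H) = sum ?a H"
    by (subst sum.reindex) (auto simp: sym)
  finally have "expand_infty r $$ 1 = ?a 0 + 2 * sum ?a H" by simp
  then show thesis using that[of H] fin by (auto simp: H_def)
qed

section \<open>The chain near infinity\<close>

definition asymptotic :: "int \<Rightarrow> ratfun \<Rightarrow> bool" where
  "asymptotic \<sigma> r \<longleftrightarrow> \<not> pole_at_infinity (r - rconst (of_int \<sigma>) * tvar)"

lemma asymptotic_iff:
  "asymptotic \<sigma> r \<longleftrightarrow> order_ge (expand_infty r) (- 1) \<and> expand_infty r $$ - 1 = of_int \<sigma>"
proof -
  have nth: "expand_infty (r - rconst (of_int \<sigma>) * tvar) $$ n
      = expand_infty r $$ n - (if n = - 1 then of_int \<sigma> else 0)" for n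
    by simp
  show ?thesis
    unfolding asymptotic_def pole_at_infinity_iff not_not order_ge_def nth by fastforce
qed

lemma asymptotic_add: "asymptotic s a \<Longrightarrow> asymptotic s' b \<Longrightarrow> asymptotic (s + s') (a + b)"
  by (simp add: asymptotic_iff order_ge_add)

lemma asymptotic_minus: "asymptotic s a \<Longrightarrow> asymptotic (- s) (- a)"
  by (simp add: asymptotic_iff order_ge_minus)

definition infinity_signs :: "(6 \<Rightarrow> int) \<Rightarrow> (6 \<Rightarrow> ratfun) \<Rightarrow> bool" where
  "infinity_signs \<sigma> u \<longleftrightarrow> (\<forall>i. (\<sigma> i = 1 \<or> \<sigma> i = - 1) \<and> asymptotic (\<sigma> i) (u i))"

lemma infinity_signsD:
  assumes "infinity_signs \<sigma> u"
  shows "\<sigma> i = 1 \<or> \<sigma> i = - 1" "order_ge (expand_infty (u i)) (- 1)"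
    "expand_infty (u i) $$ - 1 = of_int (\<sigma> i)"
  using assms unfolding infinity_signs_def asymptotic_iff by blast+

lemma chain_link_infty:
  assumes "dressing_chain \<alpha> u"
  shows "upper deriv_infty (expand_infty (u i)) - lower deriv_infty (expand_infty (u (i+1)))
    = fls_const (4 * \<alpha> i)"
proof -
  have "lower fract_deriv (u (i+1)) = upper fract_deriv (u i) - 4 * rconst (\<alpha> i)"
    using assms by (rule chain_link)
  also have "4 * rconst (\<alpha> i) = rconst (4 * \<alpha> i)" by (simp add: rconst_mult)
  finally have "expand_infty (lower fract_deriv (u (i+1)))
      = expand_infty (upper fract_deriv (u i) - rconst (4 * \<alpha> i))"
    by (rule arg_cong)
  then show ?thesis by (simp add: lower_def upper_def infty.subst_deriv)
qed

lemma chain_sum_infty: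
  assumes "dressing_chain \<alpha> u"
  shows "(\<Sum>i\<in>UNIV. expand_infty (u i) $$ k) = (if k = - 1 then 2 else 0)"
proof -
  have "expand_infty (\<Sum>i\<in>UNIV. u i) $$ k = expand_infty (2 * tvar) $$ k"
    using chain_sum[OF assms] by (rule arg_cong)
  moreover have "expand_infty (2 * tvar) = fls_X_inv + fls_X_inv"
    by (simp only: infty.subst_mult infty.subst_numeral infty.subst_tvar
        mult_2[of "fls_X_inv :: complex fls"])
  ultimately have "(\<Sum>i\<in>UNIV. expand_infty (u i) $$ k) = (fls_X_inv + fls_X_inv :: complex fls) $$ k"
    by (simp only: infty.subst_sum sum_fls_nth)
  then show ?thesis by simp
qed

lemma sum_signs:
  assumes "dressing_chain \<alpha> u" "infinity_signs \<sigma> u"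
  shows "(\<Sum>i\<in>UNIV. \<sigma> i) = 2"
proof -
  have "of_int (\<Sum>i\<in>UNIV. \<sigma> i) = (\<Sum>i\<in>UNIV. expand_infty (u i) $$ - 1)"
    using infinity_signsD(3)[OF assms(2)] by simp
  also have "\<dots> = of_int 2" using chain_sum_infty[OF assms(1), of "- 1"] by simp
  finally show ?thesis by (simp only: of_int_eq_iff)
qed

lemma sum_6_shift: "(\<Sum>j\<in>UNIV. f j) = f i + f (i+1) + f (i+2) + f (i+3) + f (i+4) + f (i+5 :: 6)"
proof -
  have "(\<Sum>j\<in>UNIV. f j) = (\<Sum>d\<in>UNIV. f (i + d))"
    by (rule sum.reindex_bij_witness[of _ "\<lambda>d. i + d" "\<lambda>j. j - i"]) simp_all
  then show ?thesis by (simp add: sum_6)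
qed

text \<open>Let \<open>n\<close> be the maximal order of growth of the \<open>u i\<close> and \<open>a i\<close> the coefficient of \<open>t\<^sup>n\<close>.  The
  chain forces \<open>a (i+1) = \<plusminus> a i\<close>, with the plus sign precisely where \<open>f i\<close> has a pole.  For each of
  the three pole patterns of type A the coefficients then add up to \<open>2 a i\<close>, which is nonzero;
  comparison with the sum \<open>2 t\<close> gives \<open>n = 1\<close> and \<open>a i = 1\<close> at the index \<open>i\<close> of the pattern.\<close>

lemma type_A_infinity_signs:
  assumes chain: "dressing_chain \<alpha> u" and A: "type_A (sols u)"
  obtains \<sigma> where "infinity_signs \<sigma> u"
proof -
  define U where "U j = expand_infty (u j)" for j
  define G where "G j = expand_infty (sols u j)" for j
  have G_nth: "G j $$ n + G j $$ n = U j $$ n + U (j+1) $$ n" for j n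
  proof -
    have "sols u j + sols u j = u j + u (j+1)" by (simp add: sols_def)
    then have "expand_infty (sols u j + sols u j) = expand_infty (u j + u (j+1))" by simp
    then have "G j + G j = U j + U (j+1)" by (simp only: G_def U_def infty.subst_add)
    then show ?thesis by (metis fls_plus_nth)
  qed
  have pole: "pole_at_infinity (sols u j) \<longleftrightarrow> (\<exists>n<0. U j $$ n + U (j+1) $$ n \<noteq> 0)" for j
  proof -
    have "G j $$ n = 0 \<longleftrightarrow> U j $$ n + U (j+1) $$ n = 0" for n
      unfolding G_nth[symmetric] by (simp flip: mult_2)
    then show ?thesis by (simp add: pole_at_infinity_iff order_ge_def G_def[symmetric])
  qed
  obtain i where i: "{j. pole_at_infinity (sols u j)} = {i, i+1} \<or>
     {j. pole_at_infinity (sols u j)} = {i, i+3} \<or>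
     {j. pole_at_infinity (sols u j)} = {i, i+1, i+2, i+4}"
    using A unfolding type_A_def by blast
  then have "pole_at_infinity (sols u i)" by blast
  then obtain m where m: "m < 0" "U i $$ m + U (i+1) $$ m \<noteq> 0" using pole by blast
  then obtain j1 where "U j1 $$ m \<noteq> 0" by (cases "U i $$ m = 0") auto
  then obtain k where km: "k \<le> m" and Uk: "\<And>j. order_ge (U j) k" and "\<exists>j. U j $$ k \<noteq> 0"
    by (rule common_order) (rule that)
  then obtain j0 where j0: "U j0 $$ k \<noteq> 0" by blast
  have k: "k < 0" using km m(1) by simp
  define a where "a j = U j $$ k" for j
  have link: "upper deriv_infty (U j) - lower deriv_infty (U (j+1)) = fls_const (4 * \<alpha> j)" for j
    unfolding U_def by (rule chain_link_infty[OF chain])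
  have der: "deriv_infty (U l) $$ (k + k) = 0" for l
    using Uk[of l] k by (simp add: order_ge_def)
  have step: "(a (j+1))\<^sup>2 = (a j)\<^sup>2" for j
  proof -
    have "(upper deriv_infty (U j) - lower deriv_infty (U (j+1))) $$ (k + k) = 0"
      unfolding link using k by simp
    then have "(U j * U j) $$ (k + k) = (U (j+1) * U (j+1)) $$ (k + k)"
      using der by (simp add: upper_def lower_def power2_eq_square del: deriv_infty_nth)
    then show ?thesis
      by (simp only: lead_mult(1)[OF Uk Uk] power2_eq_square a_def)
  qed
  have sq: "(a j)\<^sup>2 = (a j0)\<^sup>2" for j
    by (rule cycle_induct[where P = "\<lambda>j. (a j)\<^sup>2 = (a j0)\<^sup>2" and i = j0]) (simp_all add: step)
  have a0: "a j \<noteq> 0" for j using sq[of j] j0 by (auto simp: a_def)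
  have pole_iff: "pole_at_infinity (sols u j) \<longleftrightarrow> a (j+1) = a j" for j
  proof
    assume "a (j+1) = a j"
    then have "U j $$ k + U (j+1) $$ k \<noteq> 0" using a0[of j] by (simp add: a_def)
    then show "pole_at_infinity (sols u j)" using pole k by blast
  next
    assume p: "pole_at_infinity (sols u j)"
    show "a (j+1) = a j"
    proof (rule ccontr)
      assume "a (j+1) \<noteq> a j"
      then have aj: "a (j+1) = - a j" using step[of j] by (auto simp: power2_eq_iff)
      define F where "F = U j + U (j+1)"
      define d where "d = U (j+1) - U j"
      have eq: "deriv_infty F = F * d + fls_const (4 * \<alpha> j)"
        using link[of j] infty.D_add[of "U j" "U (j+1)"]
        by (simp add: F_def d_def upper_def lower_def power2_eq_square algebra_simps)
      obtain n where n: "n < 0" "F $$ n \<noteq> 0" using p pole by (auto simp: F_def)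
      define m where "m = fls_subdegree F"
      have m: "m < 0" using fls_subdegree_leI[OF n(2)] n(1) by (simp add: m_def)
      have "F \<noteq> 0" using n(2) by auto
      then have Fm: "F $$ m \<noteq> 0" by (simp add: m_def)
      have Fo: "order_ge F m" by (simp add: m_def order_ge_subdegree)
      have dk: "order_ge d k" unfolding d_def using Uk by (simp add: order_ge_diff)
      have "deriv_infty F $$ (m + k) = 0" using Fo k by (simp add: order_ge_def)
      moreover have "(F * d) $$ (m + k) = F $$ m * d $$ k" by (rule lead_mult(1)[OF Fo dk])
      moreover have "fls_const (4 * \<alpha> j) $$ (m + k) = 0" using m k by simp
      ultimately have "F $$ m * d $$ k = 0" by (simp only: eq fls_plus_nth add_0_right)
      moreover have "d $$ k = - 2 * a j" using aj by (simp add: d_def a_def)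
      ultimately show False using Fm a0[of j] by simp
    qed
  qed
  have neg: "a (j+1) = - a j" if "\<not> pole_at_infinity (sols u j)" for j
    using that step[of j] pole_iff by (auto simp: power2_eq_iff)
  have idx: "i+1+1 = i+2" "i+2+1 = i+3" "i+3+1 = i+4" "i+4+1 = i+5" "i+5+1 = i"
    by (simp_all add: add.assoc)
  have "a i + a (i+1) + a (i+2) + a (i+3) + a (i+4) + a (i+5) = 2 * a i"
  proof -
    have r: "a (i+1) = (if pole_at_infinity (sols u i) then a i else - a i)"
      "a (i+2) = (if pole_at_infinity (sols u (i+1)) then a (i+1) else - a (i+1))"
      "a (i+3) = (if pole_at_infinity (sols u (i+2)) then a (i+2) else - a (i+2))"
      "a (i+4) = (if pole_at_infinity (sols u (i+3)) then a (i+3) else - a (i+3))"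
      "a (i+5) = (if pole_at_infinity (sols u (i+4)) then a (i+4) else - a (i+4))"
      using neg[of i] pole_iff[of i] neg[of "i+1"] pole_iff[of "i+1"] neg[of "i+2"] pole_iff[of "i+2"]
        neg[of "i+3"] pole_iff[of "i+3"] neg[of "i+4"] pole_iff[of "i+4"]
      unfolding idx by simp_all
    from i show ?thesis
    proof (elim disjE)
      assume s: "{j. pole_at_infinity (sols u j)} = {i, i+1}"
      have "pole_at_infinity (sols u j) \<longleftrightarrow> j \<in> {i, i+1}" for j using s by blast
      then show ?thesis unfolding r by simp
    next
      assume s: "{j. pole_at_infinity (sols u j)} = {i, i+3}"
      have "pole_at_infinity (sols u j) \<longleftrightarrow> j \<in> {i, i+3}" for j using s by blast
      then show ?thesis unfolding r by simp
    next
      assume s: "{j. pole_at_infinity (sols u j)} = {i, i+1, i+2, i+4}"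
      have "pole_at_infinity (sols u j) \<longleftrightarrow> j \<in> {i, i+1, i+2, i+4}" for j using s by blast
      then show ?thesis unfolding r by simp
    qed
  qed
  then have "2 * a i = (\<Sum>j\<in>UNIV. a j)" by (simp only: sum_6_shift[of a i])
  also have "\<dots> = (if k = - 1 then 2 else 0)"
    using chain_sum_infty[OF chain, of k] by (simp only: a_def U_def)
  finally have k1: "k = - 1" "a i = 1" using a0[of i] by (auto split: if_splits)
  have a1: "a j = 1 \<or> a j = - 1" for j
  proof -
    have "(a j)\<^sup>2 = (a i)\<^sup>2" by (simp only: sq[of j] sq[of i])
    then show ?thesis by (simp add: k1(2) power2_eq_1_iff)
  qed
  define \<sigma> :: "6 \<Rightarrow> int" where "\<sigma> j = (if a j = 1 then 1 else - 1)" for j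
  have "infinity_signs \<sigma> u"
    unfolding infinity_signs_def asymptotic_iff
  proof (intro allI conjI)
    fix j
    show "\<sigma> j = 1 \<or> \<sigma> j = - 1" by (simp add: \<sigma>_def)
    show "order_ge (expand_infty (u j)) (- 1)" using Uk[of j] k1 by (simp add: U_def)
    show "expand_infty (u j) $$ - 1 = of_int (\<sigma> j)"
      using a1[of j] k1(1) by (auto simp: \<sigma>_def a_def U_def)
  qed
  then show thesis by (rule that)
qed

text \<open>The sum \<open>d = u + w\<close> satisfies \<open>d' = d (w - u)\<close> where \<open>w - u\<close> grows like \<open>t\<close>, whereas the
  logarithmic derivative of a nonzero rational function decays.\<close>

lemma opposite_at_infinity:
  assumes link: "lower fract_deriv w = upper fract_deriv u"
    and u: "asymptotic \<sigma> u" and w: "asymptotic (- \<sigma>) w" and \<sigma>: "\<sigma> \<noteq> 0"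
  shows "w = - u"
proof (rule ccontr)
  assume "w \<noteq> - u"
  then have d: "u + w \<noteq> 0" by (simp add: add_eq_0_iff)
  define F where "F = expand_infty (u + w)"
  define d where "d = expand_infty (w - u)"
  define m where "m = fls_subdegree F"
  have "F \<noteq> 0" using d by (simp add: F_def del: infty.subst_add)
  then have Fm: "F $$ m \<noteq> 0" by (simp add: m_def)
  have Fo: "order_ge F m" by (simp add: m_def order_ge_subdegree)
  have do: "order_ge d (- 1)" "d $$ - 1 = - 2 * of_int \<sigma>"
    using u w by (simp_all add: d_def asymptotic_iff order_ge_diff)
  have "fract_deriv (u + w) = (u + w) * (w - u)"
    using link by (simp add: lower_def upper_def fract_deriv_add power2_eq_square algebra_simps)
  then have "deriv_infty F = F * d"
    unfolding F_def d_def by (simp only: infty.subst_deriv infty.subst_mult)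
  moreover have "deriv_infty F $$ (m + - 1) = 0" using Fo by (simp add: order_ge_def)
  moreover have "(F * d) $$ (m + - 1) = F $$ m * d $$ - 1" by (rule lead_mult(1)[OF Fo do(1)])
  ultimately show False using Fm do(2) \<sigma> by simp
qed

lemma asymptotic_log_deriv:
  assumes "f \<noteq> 0"
  shows "asymptotic 0 (fract_deriv f / f)"
proof -
  define F where "F = expand_infty f"
  define H where "H = expand_infty (fract_deriv f / f)"
  have F: "F \<noteq> 0" using assms by (simp add: F_def)
  have HF: "H * F = deriv_infty F" using assms by (simp add: F_def H_def infty.subst_deriv)
  have "order_ge H 1"
  proof (cases "H = 0")
    case False
    let ?h = "fls_subdegree H" and ?m = "fls_subdegree F"
    have "(H * F) $$ (?h + ?m) = H $$ ?h * F $$ ?m"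
      by (rule lead_mult(1)[OF order_ge_subdegree order_ge_subdegree])
    moreover have "H $$ ?h \<noteq> 0" "F $$ ?m \<noteq> 0" using False F by simp_all
    ultimately have "deriv_infty F $$ (?h + ?m) \<noteq> 0" unfolding HF by simp
    then have "?m + 1 \<le> ?h + ?m"
      using order_geD[OF order_ge_deriv_infty[OF order_ge_subdegree[of F]]] by (meson not_le)
    then have "1 \<le> ?h" by simp
    then show ?thesis using order_ge_subdegree order_ge_mono by blast
  qed simp
  then show ?thesis
    unfolding asymptotic_iff H_def[symmetric] by (simp add: order_ge_def)
qed

text \<open>Comparing the leading terms of the differences \<open>u i - v i\<close>, these are \<open>\<sigma> i\<close> times a common
  constant \<open>e\<close>; as both families have the same sum, \<open>2 e = (\<Sum>i. \<sigma> i) e\<close> vanishes.\<close>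

lemma chain_unique:
  assumes u: "dressing_chain \<alpha> u" "infinity_signs \<sigma> u"
    and v: "dressing_chain \<alpha> v" "infinity_signs \<sigma> v"
  shows "u = v"
proof (rule ccontr)
  assume "u \<noteq> v"
  then obtain j where "u j \<noteq> v j" by (auto simp: fun_eq_iff)
  define U where "U j = expand_infty (u j)" for j
  define V where "V j = expand_infty (v j)" for j
  define d where "d j = U j - V j" for j
  define s where "s j = U j + V j" for j
  have "d j \<noteq> 0" using \<open>u j \<noteq> v j\<close> by (simp add: d_def U_def V_def)
  then have "d j $$ fls_subdegree (d j) \<noteq> 0" by simp
  then obtain k where dk: "\<And>j. order_ge (d j) k" and ex: "\<exists>j. d j $$ k \<noteq> 0"
    by (rule common_order) (rule that)
  have s1: "order_ge (s j) (- 1)" "s j $$ - 1 = 2 * of_int (\<sigma> j)" for j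
    using infinity_signsD(2,3)[OF u(2), of j] infinity_signsD(2,3)[OF v(2), of j]
    by (simp_all add: s_def U_def V_def order_ge_add)
  have step: "of_int (\<sigma> (j+1)) * d (j+1) $$ k = of_int (\<sigma> j) * d j $$ k" for j
  proof -
    have Dd: "deriv_infty (d l) = deriv_infty (U l) - deriv_infty (V l)" for l
      by (simp add: d_def deriv_infty_def)
    have "upper deriv_infty (U j) - lower deriv_infty (U (j+1))
        = upper deriv_infty (V j) - lower deriv_infty (V (j+1))"
      unfolding U_def V_def chain_link_infty[OF u(1)] chain_link_infty[OF v(1)] ..
    then have "d (j+1) * s (j+1) = d j * s j + deriv_infty (d j) + deriv_infty (d (j+1))"
      unfolding Dd unfolding d_def s_def upper_def lower_def power2_eq_square
      by (simp add: algebra_simps)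
    then have "(d (j+1) * s (j+1)) $$ (k + - 1)
        = (d j * s j) $$ (k + - 1) + deriv_infty (d j) $$ (k + - 1) + deriv_infty (d (j+1)) $$ (k + - 1)"
      by (simp only: fls_plus_nth)
    moreover have "deriv_infty (d l) $$ (k + - 1) = 0" for l
      using dk[of l] by (simp add: order_ge_def)
    ultimately have "d (j+1) $$ k * s (j+1) $$ - 1 = d j $$ k * s j $$ - 1"
      by (simp only: lead_mult(1)[OF dk s1(1)] add_0_right)
    then show ?thesis unfolding s1(2) by (simp add: mult_ac)
  qed
  define e where "e = of_int (\<sigma> 0) * d 0 $$ k"
  have e: "of_int (\<sigma> j) * d j $$ k = e" for j
    by (rule cycle_induct[where P = "\<lambda>j. of_int (\<sigma> j) * d j $$ k = e" and i = 0])
      (simp_all add: step e_def)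
  have de: "d j $$ k = of_int (\<sigma> j) * e" for j
    using e[of j] infinity_signsD(1)[OF u(2), of j] by auto
  have "(\<Sum>j\<in>UNIV. d j $$ k) = 0"
    using chain_sum_infty[OF u(1), of k] chain_sum_infty[OF v(1), of k]
    by (simp add: d_def U_def V_def sum_subtractf)
  then have "of_int (\<Sum>j\<in>UNIV. \<sigma> j) * e = 0" by (simp add: de flip: sum_distrib_right)
  then have "e = 0" unfolding sum_signs[OF u] by simp
  then show False using ex de by simp
qed

lemma pole_at_infinity_reflect: "pole_at_infinity (reflect r) \<longleftrightarrow> pole_at_infinity r"
proof (cases r)
  case (Fract p q)
  let ?m = "[:0, - 1:] :: complex poly"
  have "pcompose q ?m \<noteq> 0" using Fract by (simp add: pcompose_eq_0_iff)
  moreover have "reflect r = Fract (pcompose p ?m) (pcompose q ?m)"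
  proof -
    have "r = to_fract p / to_fract q" using Fract by (simp add: to_fract_def)
    then have "reflect r = to_fract (pcompose p ?m) / to_fract (pcompose q ?m)"
      by (simp add: poly_value_reflection)
    then show ?thesis using \<open>pcompose q ?m \<noteq> 0\<close> by (simp add: to_fract_def)
  qed
  ultimately show ?thesis using Fract by (simp add: pole_at_infinity_Fract degree_pcompose)
qed

lemma pole_at_infinity_minus: "pole_at_infinity (- r) \<longleftrightarrow> pole_at_infinity r"
  by (simp add: pole_at_infinity_iff order_ge_def)

lemma asymptotic_reflect: "asymptotic \<sigma> r \<Longrightarrow> asymptotic \<sigma> (- reflect r)"
proof -
  assume "asymptotic \<sigma> r"
  moreover have "- reflect r - rconst (of_int \<sigma>) * tvar = - reflect (r - rconst (of_int \<sigma>) * tvar)"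
    by simp
  ultimately show ?thesis
    by (simp only: asymptotic_def pole_at_infinity_minus pole_at_infinity_reflect not_False_eq_True)
qed

lemma lower_reflect: "lower fract_deriv (- reflect w) = reflect (lower fract_deriv w)"
  and upper_reflect: "upper fract_deriv (- reflect w) = reflect (upper fract_deriv w)"
proof -
  have "fract_deriv (reflect w) = - reflect (fract_deriv w)"
    using refl.subst_deriv[of w] by (metis minus_minus)
  then show "lower fract_deriv (- reflect w) = reflect (lower fract_deriv w)"
    "upper fract_deriv (- reflect w) = reflect (upper fract_deriv w)"
    by (simp_all add: lower_def upper_def fract_deriv_minus)
qed

text \<open>The family \<open>- u i (- t)\<close> is a chain with the same parameters and the same signs.\<close>

lemma chain_odd:
  assumes "dressing_chain \<alpha> u" "infinity_signs \<sigma> u"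
  shows "reflect (u i) = - u i"
proof -
  have "dressing_chain \<alpha> (\<lambda>i. - reflect (u i))"
    unfolding dressing_chain_def lower_reflect upper_reflect
  proof (intro conjI allI)
    fix i
    show "reflect (lower fract_deriv (u (i+1))) = reflect (upper fract_deriv (u i)) - 4 * rconst (\<alpha> i)"
      unfolding chain_link[OF assms(1)] by simp
    have "(\<Sum>i\<in>UNIV. - reflect (u i)) = - reflect (\<Sum>i\<in>UNIV. u i)"
      by (simp add: sum_negf)
    then show "(\<Sum>i\<in>UNIV. - reflect (u i)) = 2 * tvar"
      unfolding chain_sum[OF assms(1)] by simp
  qed
  moreover have "infinity_signs \<sigma> (\<lambda>i. - reflect (u i))"
    using assms(2) asymptotic_reflect unfolding infinity_signs_def by blast
  ultimately have "u = (\<lambda>i. - reflect (u i))" by (rule chain_unique[OF assms])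
  then have "u i = - reflect (u i)" by (rule fun_cong)
  then show ?thesis by (metis minus_minus)
qed

text \<open>This is the coefficient of \<open>t\<^sup>0\<close> in the chain equation; the constant terms \<open>b i\<close> of the \<open>u i\<close> drop
  out because the coefficient of \<open>t\<close> makes \<open>\<sigma> i b i\<close> independent of \<open>i\<close>.\<close>

lemma parameters_at_infinity:
  assumes chain: "dressing_chain \<alpha> u" and \<sigma>: "infinity_signs \<sigma> u"
  shows "4 * \<alpha> i = 2 * of_int (\<sigma> i) * expand_infty (u i) $$ 1
    - 2 * of_int (\<sigma> (i+1)) * expand_infty (u (i+1)) $$ 1 + of_int (\<sigma> i) + of_int (\<sigma> (i+1))"
proof -
  define U where "U j = expand_infty (u j)" for j
  have U: "order_ge (U j) (- 1)" "U j $$ - 1 = of_int (\<sigma> j)" for j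
    using infinity_signsD(2,3)[OF \<sigma>] by (simp_all add: U_def)
  have sq: "of_int (\<sigma> j) * of_int (\<sigma> j) = (1::complex)" for j
    using infinity_signsD(1)[OF \<sigma>, of j] by auto
  have link: "upper deriv_infty (U i) - lower deriv_infty (U (i+1)) = fls_const (4 * \<alpha> i)"
    unfolding U_def by (rule chain_link_infty[OF chain])
  have c1: "(U j * U j) $$ (- 1) = 2 * of_int (\<sigma> j) * U j $$ 0" for j
    using lead_mult(2)[OF U(1) U(1), of j j] by (simp add: U(2))
  have c0: "(U j * U j) $$ 0 = 2 * of_int (\<sigma> j) * U j $$ 1 + U j $$ 0 * U j $$ 0" for j
    using lead_mult(3)[OF U(1) U(1), of j j] by (simp add: U(2))
  have "U j $$ - 2 = 0" for j using U(1)[of j] by (simp add: order_ge_def)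
  moreover have "(upper deriv_infty (U i) - lower deriv_infty (U (i+1))) $$ - 1 = 0"
    unfolding link by simp
  ultimately have "of_int (\<sigma> i) * U i $$ 0 = of_int (\<sigma> (i+1)) * U (i+1) $$ 0"
    by (simp add: upper_def lower_def power2_eq_square c1)
  then have "(of_int (\<sigma> i) * of_int (\<sigma> i)) * (U i $$ 0 * U i $$ 0)
      = (of_int (\<sigma> (i+1)) * of_int (\<sigma> (i+1))) * (U (i+1) $$ 0 * U (i+1) $$ 0)"
    by algebra
  then have "U i $$ 0 * U i $$ 0 = U (i+1) $$ 0 * U (i+1) $$ 0" unfolding sq by simp
  moreover have "(upper deriv_infty (U i) - lower deriv_infty (U (i+1))) $$ 0 = 4 * \<alpha> i"
    unfolding link by simp
  ultimately show ?thesis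
    by (simp add: upper_def lower_def power2_eq_square c0 U(2) U_def[symmetric] algebra_simps)
qed

section \<open>Congruences for the parameters\<close>

definition parity :: "6 \<Rightarrow> int" where
  "parity i = (if i \<in> {1, 3, 5} then 1 else 0)"

lemma parity_step: "parity (i+1) = 1 - parity i"
proof -
  have "\<forall>i. parity (i+1) = 1 - parity i" unfolding all_6 parity_def by simp
  then show ?thesis by blast
qed

lemma half_even_Ints: "even n \<Longrightarrow> of_int n / 2 \<in> (\<int> :: complex set)"
  by (elim evenE) simp

text \<open>After the shift by \<open>1/2 + parity i\<close>, every residue \<open>\<mu> i\<close> at \<open>0\<close> is plus or minus the first one
  modulo 2.  The signs \<open>\<tau> i\<close> are well defined unless everything is integral, and their sum vanishes
  because \<open>\<tau> i \<mu> i\<close> decreases by \<open>(\<tau> i + \<tau> (i+1)) / 2\<close> in each step.\<close>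

lemma sign_pattern_arith:
  fixes \<alpha> \<mu> \<rho> :: "6 \<Rightarrow> complex" and \<sigma> n :: "6 \<Rightarrow> int"
  assumes \<sigma>: "\<And>i. \<sigma> i = 1 \<or> \<sigma> i = - 1"
    and \<alpha>: "\<And>i. 4 * \<alpha> i = 2 * of_int (\<sigma> i) * \<rho> i - 2 * of_int (\<sigma> (i+1)) * \<rho> (i+1)
      + of_int (\<sigma> i) + of_int (\<sigma> (i+1))"
    and \<rho>: "\<And>i. \<rho> i = \<mu> i + 2 * of_int (n i)"
    and \<mu>: "\<And>i. \<mu> (i+1) = - \<mu> i \<or> \<mu> (i+1) = \<mu> i - 1"
  shows "(\<forall>i. \<alpha> i \<in> \<int>) \<or> (\<exists>x \<tau>. 2 * x \<notin> \<int> \<and> (\<forall>i. \<tau> i = 1 \<or> \<tau> i = - 1) \<and> (\<Sum>i\<in>UNIV. \<tau> i) = (0::int) \<and>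
    (\<forall>i. \<alpha> i - of_int (\<sigma> i * \<tau> i - \<sigma> (i+1) * \<tau> (i+1)) * x \<in> \<int>))"
proof -
  define \<omega> where "\<omega> i = \<mu> i + 1 / 2 + of_int (parity i)" for i
  define ev where "ev z \<longleftrightarrow> z / 2 \<in> (\<int> :: complex set)" for z
  have ev_add: "ev a \<Longrightarrow> ev b \<Longrightarrow> ev (a + b)" for a b by (simp add: ev_def add_divide_distrib)
  have ev_diff: "ev a \<Longrightarrow> ev b \<Longrightarrow> ev (a - b)" for a b by (simp add: ev_def diff_divide_distrib)
  have ev_minus: "ev (- a) \<longleftrightarrow> ev a" for a by (simp add: ev_def minus_in_Ints_iff)
  have ev_2: "ev (2 * a) \<longleftrightarrow> a \<in> \<int>" for a by (simp add: ev_def)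
  have ev_Ints: "ev a \<Longrightarrow> a \<in> \<int>" for a
    unfolding ev_def using Ints_mult[of 2 "a / 2"] by simp
  have flip: "\<omega> (i+1) = 2 - \<omega> i" if "\<mu> (i+1) = - \<mu> i" for i
    using that by (simp add: \<omega>_def parity_step)
  have same: "\<omega> (i+1) = \<omega> i - 2 * of_int (parity i)" if "\<mu> (i+1) = \<mu> i - 1" for i
    using that by (simp add: \<omega>_def parity_step)
  have cong: "\<alpha> i - (of_int (\<sigma> i) * \<omega> i - of_int (\<sigma> (i+1)) * \<omega> (i+1)) / 2 \<in> \<int>" for i
  proof -
    obtain q where q: "\<sigma> i + \<sigma> (i+1) = 2 * q"
      using \<sigma>[of i] \<sigma>[of "i+1"] by (metis evenE even_add even_minus odd_one)
    have q': "(of_int (\<sigma> i) :: complex) = 2 * of_int q - of_int (\<sigma> (i+1))"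
      using arg_cong[OF q, of "of_int :: int \<Rightarrow> complex"] by (simp add: eq_diff_eq)
    have "\<alpha> i - (of_int (\<sigma> i) * \<omega> i - of_int (\<sigma> (i+1)) * \<omega> (i+1)) / 2
        = (4 * \<alpha> i - 2 * of_int (\<sigma> i) * \<omega> i + 2 * of_int (\<sigma> (i+1)) * \<omega> (i+1)) / 4"
      by (simp add: field_simps)
    also have "4 * \<alpha> i - 2 * of_int (\<sigma> i) * \<omega> i + 2 * of_int (\<sigma> (i+1)) * \<omega> (i+1)
        = 4 * (of_int (\<sigma> (i+1)) - of_int (parity i) * of_int q
           + of_int (\<sigma> i) * of_int (n i) - of_int (\<sigma> (i+1)) * of_int (n (i+1)))"
      unfolding \<alpha> \<rho> \<omega>_def parity_step q' by (simp add: algebra_simps)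
    finally have "\<alpha> i - (of_int (\<sigma> i) * \<omega> i - of_int (\<sigma> (i+1)) * \<omega> (i+1)) / 2
        = of_int (\<sigma> (i+1) - parity i * q + \<sigma> i * n i - \<sigma> (i+1) * n (i+1))"
      by simp
    then show ?thesis by simp
  qed
  have par: "ev (\<omega> (i+1) - \<omega> i) \<or> ev (\<omega> (i+1) + \<omega> i)" for i
  proof -
    have "ev (- 2 * of_int (parity i))" "ev 2" by (simp_all add: ev_def)
    then show ?thesis using \<mu>[of i] flip[of i] same[of i] by auto
  qed
  have all: "ev (\<omega> i - \<omega> 0) \<or> ev (\<omega> i + \<omega> 0)" for i
  proof (rule cycle_induct[where P = "\<lambda>i. ev (\<omega> i - \<omega> 0) \<or> ev (\<omega> i + \<omega> 0)" and i = 0])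
    show "ev (\<omega> 0 - \<omega> 0) \<or> ev (\<omega> 0 + \<omega> 0)" by (simp add: ev_def)
    fix k assume "ev (\<omega> k - \<omega> 0) \<or> ev (\<omega> k + \<omega> 0)"
    moreover have "\<omega> (k+1) - \<omega> 0 = (\<omega> (k+1) - \<omega> k) + (\<omega> k - \<omega> 0)"
      "\<omega> (k+1) - \<omega> 0 = (\<omega> (k+1) + \<omega> k) - (\<omega> k + \<omega> 0)"
      "\<omega> (k+1) + \<omega> 0 = (\<omega> (k+1) - \<omega> k) + (\<omega> k + \<omega> 0)"
      "\<omega> (k+1) + \<omega> 0 = (\<omega> (k+1) + \<omega> k) - (\<omega> k - \<omega> 0)" by simp_all
    ultimately show "ev (\<omega> (k+1) - \<omega> 0) \<or> ev (\<omega> (k+1) + \<omega> 0)"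
      using par[of k] ev_add ev_diff by metis
  qed
  show ?thesis
  proof (cases "\<omega> 0 \<in> \<int>")
    case True
    have int: "\<omega> i \<in> \<int>" for i
      using all[of i] Ints_add[OF ev_Ints True, of "\<omega> i - \<omega> 0"] Ints_diff[OF ev_Ints True, of "\<omega> i + \<omega> 0"]
      by auto
    have "\<alpha> i \<in> \<int>" for i
    proof -
      obtain v w where v: "\<omega> i = of_int v" and w: "\<omega> (i+1) = of_int w"
        using int by (meson Ints_cases)
      have iff: "ev (of_int z) \<longleftrightarrow> even z" for z
      proof
        assume "ev (of_int z)"
        then obtain y where "of_int z / 2 = (of_int y :: complex)" unfolding ev_def by (rule Ints_cases)
        then have "(of_int z :: complex) = of_int (2 * y)" by simp
        then have "z = 2 * y" by (simp only: of_int_eq_iff)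
        then show "even z" by simp
      qed (simp add: ev_def half_even_Ints)
      have "even (w - v) \<or> even (w + v)"
        using par[of i] unfolding v w iff[symmetric] by simp
      then have "even (\<sigma> i * v - \<sigma> (i+1) * w)" using \<sigma>[of i] \<sigma>[of "i+1"] by auto
      then have "of_int (\<sigma> i * v - \<sigma> (i+1) * w) / 2 \<in> (\<int> :: complex set)" by (rule half_even_Ints)
      then have "(of_int (\<sigma> i) * \<omega> i - of_int (\<sigma> (i+1)) * \<omega> (i+1)) / 2 \<in> \<int>"
        unfolding v w by simp
      from Ints_add[OF cong[of i] this] show ?thesis by simp
    qed
    then show ?thesis by blast
  next
    case False
    define \<tau> :: "6 \<Rightarrow> int" where "\<tau> i = (if ev (\<omega> i - \<omega> 0) then 1 else - 1)" for i
    have \<tau>: "\<tau> i = 1 \<or> \<tau> i = - 1" for i by (simp add: \<tau>_def)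
    have \<tau>_ev: "ev (\<omega> i - of_int (\<tau> i) * \<omega> 0)" for i
      using all[of i] by (auto simp: \<tau>_def)
    have unique: "\<tau> i = t" if "ev (\<omega> i - of_int t * \<omega> 0)" "t = 1 \<or> t = - 1" for i t
    proof (rule ccontr)
      assume "\<tau> i \<noteq> t"
      then have "t = - \<tau> i" using \<tau>[of i] that(2) by auto
      then have "(\<omega> i - of_int t * \<omega> 0) - (\<omega> i - of_int (\<tau> i) * \<omega> 0) = 2 * (of_int (\<tau> i) * \<omega> 0)"
        by (simp add: algebra_simps)
      moreover have "ev ((\<omega> i - of_int t * \<omega> 0) - (\<omega> i - of_int (\<tau> i) * \<omega> 0))"
        by (rule ev_diff[OF that(1) \<tau>_ev])
      ultimately have "ev (2 * (of_int (\<tau> i) * \<omega> 0))" by (simp only:)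
      then have "of_int (\<tau> i) * \<omega> 0 \<in> \<int>" unfolding ev_2 .
      then show False using \<tau>[of i] False by (auto simp: minus_in_Ints_iff)
    qed
    have step: "2 * (of_int (\<tau> (i+1)) * \<mu> (i+1))
        = 2 * (of_int (\<tau> i) * \<mu> i) - of_int (\<tau> i) - of_int (\<tau> (i+1))" for i
    proof -
      from \<mu>[of i] show ?thesis
      proof
        assume m: "\<mu> (i+1) = - \<mu> i"
        have "\<omega> (i+1) - of_int (- \<tau> i) * \<omega> 0 = 2 - (\<omega> i - of_int (\<tau> i) * \<omega> 0)"
          unfolding flip[OF m] by (simp add: algebra_simps)
        moreover have "ev (2 - (\<omega> i - of_int (\<tau> i) * \<omega> 0))"
          by (rule ev_diff[OF _ \<tau>_ev]) (simp add: ev_def)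
        ultimately have "ev (\<omega> (i+1) - of_int (- \<tau> i) * \<omega> 0)" by (simp only:)
        then have "\<tau> (i+1) = - \<tau> i" by (rule unique) (use \<tau>[of i] in auto)
        then show ?thesis using m by simp
      next
        assume m: "\<mu> (i+1) = \<mu> i - 1"
        have "\<omega> (i+1) - of_int (\<tau> i) * \<omega> 0 = (\<omega> i - of_int (\<tau> i) * \<omega> 0) - 2 * of_int (parity i)"
          unfolding same[OF m] by (simp add: algebra_simps)
        moreover have "ev ((\<omega> i - of_int (\<tau> i) * \<omega> 0) - 2 * of_int (parity i))"
          by (rule ev_diff[OF \<tau>_ev]) (simp add: ev_def)
        ultimately have "ev (\<omega> (i+1) - of_int (\<tau> i) * \<omega> 0)" by (simp only:)
        then have "\<tau> (i+1) = \<tau> i" by (rule unique) (rule \<tau>)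
        then show ?thesis unfolding m by (simp add: algebra_simps)
      qed
    qed
    have "(\<Sum>i\<in>UNIV. (of_int (\<tau> i) :: complex)) = 0"
      using step[of 0] step[of 1] step[of 2] step[of 3] step[of 4] step[of 5]
      unfolding sum_6 by simp algebra
    then have sum: "(\<Sum>i\<in>UNIV. \<tau> i) = 0" by (metis of_int_sum of_int_eq_0_iff)
    have "\<alpha> i - of_int (\<sigma> i * \<tau> i - \<sigma> (i+1) * \<tau> (i+1)) * (\<omega> 0 / 2) \<in> \<int>" for i
    proof -
      have I: "of_int (\<sigma> j) * ((\<omega> j - of_int (\<tau> j) * \<omega> 0) / 2) \<in> \<int>" for j
        using \<tau>_ev[of j] unfolding ev_def by (rule Ints_mult[OF Ints_of_int])
      have "\<alpha> i - of_int (\<sigma> i * \<tau> i - \<sigma> (i+1) * \<tau> (i+1)) * (\<omega> 0 / 2)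
        = (\<alpha> i - (of_int (\<sigma> i) * \<omega> i - of_int (\<sigma> (i+1)) * \<omega> (i+1)) / 2)
          + (of_int (\<sigma> i) * ((\<omega> i - of_int (\<tau> i) * \<omega> 0) / 2)
            - of_int (\<sigma> (i+1)) * ((\<omega> (i+1) - of_int (\<tau> (i+1)) * \<omega> 0) / 2))"
        by (simp add: algebra_simps diff_divide_distrib)
      then show ?thesis using Ints_add[OF cong[of i] Ints_diff[OF I[of i] I[of "i+1"]]] by (simp only:)
    qed
    then have "\<forall>i. \<alpha> i - of_int (\<sigma> i * \<tau> i - \<sigma> (i+1) * \<tau> (i+1)) * (\<omega> 0 / 2) \<in> \<int>" by (rule allI)
    moreover have "\<forall>i. \<tau> i = 1 \<or> \<tau> i = - 1" using \<tau> by (rule allI)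
    moreover have "2 * (\<omega> 0 / 2) \<notin> \<int>" using False by simp
    ultimately show ?thesis using sum by (intro disjI2 exI[of _ "\<omega> 0 / 2"] exI[of _ \<tau>] conjI)
  qed
qed

text \<open>By oddness and integrality of the residues, the coefficient of \<open>1/t\<close> at infinity differs from the
  residue at \<open>0\<close> by an even integer.\<close>

lemma chain_sign_pattern:
  assumes chain: "dressing_chain \<alpha> u" and \<sigma>: "infinity_signs \<sigma> u"
  shows "(\<forall>i. \<alpha> i \<in> \<int>) \<or> (\<exists>x \<tau>. 2 * x \<notin> \<int> \<and> (\<forall>i. \<tau> i = 1 \<or> \<tau> i = - 1) \<and> (\<Sum>i\<in>UNIV. \<tau> i) = (0::int) \<and>
    (\<forall>i. \<alpha> i - of_int (\<sigma> i * \<tau> i - \<sigma> (i+1) * \<tau> (i+1)) * x \<in> \<int>))"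
proof -
  define \<rho> where "\<rho> i = expand_infty (u i) $$ 1" for i
  define \<mu> where "\<mu> i = expand 0 (u i) $$ - 1" for i
  have "\<exists>n. \<rho> i = \<mu> i + 2 * of_int n" for i
  proof -
    obtain H where H: "finite H" "0 \<notin> H"
      "expand_infty (u i) $$ 1 = expand 0 (u i) $$ - 1 + 2 * (\<Sum>c\<in>H. expand c (u i) $$ - 1)"
      by (rule odd_residue_theorem[OF chain_simple_poles[OF chain] chain_odd[OF chain \<sigma>]]) (rule that)
    have "(\<Sum>c\<in>H. expand c (u i) $$ - 1) \<in> \<int>"
      using H(2) by (intro Ints_sum chain_residues_integral[OF chain]) auto
    then show ?thesis using H(3) unfolding \<rho>_def \<mu>_def by (auto elim: Ints_cases)
  qed
  then obtain n where n: "\<And>i. \<rho> i = \<mu> i + 2 * of_int (n i)" by metis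
  show ?thesis
  proof (rule sign_pattern_arith[where \<rho> = \<rho> and \<mu> = \<mu> and n = n])
    show "\<sigma> i = 1 \<or> \<sigma> i = - 1" for i by (rule infinity_signsD(1)[OF \<sigma>])
    show "4 * \<alpha> i = 2 * of_int (\<sigma> i) * \<rho> i - 2 * of_int (\<sigma> (i+1)) * \<rho> (i+1)
      + of_int (\<sigma> i) + of_int (\<sigma> (i+1))" for i
      unfolding \<rho>_def by (rule parameters_at_infinity[OF chain \<sigma>])
    show "\<rho> i = \<mu> i + 2 * of_int (n i)" for i by (rule n)
    show "\<mu> (i+1) = - \<mu> i \<or> \<mu> (i+1) = \<mu> i - 1" for i
      unfolding \<mu>_def by (rule chain_residue_step[OF chain])
  qed
qed

section \<open>Orbits of parameters\<close>

lemma generated_comp: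
  assumes "w \<in> generated G" "v \<in> generated G"
  shows "w \<circ> v \<in> generated G"
  using assms(1) by induction (simp_all only: id_comp comp_assoc assms(2) generated.intros)

lemma generated_base: "g \<in> G \<Longrightarrow> g \<in> generated G"
  using generated.gen[OF _ generated.one] by fastforce

lemma generated_base_inv: "g \<in> G \<Longrightarrow> inv g \<in> generated G"
  using generated.inv[OF _ generated.one] by fastforce

lemma generated_left_inverse:
  assumes bij: "\<And>g. g \<in> G \<Longrightarrow> bij g" and w: "w \<in> generated G"
  shows "\<exists>v\<in>generated G. \<forall>x. v (w x) = x"
  using w
proof induction
  case one
  then show ?case by (intro bexI[of _ id] generated.one) simp
next
  case (gen g w)
  then obtain v where v: "v \<in> generated G" "\<forall>x. v (w x) = x" by blast
  have "inv g (g y) = y" for y using bij[OF gen(1)] by (simp add: bij_is_inj)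
  then show ?case
    using v by (intro bexI[OF _ generated_comp[OF v(1) generated_base_inv[OF gen(1)]]]) simp
next
  case (inv g w)
  then obtain v where v: "v \<in> generated G" "\<forall>x. v (w x) = x" by blast
  have "g (inv g y) = y" for y using bij[OF inv(1)] by (simp add: bij_is_surj surj_f_inv_f)
  then show ?case
    using v by (intro bexI[OF _ generated_comp[OF v(1) generated_base[OF inv(1)]]]) simp
qed

definition param_orbit :: "(6 \<Rightarrow> complex) \<Rightarrow> (6 \<Rightarrow> complex) \<Rightarrow> bool" where
  "param_orbit \<alpha> \<beta> \<longleftrightarrow> (\<exists>w\<in>weyl_param. w \<alpha> = \<beta>)"

lemma param_orbit_refl: "param_orbit \<alpha> \<alpha>"
  unfolding param_orbit_def weyl_param_def by (rule bexI[OF _ generated.one]) simp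

lemma param_orbit_trans:
  assumes "param_orbit \<alpha> \<beta>" "param_orbit \<beta> \<gamma>"
  shows "param_orbit \<alpha> \<gamma>"
proof -
  obtain w v where "w \<in> weyl_param" "w \<alpha> = \<beta>" "v \<in> weyl_param" "v \<beta> = \<gamma>"
    using assms unfolding param_orbit_def by blast
  then have "v \<circ> w \<in> weyl_param" "(v \<circ> w) \<alpha> = \<gamma>"
    unfolding weyl_param_def by (simp_all add: generated_comp)
  then show ?thesis unfolding param_orbit_def by blast
qed

lemma param_orbit_sym:
  assumes "param_orbit \<alpha> \<beta>"
  shows "param_orbit \<beta> \<alpha>"
proof -
  obtain w where w: "w \<in> weyl_param" "w \<alpha> = \<beta>" using assms unfolding param_orbit_def by blast
  have "bij g" if "g \<in> insert pi_param (range s_param)" for g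
    using that bij_s_param bij_pi_param by blast
  then obtain v where "v \<in> weyl_param" "\<forall>x. v (w x) = x"
    using generated_left_inverse[of "insert pi_param (range s_param)" w] w(1)
    unfolding weyl_param_def by blast
  then show ?thesis using w(2) unfolding param_orbit_def by blast
qed

lemma param_orbit_s: "param_orbit \<alpha> (s_param i \<alpha>)"
  unfolding param_orbit_def weyl_param_def
  by (rule bexI[where x = "s_param i"]) (simp_all add: generated_base)

lemma param_orbit_pi: "param_orbit \<alpha> (pi_param \<alpha>)"
  unfolding param_orbit_def weyl_param_def
  by (rule bexI[where x = pi_param]) (simp_all add: generated_base)

lemma index_minus_1: "i - 1 = i + (5 :: 6)"
proof -
  have "(- 1 :: 6) = 5" by simp
  then show ?thesis by (metis diff_conv_add_uminus)
qed

lemma s_param_nth: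
  "s_param i \<alpha> i = - \<alpha> i" "s_param i \<alpha> (i+1) = \<alpha> (i+1) + \<alpha> i" "s_param i \<alpha> (i+2) = \<alpha> (i+2)"
  "s_param i \<alpha> (i+3) = \<alpha> (i+3)" "s_param i \<alpha> (i+4) = \<alpha> (i+4)" "s_param i \<alpha> (i+5) = \<alpha> (i+5) + \<alpha> i"
  by (simp_all add: s_param_def index_minus_1)

lemma sum_s_param: "(\<Sum>j\<in>UNIV. s_param i \<alpha> j) = (\<Sum>j\<in>UNIV. \<alpha> j)"
  unfolding sum_6_shift[of _ i] s_param_nth by simp

lemma all_6_shift: "(\<forall>j. P j) \<longleftrightarrow> P i \<and> P (i+1) \<and> P (i+2) \<and> P (i+3) \<and> P (i+4) \<and> P (i+5 :: 6)"
proof -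
  have "(\<forall>j. P j) \<longleftrightarrow> (\<forall>d. P (i + d))" by (metis add.commute diff_add_cancel)
  then show ?thesis by (simp add: all_6)
qed

text \<open>In coordinates \<open>\<epsilon>\<close> with \<open>\<alpha> i = \<epsilon> i - \<epsilon> (i+1)\<close> the extended affine Weyl group permutes the \<open>\<epsilon> i\<close>
  and shifts them by integers; the pattern says that the \<open>\<epsilon> i\<close> fall into at most two classes
  modulo the integers, of sizes \<open>5 + 1\<close> or \<open>3 + 3\<close>; the sign \<open>s i\<close> names the class of \<open>\<epsilon> i\<close> and
  \<open>2 x\<close> is the difference of the classes.  A single class is covered by \<open>x = 0\<close>.\<close>

definition two_classes :: "(6 \<Rightarrow> complex) \<Rightarrow> bool" where
  "two_classes \<alpha> \<longleftrightarrow> (\<exists>x s. (\<forall>i. s i = 1 \<or> s i = - 1) \<and> (\<Sum>i\<in>UNIV. s i) \<in> {4, - 4, 0 :: int} \<and>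
     (\<forall>i. \<alpha> i - of_int (s i - s (i+1)) * x \<in> \<int>))"

lemma two_classes_s_param:
  assumes "two_classes \<alpha>"
  shows "two_classes (s_param j \<alpha>)"
proof -
  obtain x s where s: "\<forall>i. s i = 1 \<or> s i = - 1" "(\<Sum>i\<in>UNIV. s i) \<in> {4, - 4, 0 :: int}"
    and xs: "\<forall>i. \<alpha> i - of_int (s i - s (i+1)) * x \<in> \<int>"
    using assms unfolding two_classes_def by blast
  define s' where "s' = s(j := s (j+1), j+1 := s j)"
  have n: "s' j = s (j+1)" "s' (j+1) = s j" "s' (j+2) = s (j+2)" "s' (j+3) = s (j+3)"
    "s' (j+4) = s (j+4)" "s' (j+5) = s (j+5)"
    by (simp_all add: s'_def)
  have idx: "j+1+1 = j+2" "j+2+1 = j+3" "j+3+1 = j+4" "j+4+1 = j+5" "j+5+1 = j"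
    by (simp_all add: add.assoc)
  have "\<forall>i. s' i = 1 \<or> s' i = - 1" using s(1) by (simp add: s'_def)
  moreover have "(\<Sum>i\<in>UNIV. s' i) = (\<Sum>i\<in>UNIV. s i)"
    unfolding sum_6_shift[of _ j] n by simp
  moreover have "\<forall>i. s_param j \<alpha> i - of_int (s' i - s' (i+1)) * x \<in> \<int>"
  proof -
    have I: "\<alpha> j - of_int (s j - s (j+1)) * x \<in> \<int>" "\<alpha> (j+1) - of_int (s (j+1) - s (j+2)) * x \<in> \<int>"
      "\<alpha> (j+5) - of_int (s (j+5) - s j) * x \<in> \<int>"
      using xs[rule_format, of j] xs[rule_format, of "j+1"] xs[rule_format, of "j+5"] unfolding idx by blast+
    have e: "- \<alpha> j - of_int (s (j+1) - s j) * x = - (\<alpha> j - of_int (s j - s (j+1)) * x)"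
      "\<alpha> (j+1) + \<alpha> j - of_int (s j - s (j+2)) * x
        = (\<alpha> (j+1) - of_int (s (j+1) - s (j+2)) * x) + (\<alpha> j - of_int (s j - s (j+1)) * x)"
      "\<alpha> (j+5) + \<alpha> j - of_int (s (j+5) - s (j+1)) * x
        = (\<alpha> (j+5) - of_int (s (j+5) - s j) * x) + (\<alpha> j - of_int (s j - s (j+1)) * x)"
      by (simp_all add: algebra_simps)
    show ?thesis
      unfolding all_6_shift[of _ j] idx n s_param_nth e
      using Ints_minus[OF I(1)] Ints_add[OF I(2) I(1)] Ints_add[OF I(3) I(1)]
        xs[rule_format, of "j+2"] xs[rule_format, of "j+3"] xs[rule_format, of "j+4"]
      unfolding idx by blast
  qed
  ultimately show ?thesis using s(2) unfolding two_classes_def by metis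
qed

lemma two_classes_rotate:
  assumes "two_classes \<alpha>"
  shows "two_classes (\<lambda>i. \<alpha> (i + k))"
proof -
  obtain x s where s: "\<forall>i. s i = 1 \<or> s i = - 1" "(\<Sum>i\<in>UNIV. s i) \<in> {4, - 4, 0 :: int}"
    and xs: "\<forall>i. \<alpha> i - of_int (s i - s (i+1)) * x \<in> \<int>"
    using assms unfolding two_classes_def by blast
  have "(\<Sum>i\<in>UNIV. s (i + k)) = (\<Sum>i\<in>UNIV. s i)"
    by (rule sum.reindex_bij_witness[of _ "\<lambda>i. i - k" "\<lambda>i. i + k"]) simp_all
  moreover have "\<alpha> (i + k) - of_int (s (i + k) - s (i + 1 + k)) * x \<in> \<int>" for i
    using xs[rule_format, of "i + k"] by (simp add: ac_simps)
  ultimately show ?thesis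
    unfolding two_classes_def using s by (intro exI[of _ x] exI[of _ "\<lambda>i. s (i + k)"]) simp
qed

lemma inv_s_param: "inv (s_param i) = s_param i"
  by (rule inv_unique_comp) (simp_all add: fun_eq_iff s_param_s_param)

lemma inv_pi_param: "inv pi_param = (\<lambda>\<alpha> i. \<alpha> (i - 1))"
  by (rule inv_unique_comp) (simp_all add: fun_eq_iff pi_param_def)

lemma weyl_param_induct:
  assumes "w \<in> weyl_param" and "P \<alpha>"
    and "\<And>\<beta> i. P \<beta> \<Longrightarrow> P (s_param i \<beta>)" and "\<And>\<beta>. P \<beta> \<Longrightarrow> P (\<lambda>i. \<beta> (i + 1))"
    and "\<And>\<beta>. P \<beta> \<Longrightarrow> P (\<lambda>i. \<beta> (i - 1))"
  shows "P (w \<alpha>)"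
  using assms(1) unfolding weyl_param_def
proof induction
  case (gen g w)
  then show ?case using assms by (auto simp: pi_param_def)
next
  case (inv g w)
  then show ?case using assms by (auto simp: inv_s_param inv_pi_param)
qed (simp add: assms)

lemma param_orbit_invariants:
  assumes "param_orbit \<alpha> \<beta>"
  shows "two_classes \<alpha> \<Longrightarrow> two_classes \<beta>" "(\<Sum>i\<in>UNIV. \<beta> i) = (\<Sum>i\<in>UNIV. \<alpha> i)"
proof -
  obtain w where w: "w \<in> weyl_param" "\<beta> = w \<alpha>" using assms unfolding param_orbit_def by blast
  show "two_classes \<beta>" if "two_classes \<alpha>"
    unfolding w(2)
    using two_classes_rotate[of _ 1] two_classes_rotate[of _ "- 1"]
    by (intro weyl_param_induct[where P = two_classes, OF w(1) that])
      (simp_all add: two_classes_s_param)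
  have rot: "(\<Sum>i\<in>UNIV. \<gamma> (i + 1)) = (\<Sum>i\<in>UNIV. \<gamma> i)" "(\<Sum>i\<in>UNIV. \<gamma> (i - 1)) = (\<Sum>i\<in>UNIV. \<gamma> i)"
    for \<gamma> :: "6 \<Rightarrow> complex"
    by (rule sum.reindex_bij_witness[of _ "\<lambda>i. i - 1" "\<lambda>i. i + 1"]; simp)
      (rule sum.reindex_bij_witness[of _ "\<lambda>i. i + 1" "\<lambda>i. i - 1"]; simp)
  show "(\<Sum>i\<in>UNIV. \<beta> i) = (\<Sum>i\<in>UNIV. \<alpha> i)"
    unfolding w(2)
    by (rule weyl_param_induct[where P = "\<lambda>\<gamma>. (\<Sum>i\<in>UNIV. \<gamma> i) = (\<Sum>i\<in>UNIV. \<alpha> i)", OF w(1) refl])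
      (simp_all only: sum_s_param rot)
qed

definition integrality :: "(6 \<Rightarrow> complex) \<Rightarrow> bool" where
  "integrality \<alpha> \<longleftrightarrow>
          (\<exists>i. \<alpha> (i+2) \<in> \<int> \<and> \<alpha> (i+3) \<in> \<int> \<and> \<alpha> (i+4) \<in> \<int> \<and> \<alpha> (i+5) \<in> \<int>) \<or>
          (\<exists>i. \<alpha> (i+1) \<in> \<int> \<and> \<alpha> (i+2) \<in> \<int> \<and> \<alpha> (i+4) \<in> \<int> \<and> \<alpha> (i+5) \<in> \<int>) \<or>
          (\<exists>i. \<alpha> (i+3) \<in> \<int> \<and> \<alpha> (i+5) \<in> \<int> \<and> \<alpha> i + \<alpha> (i+4) \<in> \<int> \<and> \<alpha> i - \<alpha> (i+2) \<in> \<int>) \<or>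
          (\<exists>i. \<alpha> (i+3) + \<alpha> (i+4) \<in> \<int> \<and> \<alpha> (i+4) + \<alpha> (i+5) \<in> \<int> \<and>
               \<alpha> i + \<alpha> (i+1) \<in> \<int> \<and> \<alpha> i - \<alpha> (i+4) \<in> \<int>) \<or>
          (\<exists>i. \<alpha> i + \<alpha> (i+1) \<in> \<int> \<and> \<alpha> i + \<alpha> (i+5) \<in> \<int> \<and> \<alpha> (i+2) + \<alpha> (i+3) \<in> \<int> \<and>
               \<alpha> (i+3) + \<alpha> (i+4) \<in> \<int> \<and> \<alpha> i + \<alpha> (i+3) \<in> \<int>)"

text \<open>Up to rotation and exchange of the classes there are four ways to split a cycle of six points as
  \<open>5 + 1\<close> or \<open>3 + 3\<close>: one isolated point, two arcs of length three, the alternating split, and one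
  asymmetric split.\<close>

lemma sign_patterns:
  fixes s :: "6 \<Rightarrow> int"
  assumes "\<forall>i. s i = 1 \<or> s i = - 1" "(\<Sum>i\<in>UNIV. s i) \<in> {4, - 4, 0 :: int}"
  shows "\<exists>i. s (i+2) = s i \<and> s (i+3) = s i \<and> s (i+4) = s i \<and> s (i+5) = s i
    \<or> s (i+2) = s (i+1) \<and> s (i+3) = s (i+1) \<and> s (i+4) = s i \<and> s (i+5) = s i
    \<or> s (i+2) = s i \<and> s (i+5) = s i \<and> s (i+3) = s (i+1) \<and> s (i+4) = s (i+1)
    \<or> s (i+2) = s i \<and> s (i+4) = s i \<and> s (i+3) = s (i+1) \<and> s (i+5) = s (i+1)"
proof -
  have "s 0 = 1 \<or> s 0 = - 1" "s 1 = 1 \<or> s 1 = - 1" "s 2 = 1 \<or> s 2 = - 1"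
    "s 3 = 1 \<or> s 3 = - 1" "s 4 = 1 \<or> s 4 = - 1" "s 5 = 1 \<or> s 5 = - 1"
    using assms(1) by blast+
  then show ?thesis
    using assms(2) unfolding sum_6 ex_6 by (elim disjE) simp_all
qed

lemma two_classes_integrality:
  assumes "two_classes \<alpha>"
  shows "integrality \<alpha>"
proof -
  obtain x s where s: "\<forall>i. s i = 1 \<or> s i = - 1" "(\<Sum>i\<in>UNIV. s i) \<in> {4, - 4, 0 :: int}"
    and xs: "\<And>i. \<alpha> i - of_int (s i - s (i+1)) * x \<in> \<int>"
    using assms unfolding two_classes_def by blast
  obtain i where i: "s (i+2) = s i \<and> s (i+3) = s i \<and> s (i+4) = s i \<and> s (i+5) = s i
    \<or> s (i+2) = s (i+1) \<and> s (i+3) = s (i+1) \<and> s (i+4) = s i \<and> s (i+5) = s i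
    \<or> s (i+2) = s i \<and> s (i+5) = s i \<and> s (i+3) = s (i+1) \<and> s (i+4) = s (i+1)
    \<or> s (i+2) = s i \<and> s (i+4) = s i \<and> s (i+3) = s (i+1) \<and> s (i+5) = s (i+1)"
    using sign_patterns[OF s] by blast
  have idx: "i+1+1 = i+2" "i+2+1 = i+3" "i+3+1 = i+4" "i+4+1 = i+5" "i+5+1 = i"
    by (simp_all add: add.assoc)
  note I = xs[of i] xs[of "i+1", unfolded idx] xs[of "i+2", unfolded idx] xs[of "i+3", unfolded idx]
    xs[of "i+4", unfolded idx] xs[of "i+5", unfolded idx]
  show ?thesis
    using i
  proof (elim disjE conjE)
    assume e: "s (i+2) = s i" "s (i+3) = s i" "s (i+4) = s i" "s (i+5) = s i"
    show ?thesis using I(3-6) unfolding e integrality_def by auto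
  next
    assume e: "s (i+2) = s (i+1)" "s (i+3) = s (i+1)" "s (i+4) = s i" "s (i+5) = s i"
    show ?thesis using I(2,3,5,6) unfolding e integrality_def by auto
  next
    assume e: "s (i+2) = s i" "s (i+5) = s i" "s (i+3) = s (i+1)" "s (i+4) = s (i+1)"
    have "\<alpha> i + \<alpha> (i+4) = (\<alpha> i - of_int (s i - s (i+1)) * x) + (\<alpha> (i+4) - of_int (s (i+4) - s (i+5)) * x)"
      "\<alpha> i - \<alpha> (i+2) = (\<alpha> i - of_int (s i - s (i+1)) * x) - (\<alpha> (i+2) - of_int (s (i+2) - s (i+3)) * x)"
      unfolding e by (simp_all add: algebra_simps)
    then have "\<alpha> i + \<alpha> (i+4) \<in> \<int>" "\<alpha> i - \<alpha> (i+2) \<in> \<int>"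
      using Ints_add[OF I(1) I(5)] Ints_diff[OF I(1) I(3)] by (simp_all only:)
    moreover have "\<alpha> (i+3) \<in> \<int>" "\<alpha> (i+5) \<in> \<int>" using I(4,6) unfolding e by simp_all
    ultimately show ?thesis unfolding integrality_def by blast
  next
    assume e: "s (i+2) = s i" "s (i+4) = s i" "s (i+3) = s (i+1)" "s (i+5) = s (i+1)"
    let ?c = "of_int (s i - s (i+1)) * x"
    have J: "\<alpha> i - ?c \<in> \<int>" "\<alpha> (i+1) + ?c \<in> \<int>" "\<alpha> (i+2) - ?c \<in> \<int>" "\<alpha> (i+3) + ?c \<in> \<int>"
      "\<alpha> (i+4) - ?c \<in> \<int>" "\<alpha> (i+5) + ?c \<in> \<int>"
      using I unfolding e by (simp_all add: algebra_simps)
    have "a + b \<in> \<int>" if "a - ?c \<in> \<int>" "b + ?c \<in> \<int>" for a b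
      using Ints_add[OF that] by simp
    then have "\<alpha> i + \<alpha> (i+1) \<in> \<int>" "\<alpha> i + \<alpha> (i+5) \<in> \<int>" "\<alpha> (i+2) + \<alpha> (i+3) \<in> \<int>"
      "\<alpha> (i+4) + \<alpha> (i+3) \<in> \<int>" "\<alpha> i + \<alpha> (i+3) \<in> \<int>"
      using J by blast+
    then show ?thesis unfolding integrality_def by (metis add.commute)
  qed
qed

text \<open>The translation by which \<open>move\<close> acts is \<open>\<pi>\<inverse> s\<^sub>5 s\<^sub>4 s\<^sub>3 s\<^sub>2 s\<^sub>1\<close> for \<open>k = 0\<close>, \<open>l = 1\<close>, \<open>n = 1\<close>.\<close>

definition move :: "int \<Rightarrow> 6 \<Rightarrow> 6 \<Rightarrow> (6 \<Rightarrow> complex) \<Rightarrow> 6 \<Rightarrow> complex" where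
  "move n k l \<alpha> = (\<lambda>i. \<alpha> i - (if i = k then of_int n else 0) + (if i = l then of_int n else 0))"

lemma sum_move: "(\<Sum>i\<in>UNIV. move n k l \<alpha> i) = (\<Sum>i\<in>UNIV. \<alpha> i)"
  by (simp add: move_def sum.distrib sum_subtractf)

lemma move_add: "move m k l (move n k l \<alpha>) = move (m + n) k l \<alpha>"
  by (simp add: move_def fun_eq_iff)

lemma move_trans: "move n l m (move n k l \<alpha>) = move n k m \<alpha>"
  by (simp add: move_def fun_eq_iff)

lemmas s_param_1 = s_param_nth[of 1, simplified]
  and s_param_2 = s_param_nth[of 2, simplified]
  and s_param_3 = s_param_nth[of 3, simplified]
  and s_param_4 = s_param_nth[of 4, simplified]
  and s_param_5 = s_param_nth[of 5, simplified]

lemma param_orbit_move_0: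
  assumes "(\<Sum>i\<in>UNIV. \<alpha> i) = 1"
  shows "param_orbit \<alpha> (move 1 0 1 \<alpha>)"
proof -
  let ?\<beta> = "s_param 5 (s_param 4 (s_param 3 (s_param 2 (s_param 1 \<alpha>))))"
  have "\<alpha> 0 + \<alpha> 1 + \<alpha> 2 + \<alpha> 3 + \<alpha> 4 + \<alpha> 5 = 1" using assms by (simp only: sum_6)
  then have a0: "\<alpha> 0 = 1 - \<alpha> 1 - \<alpha> 2 - \<alpha> 3 - \<alpha> 4 - \<alpha> 5" by (simp add: algebra_simps)
  have "\<forall>i. pi_param (move 1 0 1 \<alpha>) i = ?\<beta> i"
    unfolding all_6 pi_param_def move_def
    by (simp add: s_param_1 s_param_2 s_param_3 s_param_4 s_param_5 a0)
  then have "pi_param (move 1 0 1 \<alpha>) = ?\<beta>" by blast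
  then have "param_orbit (move 1 0 1 \<alpha>) ?\<beta>" using param_orbit_pi by metis
  moreover have "param_orbit \<alpha> ?\<beta>"
    using param_orbit_s param_orbit_trans by meson
  ultimately show ?thesis using param_orbit_sym param_orbit_trans by blast
qed

lemma param_orbit_rotate: "param_orbit \<alpha> (\<lambda>i. \<alpha> (i + k))"
proof (rule cycle_induct[where P = "\<lambda>k. param_orbit \<alpha> (\<lambda>i. \<alpha> (i + k))" and i = 0])
  fix k assume "param_orbit \<alpha> (\<lambda>i. \<alpha> (i + k))"
  moreover have "pi_param (\<lambda>i. \<alpha> (i + k)) = (\<lambda>i. \<alpha> (i + (k + 1)))"
    by (simp add: pi_param_def fun_eq_iff ac_simps)
  ultimately show "param_orbit \<alpha> (\<lambda>i. \<alpha> (i + (k + 1)))"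
    using param_orbit_pi param_orbit_trans by metis
qed (simp add: param_orbit_refl)

lemma sum_rotate: "(\<Sum>i\<in>UNIV. \<alpha> (i + k :: 6)) = (\<Sum>i\<in>UNIV. \<alpha> i)"
  by (rule sum.reindex_bij_witness[of _ "\<lambda>i. i - k" "\<lambda>i. i + k"]) simp_all

lemma param_orbit_move:
  assumes sum: "(\<Sum>i\<in>UNIV. \<alpha> i) = 1"
  shows "param_orbit \<alpha> (move n k l \<alpha>)"
proof -
  have unit: "param_orbit \<alpha> (move 1 k (k+1) \<alpha>)" if "(\<Sum>i\<in>UNIV. \<alpha> i) = 1" for k \<alpha>
  proof -
    have o1: "param_orbit \<alpha> (\<lambda>i. \<alpha> (i + k))" by (rule param_orbit_rotate)
    have o2: "param_orbit (\<lambda>i. \<alpha> (i + k)) (move 1 0 1 (\<lambda>i. \<alpha> (i + k)))"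
      by (rule param_orbit_move_0) (simp only: sum_rotate that)
    have o3: "param_orbit (move 1 k (k+1) \<alpha>) (\<lambda>i. move 1 k (k+1) \<alpha> (i + k))"
      by (rule param_orbit_rotate)
    have e: "(\<lambda>i. move 1 k (k+1) \<alpha> (i + k)) = move 1 0 1 (\<lambda>i. \<alpha> (i + k))"
    proof
      fix i
      have "i + k = k \<longleftrightarrow> i = 0" by simp
      moreover have "i + k = k + 1 \<longleftrightarrow> i = 1" by (metis add.commute add_right_cancel)
      ultimately show "move 1 k (k+1) \<alpha> (i + k) = move 1 0 1 (\<lambda>i. \<alpha> (i + k)) i"
        unfolding move_def by (simp only:)
    qed
    show ?thesis
      by (rule param_orbit_trans[OF o1 param_orbit_trans[OF o2 param_orbit_sym[OF o3[unfolded e]]]])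
  qed
  have next_n: "param_orbit \<alpha> (move n k (k+1) \<alpha>)" if "(\<Sum>i\<in>UNIV. \<alpha> i) = 1" for n k \<alpha>
  proof (induction n rule: int_induct[of _ 0])
    case base
    have "move 0 k (k+1) \<alpha> = \<alpha>" by (rule ext) (simp add: move_def)
    then show ?case by (simp only: param_orbit_refl)
  next
    case (step1 n)
    have "param_orbit (move n k (k+1) \<alpha>) (move 1 k (k+1) (move n k (k+1) \<alpha>))"
      by (rule unit) (simp only: sum_move that)
    from param_orbit_trans[OF step1(2) this] show ?case
      unfolding move_add by (simp only: add.commute[of 1 n])
  next
    case (step2 n)
    have "param_orbit (move (n - 1) k (k+1) \<alpha>) (move 1 k (k+1) (move (n - 1) k (k+1) \<alpha>))"
      by (rule unit) (simp only: sum_move that)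
    then have "param_orbit (move (n - 1) k (k+1) \<alpha>) (move n k (k+1) \<alpha>)"
      unfolding move_add by simp
    then show ?case using step2(2) param_orbit_trans param_orbit_sym by blast
  qed
  show ?thesis
  proof (rule cycle_induct[where P = "\<lambda>l. param_orbit \<alpha> (move n k l \<alpha>)" and i = k])
    have "move n k k \<alpha> = \<alpha>" by (simp add: move_def)
    then show "param_orbit \<alpha> (move n k k \<alpha>)" by (simp only: param_orbit_refl)
    fix l assume "param_orbit \<alpha> (move n k l \<alpha>)"
    moreover have "param_orbit (move n k l \<alpha>) (move n l (l+1) (move n k l \<alpha>))"
      by (rule next_n) (simp only: sum_move sum)
    ultimately show "param_orbit \<alpha> (move n k (l+1) \<alpha>)"
      using param_orbit_trans unfolding move_trans by blast
  qed
qed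

text \<open>An integral parameter can be translated to another index.\<close>

lemma param_orbit_clear:
  assumes "(\<Sum>i\<in>UNIV. \<alpha> i) = 1" "\<alpha> k \<in> \<int>" "k \<noteq> l"
  obtains \<beta> where "param_orbit \<alpha> \<beta>" "(\<Sum>i\<in>UNIV. \<beta> i) = 1" "\<beta> k = 0" "\<And>i. i \<noteq> k \<Longrightarrow> i \<noteq> l \<Longrightarrow> \<beta> i = \<alpha> i"
proof -
  obtain n where n: "\<alpha> k = of_int n" using assms(2) by (rule Ints_cases)
  show thesis
  proof
    show "param_orbit \<alpha> (move n k l \<alpha>)" by (rule param_orbit_move[OF assms(1)])
    show "(\<Sum>i\<in>UNIV. move n k l \<alpha> i) = 1" by (simp only: sum_move assms(1))
    show "move n k l \<alpha> k = 0" using assms(3) by (simp add: move_def n)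
    show "\<And>i. i \<noteq> k \<Longrightarrow> i \<noteq> l \<Longrightarrow> move n k l \<alpha> i = \<alpha> i" by (simp add: move_def)
  qed
qed

lemma hexad_nth [simp]:
  "hexad a b c d e f 0 = a" "hexad a b c d e f 1 = b" "hexad a b c d e f 2 = c"
  "hexad a b c d e f 3 = d" "hexad a b c d e f 4 = e" "hexad a b c d e f 5 = f"
  by (simp_all add: hexad_def)

lemma eq_hexad_iff:
  "g = hexad a b c d e f \<longleftrightarrow> g 0 = a \<and> g 1 = b \<and> g 2 = c \<and> g 3 = d \<and> g 4 = e \<and> g 5 = f"
  unfolding fun_eq_iff all_6 by simp

text \<open>The parameters of the first and of the second normal form; those of the third are
  \<open>adjacent_params 0\<close>.\<close>

definition adjacent_params :: "complex \<Rightarrow> 6 \<Rightarrow> complex" where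
  "adjacent_params a = hexad a (1 - a) 0 0 0 0"

definition opposite_params :: "complex \<Rightarrow> 6 \<Rightarrow> complex" where
  "opposite_params a = hexad a 0 0 (1 - a) 0 0"

lemma param_orbit_clear_set:
  assumes "finite K" "0 \<notin> K" "\<forall>k\<in>K. \<alpha> k \<in> \<int>" "(\<Sum>i\<in>UNIV. \<alpha> i) = 1"
  shows "\<exists>\<beta>. param_orbit \<alpha> \<beta> \<and> (\<Sum>i\<in>UNIV. \<beta> i) = 1 \<and> (\<forall>k\<in>K. \<beta> k = 0) \<and>
    (\<forall>i. i \<notin> K \<and> i \<noteq> 0 \<longrightarrow> \<beta> i = \<alpha> i)"
  using assms(1-3)
proof (induction K rule: finite_induct)
  case empty
  then show ?case using param_orbit_refl assms(4) by blast
next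
  case (insert k K)
  then obtain \<beta> where b: "param_orbit \<alpha> \<beta>" "(\<Sum>i\<in>UNIV. \<beta> i) = 1" "\<forall>j\<in>K. \<beta> j = 0"
    "\<forall>i. i \<notin> K \<and> i \<noteq> 0 \<longrightarrow> \<beta> i = \<alpha> i" by auto
  have k: "\<beta> k \<in> \<int>" "k \<noteq> 0" using b(4) insert by auto
  obtain \<gamma> where c: "param_orbit \<beta> \<gamma>" "(\<Sum>i\<in>UNIV. \<gamma> i) = 1" "\<gamma> k = 0"
    "\<And>i. i \<noteq> k \<Longrightarrow> i \<noteq> 0 \<Longrightarrow> \<gamma> i = \<beta> i"
    by (rule param_orbit_clear[OF b(2) k]) (rule that)
  have "\<forall>j\<in>insert k K. \<gamma> j = 0"
  proof
    fix j assume j: "j \<in> insert k K"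
    then have "j \<noteq> 0" using insert.prems(1) by auto
    then show "\<gamma> j = 0" using j b(3) c(3,4) by (cases "j = k") auto
  qed
  moreover have "\<forall>i. i \<notin> insert k K \<and> i \<noteq> 0 \<longrightarrow> \<gamma> i = \<alpha> i" using b(4) c(4) by simp
  ultimately show ?case using param_orbit_trans[OF b(1) c(1)] c(2) by blast
qed

lemma orbit_adjacent:
  assumes "(\<Sum>i\<in>UNIV. \<alpha> i) = 1" "\<alpha> 2 \<in> \<int>" "\<alpha> 3 \<in> \<int>" "\<alpha> 4 \<in> \<int>" "\<alpha> 5 \<in> \<int>"
  shows "\<exists>a. param_orbit \<alpha> (adjacent_params a)"
proof -
  obtain \<beta> where b: "param_orbit \<alpha> \<beta>" "(\<Sum>i\<in>UNIV. \<beta> i) = 1" "\<forall>k\<in>{2, 3, 4, 5}. \<beta> k = 0"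
    using param_orbit_clear_set[of "{2, 3, 4, 5}" \<alpha>] assms by auto
  have "\<beta> 1 = 1 - \<beta> 0" using b(2,3) unfolding sum_6 by (simp add: eq_diff_eq add.commute)
  then have "\<beta> = adjacent_params (\<beta> 0)"
    unfolding adjacent_params_def eq_hexad_iff using b(3) by simp
  then show ?thesis using b(1) by metis
qed

lemma orbit_opposite:
  assumes "(\<Sum>i\<in>UNIV. \<alpha> i) = 1" "\<alpha> 1 \<in> \<int>" "\<alpha> 2 \<in> \<int>" "\<alpha> 4 \<in> \<int>" "\<alpha> 5 \<in> \<int>"
  shows "\<exists>a. param_orbit \<alpha> (opposite_params a)"
proof -
  obtain \<beta> where b: "param_orbit \<alpha> \<beta>" "(\<Sum>i\<in>UNIV. \<beta> i) = 1" "\<forall>k\<in>{1, 2, 4, 5}. \<beta> k = 0"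
    using param_orbit_clear_set[of "{1, 2, 4, 5}" \<alpha>] assms by auto
  have "\<beta> 3 = 1 - \<beta> 0" using b(2,3) unfolding sum_6 by (simp add: eq_diff_eq add.commute)
  then have "\<beta> = opposite_params (\<beta> 0)"
    unfolding opposite_params_def eq_hexad_iff using b(3) by simp
  then show ?thesis using b(1) by metis
qed

text \<open>Two arcs of length three are the pattern of \<open>opposite_params\<close>.  The asymmetric split is turned into
  this one by a single reflection \<open>s\<^sub>1\<close>, the alternating one by \<open>s\<^sub>1\<close> and \<open>s\<^sub>4\<close>.\<close>

lemma integrality_orbit:
  assumes sum: "(\<Sum>i\<in>UNIV. \<alpha> i) = 1" and int: "integrality \<alpha>"
  shows "\<exists>a. param_orbit \<alpha> (adjacent_params a) \<or> param_orbit \<alpha> (opposite_params a)"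
proof -
  have sum': "(\<Sum>j\<in>UNIV. \<alpha> (j + i)) = 1" for i by (simp only: sum_rotate sum)
  have opp: "\<exists>a. param_orbit \<alpha> (opposite_params a)"
    if "param_orbit \<alpha> \<beta>" "(\<Sum>j\<in>UNIV. \<beta> j) = 1" "\<beta> (i+1) \<in> \<int>" "\<beta> (i+2) \<in> \<int>" "\<beta> (i+4) \<in> \<int>" "\<beta> (i+5) \<in> \<int>"
    for \<beta> i
    using orbit_opposite[of "\<lambda>j. \<beta> (j + i)"] that param_orbit_rotate[of \<beta> i] param_orbit_trans
    by (simp add: sum_rotate add.commute) meson
  have swap: "\<exists>a. param_orbit \<alpha> (opposite_params a)"
    if "\<beta> = (\<lambda>j. \<alpha> (j + i))" "\<beta> 0 + \<beta> 1 \<in> \<int>" "\<beta> 1 + \<beta> 2 \<in> \<int>" "\<beta> 3 \<in> \<int>" "\<beta> 5 \<in> \<int>" for \<beta> i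
  proof (rule opp[of "s_param 1 \<beta>" 1])
    show "param_orbit \<alpha> (s_param 1 \<beta>)"
      unfolding that(1) by (rule param_orbit_trans[OF param_orbit_rotate param_orbit_s])
    show "(\<Sum>j\<in>UNIV. s_param 1 \<beta> j) = 1" by (simp only: sum_s_param that(1) sum')
    show "s_param 1 \<beta> (1+1) \<in> \<int>" "s_param 1 \<beta> (1+2) \<in> \<int>" "s_param 1 \<beta> (1+4) \<in> \<int>" "s_param 1 \<beta> (1+5) \<in> \<int>"
      unfolding s_param_nth using that by (simp_all add: add.commute)
  qed
  have swap2: "\<exists>a. param_orbit \<alpha> (opposite_params a)"
    if "\<beta> = (\<lambda>j. \<alpha> (j + i))" "\<beta> 0 + \<beta> 1 \<in> \<int>" "\<beta> 1 + \<beta> 2 \<in> \<int>" "\<beta> 3 + \<beta> 4 \<in> \<int>" "\<beta> 4 + \<beta> 5 \<in> \<int>"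
    for \<beta> i
  proof (rule opp[of "s_param 4 (s_param 1 \<beta>)" 1])
    show "param_orbit \<alpha> (s_param 4 (s_param 1 \<beta>))"
      unfolding that(1)
      by (rule param_orbit_trans[OF param_orbit_trans[OF param_orbit_rotate param_orbit_s] param_orbit_s])
    show "(\<Sum>j\<in>UNIV. s_param 4 (s_param 1 \<beta>) j) = 1" by (simp only: sum_s_param that(1) sum')
    show "s_param 4 (s_param 1 \<beta>) (1+1) \<in> \<int>" "s_param 4 (s_param 1 \<beta>) (1+2) \<in> \<int>"
      "s_param 4 (s_param 1 \<beta>) (1+4) \<in> \<int>" "s_param 4 (s_param 1 \<beta>) (1+5) \<in> \<int>"
      using that unfolding s_param_def index_minus_1 by (simp_all add: add.commute)
  qed
  from int show ?thesis
    unfolding integrality_def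
  proof (elim disjE exE conjE)
    fix i assume "\<alpha> (i+2) \<in> \<int>" "\<alpha> (i+3) \<in> \<int>" "\<alpha> (i+4) \<in> \<int>" "\<alpha> (i+5) \<in> \<int>"
    then obtain a where "param_orbit (\<lambda>j. \<alpha> (j + i)) (adjacent_params a)"
      using orbit_adjacent[of "\<lambda>j. \<alpha> (j + i)", OF sum'] by (auto simp: add.commute)
    then show ?thesis using param_orbit_rotate param_orbit_trans by blast
  next
    fix i assume "\<alpha> (i+1) \<in> \<int>" "\<alpha> (i+2) \<in> \<int>" "\<alpha> (i+4) \<in> \<int>" "\<alpha> (i+5) \<in> \<int>"
    then show ?thesis using opp[OF param_orbit_refl sum] by blast
  next
    fix i
    define \<beta> where "\<beta> = (\<lambda>j. \<alpha> (j + i))"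
    assume "\<alpha> (i+3) \<in> \<int>" "\<alpha> (i+5) \<in> \<int>" "\<alpha> i + \<alpha> (i+4) \<in> \<int>" "\<alpha> i - \<alpha> (i+2) \<in> \<int>"
    then have I: "\<beta> 3 \<in> \<int>" "\<beta> 5 \<in> \<int>" "\<beta> 0 + \<beta> 4 \<in> \<int>" "\<beta> 0 - \<beta> 2 \<in> \<int>"
      by (simp_all add: \<beta>_def add.commute)
    have S: "\<beta> 0 + \<beta> 1 + \<beta> 2 + \<beta> 3 + \<beta> 4 + \<beta> 5 = 1"
      using sum'[of i] unfolding sum_6 \<beta>_def .
    have "\<beta> 0 + \<beta> 1 = 1 - \<beta> 3 - \<beta> 5 - (\<beta> 0 + \<beta> 4) + (\<beta> 0 - \<beta> 2)"
      "\<beta> 1 + \<beta> 2 = 1 - \<beta> 3 - \<beta> 5 - (\<beta> 0 + \<beta> 4)"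
      using S by (simp_all add: algebra_simps)
    then have "\<beta> 0 + \<beta> 1 \<in> \<int>" "\<beta> 1 + \<beta> 2 \<in> \<int>"
      using I by (simp_all only: Ints_add Ints_diff Ints_1)
    then show ?thesis using swap[OF \<beta>_def] I(1,2) by blast
  next
    fix i
    define \<beta> where "\<beta> = (\<lambda>j. \<alpha> (j + i))"
    assume "\<alpha> (i+3) + \<alpha> (i+4) \<in> \<int>" "\<alpha> (i+4) + \<alpha> (i+5) \<in> \<int>" "\<alpha> i + \<alpha> (i+1) \<in> \<int>" "\<alpha> i - \<alpha> (i+4) \<in> \<int>"
    then have I: "\<beta> 3 + \<beta> 4 \<in> \<int>" "\<beta> 4 + \<beta> 5 \<in> \<int>" "\<beta> 0 + \<beta> 1 \<in> \<int>" "\<beta> 0 - \<beta> 4 \<in> \<int>"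
      by (simp_all add: \<beta>_def add.commute)
    have S: "\<beta> 0 + \<beta> 1 + \<beta> 2 + \<beta> 3 + \<beta> 4 + \<beta> 5 = 1"
      using sum'[of i] unfolding sum_6 \<beta>_def .
    have "\<beta> 1 + \<beta> 2 = 1 - (\<beta> 3 + \<beta> 4) - (\<beta> 0 - \<beta> 4) - (\<beta> 4 + \<beta> 5)"
      using S by (simp add: algebra_simps)
    then have "\<beta> 1 + \<beta> 2 \<in> \<int>"
      using I by (simp only: Ints_add Ints_diff Ints_1)
    then show ?thesis using swap2[OF \<beta>_def I(3) _ I(1,2)] by blast
  next
    fix i
    define \<beta> where "\<beta> = (\<lambda>j. \<alpha> (j + i))"
    assume "\<alpha> i + \<alpha> (i+1) \<in> \<int>" "\<alpha> i + \<alpha> (i+5) \<in> \<int>" "\<alpha> (i+2) + \<alpha> (i+3) \<in> \<int>"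
      "\<alpha> (i+3) + \<alpha> (i+4) \<in> \<int>" "\<alpha> i + \<alpha> (i+3) \<in> \<int>"
    then have I: "\<beta> 0 + \<beta> 1 \<in> \<int>" "\<beta> 0 + \<beta> 5 \<in> \<int>" "\<beta> 2 + \<beta> 3 \<in> \<int>" "\<beta> 3 + \<beta> 4 \<in> \<int>" "\<beta> 0 + \<beta> 3 \<in> \<int>"
      by (simp_all add: \<beta>_def add.commute)
    have "\<beta> 1 + \<beta> 2 = (\<beta> 0 + \<beta> 1) - (\<beta> 0 + \<beta> 3) + (\<beta> 2 + \<beta> 3)"
      "\<beta> 4 + \<beta> 5 = (\<beta> 3 + \<beta> 4) - (\<beta> 0 + \<beta> 3) + (\<beta> 0 + \<beta> 5)" by simp_all
    then have "\<beta> 1 + \<beta> 2 \<in> \<int>" "\<beta> 4 + \<beta> 5 \<in> \<int>"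
      using I by (simp_all only: Ints_add Ints_diff)
    then show ?thesis using swap2[OF \<beta>_def I(1) _ I(4)] by blast
  qed
qed

lemma two_classes_adjacent: "two_classes (adjacent_params a)"
  unfolding two_classes_def
proof (intro exI conjI)
  let ?s = "hexad 1 (- 1) 1 1 1 1 :: 6 \<Rightarrow> int"
  show "\<forall>i. ?s i = 1 \<or> ?s i = - 1" "(\<Sum>i\<in>UNIV. ?s i) \<in> {4, - 4, 0 :: int}"
    unfolding all_6 sum_6 by simp_all
  show "\<forall>i. adjacent_params a i - of_int (?s i - ?s (i+1)) * (a / 2) \<in> \<int>"
    unfolding all_6 adjacent_params_def by simp
qed

lemma two_classes_opposite: "two_classes (opposite_params a)"
  unfolding two_classes_def
proof (intro exI conjI)
  let ?s = "hexad 1 (- 1) (- 1) (- 1) 1 1 :: 6 \<Rightarrow> int"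
  show "\<forall>i. ?s i = 1 \<or> ?s i = - 1" "(\<Sum>i\<in>UNIV. ?s i) \<in> {4, - 4, 0 :: int}"
    unfolding all_6 sum_6 by simp_all
  show "\<forall>i. opposite_params a i - of_int (?s i - ?s (i+1)) * (a / 2) \<in> \<int>"
    unfolding all_6 opposite_params_def by simp
qed

lemma orbit_of_seeds:
  "(\<Union>w\<in>weyl_param. w ` (range (\<lambda>a. hexad a (1 - a) 0 0 0 0) \<union>
      range (\<lambda>a. hexad a 0 0 (1 - a) 0 0) \<union> {hexad 0 1 0 0 0 0}))
   = {\<alpha> \<in> parameters. integrality \<alpha>}" (is "?L = ?R")
proof -
  let ?S = "range adjacent_params \<union> range opposite_params"
  have seeds: "range (\<lambda>a. hexad a (1 - a) 0 0 0 0) \<union> range (\<lambda>a. hexad a 0 0 (1 - a) 0 0)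
      \<union> {hexad 0 1 0 0 0 0 :: 6 \<Rightarrow> complex} = ?S"
  proof -
    have "hexad 0 1 0 0 0 0 = adjacent_params 0" by (simp add: adjacent_params_def)
    then have "hexad 0 1 0 0 0 0 \<in> range adjacent_params" by (metis rangeI)
    moreover have "range (\<lambda>a. hexad a (1 - a) 0 0 0 0) = range adjacent_params"
      "range (\<lambda>a. hexad a 0 0 (1 - a) 0 0) = range opposite_params"
      by (simp_all add: adjacent_params_def[abs_def] opposite_params_def[abs_def])
    ultimately show ?thesis by blast
  qed
  have "?L = {\<alpha>. \<exists>\<beta>\<in>?S. param_orbit \<beta> \<alpha>}"
    unfolding seeds param_orbit_def by blast
  also have "\<dots> = ?R"
  proof (intro equalityI subsetI)
    fix \<alpha> assume "\<alpha> \<in> {\<alpha>. \<exists>\<beta>\<in>?S. param_orbit \<beta> \<alpha>}"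
    then obtain \<beta> where b: "\<beta> \<in> ?S" "param_orbit \<beta> \<alpha>" by blast
    have "(\<Sum>i\<in>UNIV. \<beta> i) = 1"
      using b(1) by (auto simp: adjacent_params_def opposite_params_def sum_6)
    moreover have "two_classes \<beta>"
      using b(1) two_classes_adjacent two_classes_opposite by blast
    ultimately show "\<alpha> \<in> ?R"
      using param_orbit_invariants[OF b(2)] two_classes_integrality by (simp add: parameters_def)
  next
    fix \<alpha> assume "\<alpha> \<in> ?R"
    then have "\<exists>a. param_orbit \<alpha> (adjacent_params a) \<or> param_orbit \<alpha> (opposite_params a)"
      using integrality_orbit by (simp add: parameters_def)
    then show "\<alpha> \<in> {\<alpha>. \<exists>\<beta>\<in>?S. param_orbit \<beta> \<alpha>}" using param_orbit_sym by blast
  qed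
  finally show ?thesis .
qed

section \<open>Baecklund transformations of the chain\<close>

definition type_A_chain :: "(6 \<Rightarrow> complex) \<Rightarrow> (6 \<Rightarrow> ratfun) \<Rightarrow> bool" where
  "type_A_chain \<alpha> u \<longleftrightarrow> dressing_chain \<alpha> u \<and> (\<exists>\<sigma>. infinity_signs \<sigma> u)"

lemma sols_double: "2 * sols u i = u i + u (i+1)"
  by (simp add: sols_def)

text \<open>In terms of the chain, \<open>s\<^sub>i\<close> adds \<open>\<minusplus> 2 \<alpha> i / f i\<close> to \<open>u i\<close> and \<open>u (i+1)\<close>.  By the equation for
  \<open>f i\<close> the results are \<open>u (i+1) - f' i / f i\<close> and \<open>u i + f' i / f i\<close>, so the signs at infinity are
  interchanged.\<close>

lemma s_state_chain:
  assumes "type_A_chain \<alpha> u"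
  shows "\<exists>v. s_state i (\<alpha>, sols u) = (s_param i \<alpha>, sols v) \<and> type_A_chain (s_param i \<alpha>) v"
proof (cases "sols u i = 0")
  case True
  have chain: "dressing_chain \<alpha> u" using assms by (simp add: type_A_chain_def)
  have "u (i+1) = - u i" using sols_double[of u i] True by (simp add: eq_neg_iff_add_eq_0 add.commute)
  then have "4 * rconst (\<alpha> i) = 0"
    using chain_link[OF chain, of i] by (simp add: lower_def upper_def fract_deriv_minus)
  then have "\<alpha> i = 0" by simp
  then have "s_param i \<alpha> = \<alpha>" by (auto simp: s_param_def fun_eq_iff)
  then show ?thesis using True assms by (intro exI[of _ u]) (simp add: s_state_def)
next
  case False
  have chain: "dressing_chain \<alpha> u" using assms by (simp add: type_A_chain_def)
  obtain \<sigma> where \<sigma>: "infinity_signs \<sigma> u" using assms by (auto simp: type_A_chain_def)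
  define f where "f = sols u i"
  define a where "a = rconst (\<alpha> i)"
  define g where "g = 2 * a / f"
  define p where "p = u i"
  define q where "q = u (i+1)"
  define r where "r = fract_deriv f / f"
  have f: "f \<noteq> 0" using False by (simp add: f_def)
  have gf: "g * f = 2 * a" using f by (simp add: g_def)
  have rf: "r * f = fract_deriv f" using f by (simp add: r_def)
  have pq: "p + q = 2 * f" unfolding p_def q_def f_def sols_double ..
  have dpq: "fract_deriv p + fract_deriv q = 2 * fract_deriv f"
    using arg_cong[OF pq, of fract_deriv]
    by (simp only: fract_deriv_add fract_deriv_mult fract_deriv_numeral mult_zero_left add_0)
  have link: "lower fract_deriv q = upper fract_deriv p - 4 * a"
    unfolding p_def q_def a_def by (rule chain_link[OF chain])
  have link': "fract_deriv p + fract_deriv q = (p + q) * (q - p) + 4 * a"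
    using link unfolding lower_def upper_def by algebra
  have "(2 * f) * r = (2 * f) * (q - p + g)"
    using link' rf gf unfolding pq dpq by algebra
  then have r: "r = q - p + g" using f by simp
  have dg: "fract_deriv g = - g * (q - p) - g * g"
  proof -
    have "fract_deriv (g * f) = 0"
      unfolding gf a_def by (simp add: fract_deriv_mult)
    then have "f * fract_deriv g = f * (- g * (q - p) - g * g)"
      unfolding fract_deriv_mult rf[symmetric] r by algebra
    then show ?thesis using f mult_left_cancel by blast
  qed
  define v where "v = u(i := p - g, i+1 := q + g)"
  have v: "v i = p - g" "v (i+1) = q + g" "v (i+2) = u (i+2)" "v (i+3) = u (i+3)"
    "v (i+4) = u (i+4)" "v (i+5) = u (i+5)"
    by (simp_all add: v_def)
  have idx: "i+1+1 = i+2" "i+2+1 = i+3" "i+3+1 = i+4" "i+4+1 = i+5" "i+5+1 = i"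
    by (simp_all add: add.assoc)
  have "dressing_chain (s_param i \<alpha>) v"
    unfolding dressing_chain_def all_6_shift[of _ i] idx v s_param_nth
  proof (intro conjI)
    show "lower fract_deriv (q + g) = upper fract_deriv (p - g) - 4 * rconst (- \<alpha> i)"
      unfolding rconst_minus a_def[symmetric] lower_def upper_def fract_deriv_add fract_deriv_diff
      using link' gf pq by algebra
    have "lower fract_deriv (u (i+2)) = upper fract_deriv q - 4 * rconst (\<alpha> (i+1))"
      using chain_link[OF chain, of "i+1"] unfolding idx q_def .
    moreover have "upper fract_deriv (q + g) = upper fract_deriv q + 4 * a"
      unfolding upper_def fract_deriv_add dg using gf pq by algebra
    ultimately show "lower fract_deriv (u (i+2)) = upper fract_deriv (q + g) - 4 * rconst (\<alpha> (i+1) + \<alpha> i)"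
      unfolding rconst_add a_def[symmetric] by algebra
    show "lower fract_deriv (u (i+3)) = upper fract_deriv (u (i+2)) - 4 * rconst (\<alpha> (i+2))"
      using chain_link[OF chain, of "i+2"] unfolding idx .
    show "lower fract_deriv (u (i+4)) = upper fract_deriv (u (i+3)) - 4 * rconst (\<alpha> (i+3))"
      using chain_link[OF chain, of "i+3"] unfolding idx .
    show "lower fract_deriv (u (i+5)) = upper fract_deriv (u (i+4)) - 4 * rconst (\<alpha> (i+4))"
      using chain_link[OF chain, of "i+4"] unfolding idx .
    have "lower fract_deriv p = upper fract_deriv (u (i+5)) - 4 * rconst (\<alpha> (i+5))"
      using chain_link[OF chain, of "i+5"] unfolding idx p_def .
    moreover have "lower fract_deriv (p - g) = lower fract_deriv p - 4 * a"
      unfolding lower_def fract_deriv_diff dg using gf pq by algebra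
    ultimately show "lower fract_deriv (p - g) = upper fract_deriv (u (i+5)) - 4 * rconst (\<alpha> (i+5) + \<alpha> i)"
      unfolding rconst_add a_def[symmetric] by algebra
    have "(\<Sum>j\<in>UNIV. v j) = (\<Sum>j\<in>UNIV. u j)"
      unfolding sum_6_shift[of _ i] v p_def q_def by simp
    then show "(\<Sum>j\<in>UNIV. v j) = 2 * tvar" unfolding chain_sum[OF chain] .
  qed
  moreover have "infinity_signs (\<sigma>(i := \<sigma> (i+1), i+1 := \<sigma> i)) v"
  proof -
    have s: "\<And>j. (\<sigma> j = 1 \<or> \<sigma> j = - 1) \<and> asymptotic (\<sigma> j) (u j)"
      using \<sigma> by (simp add: infinity_signs_def)
    have ar: "asymptotic 0 r" unfolding r_def by (rule asymptotic_log_deriv[OF f])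
    have "asymptotic (\<sigma> i + 0) (p + r)" "asymptotic (\<sigma> (i+1) + - 0) (q + - r)"
      using s ar by (auto simp only: p_def q_def intro!: asymptotic_add asymptotic_minus)
    moreover have "p + r = q + g" "q + - r = p - g" unfolding r by simp_all
    ultimately have "asymptotic (\<sigma> i) (q + g)" "asymptotic (\<sigma> (i+1)) (p - g)" by simp_all
    then show ?thesis
      unfolding infinity_signs_def using s by (simp add: v_def)
  qed
  moreover have "s_state i (\<alpha>, sols u) = (s_param i \<alpha>, sols v)"
  proof -
    have h: "2 * rconst (\<alpha> i) / f = g" by (simp add: g_def a_def)
    have half: "rconst (\<alpha> i) / f = g / 2" unfolding h[symmetric] by simp
    have "\<forall>j. ((sols u)(i+1 := sols u (i+1) + rconst (\<alpha> i) / sols u i,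
        i-1 := sols u (i-1) - rconst (\<alpha> i) / sols u i)) j = sols v j"
      unfolding f_def[symmetric] half index_minus_1 all_6_shift[of _ i]
      unfolding sols_def unfolding idx v p_def q_def
      by (simp add: add_divide_distrib diff_divide_distrib add.commute)
    then have "(sols u)(i+1 := sols u (i+1) + rconst (\<alpha> i) / sols u i,
        i-1 := sols u (i-1) - rconst (\<alpha> i) / sols u i) = sols v" by (intro ext) blast
    then show ?thesis using False by (simp add: s_state_def)
  qed
  ultimately show ?thesis unfolding type_A_chain_def by blast
qed

lemma chain_rotate:
  assumes "type_A_chain \<alpha> u"
  shows "type_A_chain (\<lambda>i. \<alpha> (i + k)) (\<lambda>i. u (i + k))"
proof -
  obtain \<sigma> where u: "dressing_chain \<alpha> u" "infinity_signs \<sigma> u"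
    using assms unfolding type_A_chain_def by blast
  have "dressing_chain (\<lambda>i. \<alpha> (i + k)) (\<lambda>i. u (i + k))"
    unfolding dressing_chain_def
  proof (intro conjI allI)
    fix i
    have "i + 1 + k = i + k + 1" by (simp only: ac_simps)
    then show "lower fract_deriv (u (i+1+k)) = upper fract_deriv (u (i+k)) - 4 * rconst (\<alpha> (i+k))"
      using chain_link[OF u(1), of "i + k"] by (simp only:)
    have "(\<Sum>i\<in>UNIV. u (i + k)) = (\<Sum>i\<in>UNIV. u i)"
      by (rule sum.reindex_bij_witness[of _ "\<lambda>i. i - k" "\<lambda>i. i + k"]) simp_all
    then show "(\<Sum>i\<in>UNIV. u (i + k)) = 2 * tvar" unfolding chain_sum[OF u(1)] .
  qed
  moreover have "infinity_signs (\<lambda>i. \<sigma> (i + k)) (\<lambda>i. u (i + k))"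
    using u(2) by (simp add: infinity_signs_def)
  ultimately show ?thesis unfolding type_A_chain_def by blast
qed

lemma pi_state_chain: "pi_state (\<alpha>, sols u) = (\<lambda>i. \<alpha> (i + 1), sols (\<lambda>i. u (i + 1)))"
  by (simp add: pi_state_def pi_param_def sols_def fun_eq_iff)

lemma inv_pi_state_chain: "inv pi_state (\<alpha>, sols u) = (\<lambda>i. \<alpha> (i - 1), sols (\<lambda>i. u (i - 1)))"
proof -
  have "pi_state (\<lambda>i. \<alpha> (i - 1), sols (\<lambda>i. u (i - 1))) = (\<alpha>, sols u)"
    unfolding pi_state_chain by simp
  then show ?thesis using bij_pi_state by (metis bij_inv_eq_iff)
qed

lemma inv_s_state: "inv (s_state i) = s_state i"
  by (rule inv_unique_comp) (simp_all add: fun_eq_iff s_state_s_state)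

text \<open>Every word in the generators of the parameter action is carried out on states letter by letter.
  The convention that \<open>s\<^sub>i\<close> fixes a state with \<open>f i = 0\<close> does no harm, since then \<open>\<alpha> i = 0\<close>.\<close>

lemma lift_to_solutions:
  assumes w: "w \<in> weyl_param" and u: "type_A_chain \<alpha> u"
  shows "\<exists>W\<in>baecklund. \<exists>v. W (\<alpha>, sols u) = (w \<alpha>, sols v) \<and> type_A_chain (w \<alpha>) v"
  using w unfolding weyl_param_def
proof induction
  case one
  then show ?case
    using u unfolding baecklund_def by (intro bexI[OF _ generated.one] exI[of _ u]) simp
next
  case (gen g w)
  then obtain W v where W: "W \<in> baecklund" "W (\<alpha>, sols u) = (w \<alpha>, sols v)" "type_A_chain (w \<alpha>) v"
    by blast
  have "\<exists>G\<in>insert pi_state (range s_state). \<exists>v'. G (w \<alpha>, sols v) = (g (w \<alpha>), sols v') \<and> type_A_chain (g (w \<alpha>)) v'"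
    using gen(1)
  proof
    assume g: "g = pi_param"
    show ?thesis
      unfolding g pi_param_def
      using chain_rotate[OF W(3), of 1] pi_state_chain by blast
  next
    assume "g \<in> range s_param"
    then obtain i where g: "g = s_param i" by blast
    show ?thesis unfolding g using s_state_chain[OF W(3), of i] by blast
  qed
  then obtain G v' where G: "G \<in> insert pi_state (range s_state)" "G (w \<alpha>, sols v) = (g (w \<alpha>), sols v')"
    "type_A_chain (g (w \<alpha>)) v'" by blast
  have "G \<circ> W \<in> baecklund"
    using generated.gen[OF G(1)] W(1) unfolding baecklund_def by blast
  then show ?case using G W by (intro bexI[of _ "G \<circ> W"] exI[of _ v']) simp_all
next
  case (inv g w)
  then obtain W v where W: "W \<in> baecklund" "W (\<alpha>, sols u) = (w \<alpha>, sols v)" "type_A_chain (w \<alpha>) v"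
    by blast
  have "\<exists>G\<in>insert pi_state (range s_state). \<exists>v'. inv G (w \<alpha>, sols v) = (inv g (w \<alpha>), sols v') \<and> type_A_chain (inv g (w \<alpha>)) v'"
    using inv(1)
  proof
    assume g: "g = pi_param"
    have "type_A_chain (\<lambda>i. w \<alpha> (i - 1)) (\<lambda>i. v (i - 1))"
      using chain_rotate[OF W(3), of "- 1"] by simp
    then show ?thesis
      unfolding g inv_pi_param using inv_pi_state_chain by blast
  next
    assume "g \<in> range s_param"
    then obtain i where g: "g = s_param i" by blast
    have "inv (s_state i) = s_state i" by (rule inv_s_state)
    then show ?thesis unfolding g inv_s_param using s_state_chain[OF W(3), of i] by (metis insertCI rangeI)
  qed
  then obtain G v' where G: "G \<in> insert pi_state (range s_state)" "inv G (w \<alpha>, sols v) = (inv g (w \<alpha>), sols v')"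
    "type_A_chain (inv g (w \<alpha>)) v'" by blast
  have "inv G \<circ> W \<in> baecklund"
    using generated.inv[OF G(1)] W(1) unfolding baecklund_def by blast
  then show ?case using G W by (intro bexI[of _ "inv G \<circ> W"] exI[of _ v']) simp_all
qed

section \<open>Riccati equations with an explicit potential\<close>

text \<open>The superpotential of the isotonic oscillator.\<close>

definition oscillator :: "complex \<Rightarrow> ratfun" where
  "oscillator \<kappa> = tvar + rconst \<kappa> * inverse tvar"

definition potential :: "complex \<Rightarrow> complex \<Rightarrow> ratfun" where
  "potential e l = tvar * tvar + rconst e + rconst (l * l + l) * (inverse tvar * inverse tvar)"

lemma deriv_inverse_tvar: "fract_deriv (inverse tvar) = - (inverse tvar * inverse tvar)"
  by (simp add: fract_deriv_inverse)

lemma lower_oscillator: "lower fract_deriv (oscillator \<kappa>) = potential (2 * \<kappa> - 1) \<kappa>"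
  and upper_oscillator: "upper fract_deriv (oscillator \<kappa>) = potential (2 * \<kappa> + 1) (- \<kappa>)"
proof -
  have D: "fract_deriv (oscillator \<kappa>) = 1 - rconst \<kappa> * (inverse tvar * inverse tvar)"
    by (simp add: oscillator_def fract_deriv_add fract_deriv_mult deriv_inverse_tvar)
  have t: "tvar * inverse tvar = 1" by simp
  have e: "rconst (2 * \<kappa> - 1) = 2 * rconst \<kappa> - 1" "rconst (2 * \<kappa> + 1) = 2 * rconst \<kappa> + 1"
    "rconst (\<kappa> * \<kappa> + \<kappa>) = rconst \<kappa> * rconst \<kappa> + rconst \<kappa>"
    "rconst (- \<kappa> * - \<kappa> + - \<kappa>) = rconst \<kappa> * rconst \<kappa> - rconst \<kappa>"
    by (simp_all add: rconst_add rconst_diff rconst_mult)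
  show "lower fract_deriv (oscillator \<kappa>) = potential (2 * \<kappa> - 1) \<kappa>"
    unfolding lower_def D potential_def e unfolding oscillator_def using t by algebra
  show "upper fract_deriv (oscillator \<kappa>) = potential (2 * \<kappa> + 1) (- \<kappa>)"
    unfolding upper_def D potential_def e unfolding oscillator_def using t by algebra
qed

lemma inverse_fls_X_inv: "inverse (fls_X_inv :: complex fls) = fls_X"
  by (metis fls_inverse_X inverse_inverse_eq)

lemma asymptotic_oscillator: "asymptotic 1 (oscillator \<kappa>)"
proof -
  have "expand_infty (oscillator \<kappa>) = fls_X_inv + fls_const \<kappa> * fls_X"
    by (simp add: oscillator_def inverse_fls_X_inv)
  then show ?thesis by (simp add: asymptotic_iff order_ge_def)
qed

lemma expand_infty_potential:
  "expand_infty (potential e l) $$ 0 = e" "expand_infty (potential e l) $$ - 1 = 0"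
proof -
  have "expand_infty (potential e l)
      = fls_X_inv * fls_X_inv + fls_const e + fls_const (l * l + l) * (fls_X * fls_X)"
    by (simp add: potential_def inverse_fls_X_inv)
  then show "expand_infty (potential e l) $$ 0 = e" "expand_infty (potential e l) $$ - 1 = 0"
    by (simp_all add: fls_X_inv_times_conv_shift fls_X_times_conv_shift)
qed

lemma expand_potential:
  "order_ge (expand c (potential e l)) (- 2)"
  "expand c (potential e l) $$ - 2 = (if c = 0 then l * l + l else 0)"
proof -
  have E: "expand c (potential e l) = (fls_const c + fls_X) * (fls_const c + fls_X) + fls_const e
      + fls_const (l * l + l) * (inverse (fls_const c + fls_X) * inverse (fls_const c + fls_X))"
    by (simp add: potential_def)
  have X: "order_ge (fls_const c + fls_X) 0" by (auto simp: order_ge_def)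
  have pol: "order_ge ((fls_const c + fls_X) * (fls_const c + fls_X) + fls_const e) 0"
    using order_ge_mult[OF X X] by (intro order_ge_add order_ge_const) simp_all
  have "order_ge (expand c (potential e l)) (- 2)
    \<and> expand c (potential e l) $$ - 2 = (if c = 0 then l * l + l else 0)"
  proof (cases "c = 0")
    case True
    have I: "inverse (fls_const c + fls_X) * inverse (fls_const c + fls_X) = fls_X_inv * fls_X_inv"
      using True by (simp add: fls_inverse_X)
    have "order_ge (fls_const (l * l + l) * (fls_X_inv * fls_X_inv)) (- 2)"
      "(fls_const (l * l + l) * (fls_X_inv * fls_X_inv)) $$ - 2 = l * l + l"
      by (auto simp: order_ge_def fls_X_inv_times_conv_shift)
    then show ?thesis
      unfolding E I using pol True by (auto simp: order_ge_def)
  next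
    case False
    have "order_ge (1 / (fls_const c + fls_X)) 0"
      using False X by (intro order_ge_divide) (auto simp: order_ge_def)
    then have I: "order_ge (inverse (fls_const c + fls_X)) 0"
      by (simp only: inverse_eq_divide)
    have "order_ge (fls_const (l * l + l) * (inverse (fls_const c + fls_X) * inverse (fls_const c + fls_X))) 0"
      using order_ge_mult[OF order_ge_const[of 0] order_ge_mult[OF I I]] by simp
    then have "order_ge (expand c (potential e l)) 0"
      unfolding E by (rule order_ge_add[OF pol])
    then show ?thesis using False by (auto simp: order_ge_def)
  qed
  then show "order_ge (expand c (potential e l)) (- 2)"
    "expand c (potential e l) $$ - 2 = (if c = 0 then l * l + l else 0)" by blast+
qed

lemma reflect_potential: "reflect (potential e l) = potential e l"
  by (simp add: potential_def)

text \<open>All poles of a rational solution other than \<open>0\<close> have residue \<open>- 1\<close>, since there the potential is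
  regular.  So the coefficient of \<open>1/t\<close> at infinity falls short of the residue at \<open>0\<close> by the
  number \<open>2 n\<close> of these poles, which is even because the solution is odd.\<close>

lemma riccati_pole_count:
  assumes x: "lower fract_deriv x = potential e l" and \<sigma>: "asymptotic \<sigma> x" "\<sigma> = 1 \<or> \<sigma> = - 1"
  shows "\<exists>n r. (r = l \<or> r = - 1 - l) \<and> 2 * of_int \<sigma> * (r - 2 * of_nat n) = e + of_int \<sigma>"
proof -
  have at: "lower fls_deriv (expand c x) = expand c (potential e l)" for c
    using arg_cong[OF x, of "expand c"] by (simp add: lower_def at.subst_deriv)
  have simple: "order_ge (expand c x) (- 1)" for c
  proof (rule ccontr)
    assume no: "\<not> order_ge (expand c x) (- 1)"
    let ?F = "expand c x" and ?m = "fls_subdegree (expand c x)"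
    have "?F \<noteq> 0" using no by auto
    then have Fm: "?F $$ ?m \<noteq> 0" by (rule nth_fls_subdegree_nonzero)
    have o: "order_ge ?F ?m" by (rule order_ge_subdegree)
    have m: "?m < - 1" using no order_ge_mono[OF o] by (meson not_le)
    have "fls_deriv ?F $$ (?m + ?m) = 0"
      using order_geD[OF order_ge_deriv[OF o]] m by (simp del: fls_deriv_nth)
    moreover have "expand c (potential e l) $$ (?m + ?m) = 0"
      using order_geD[OF expand_potential(1)] m by simp
    moreover have "lower fls_deriv ?F $$ (?m + ?m) = (?F * ?F) $$ (?m + ?m) - fls_deriv ?F $$ (?m + ?m)"
      by (simp only: lower_def power2_eq_square fls_minus_nth)
    ultimately have "?F $$ ?m * ?F $$ ?m = 0"
      unfolding lead_mult(1)[OF o o] at by simp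
    then show False using Fm by simp
  qed
  have res: "expand c x $$ - 1 * expand c x $$ - 1 + expand c x $$ - 1 = (if c = 0 then l * l + l else 0)" for c
  proof -
    have "(expand c x * expand c x) $$ (- 1 + - 1) = expand c x $$ - 1 * expand c x $$ - 1"
      by (rule lead_mult(1)[OF simple simple])
    moreover have "lower fls_deriv (expand c x) $$ - 2 = (if c = 0 then l * l + l else 0)"
      unfolding at by (rule expand_potential(2))
    ultimately show ?thesis by (simp add: lower_def power2_eq_square)
  qed
  have "lower fract_deriv (- reflect x) = upper fract_deriv (- x)"
    unfolding lower_reflect x reflect_potential
    using x by (simp add: lower_def upper_def fract_deriv_minus)
  moreover have "asymptotic (- \<sigma>) (- x)" "asymptotic (- (- \<sigma>)) (- reflect x)"
    using asymptotic_minus[OF \<sigma>(1)] asymptotic_reflect[OF \<sigma>(1)] by simp_all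
  ultimately have "- reflect x = - (- x)" using \<sigma>(2) by (intro opposite_at_infinity) auto
  then have odd: "reflect x = - x" by (simp add: minus_equation_iff)
  obtain H where H: "finite H" "0 \<notin> H" "H \<subseteq> poles x"
    "expand_infty x $$ 1 = expand 0 x $$ - 1 + 2 * (\<Sum>c\<in>H. expand c x $$ - 1)"
    by (rule odd_residue_theorem[OF simple odd]) (rule that)
  have "expand c x $$ - 1 = - 1" if "c \<in> H" for c
  proof -
    have "c \<noteq> 0" "expand c x $$ - 1 \<noteq> 0" using that H by (auto simp: poles_def)
    moreover have "expand c x $$ - 1 * (expand c x $$ - 1 + 1) = 0"
      using res[of c] \<open>c \<noteq> 0\<close> by (simp add: algebra_simps)
    ultimately show ?thesis by (simp add: eq_neg_iff_add_eq_0)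
  qed
  then have \<rho>: "expand_infty x $$ 1 = expand 0 x $$ - 1 - 2 * of_nat (card H)"
    using H(4) by simp
  have U: "order_ge (expand_infty x) (- 1)" "expand_infty x $$ - 1 = of_int \<sigma>"
    using \<sigma>(1) by (simp_all add: asymptotic_iff)
  let ?U = "expand_infty x"
  have inf: "lower deriv_infty ?U = expand_infty (potential e l)"
    using arg_cong[OF x, of expand_infty] by (simp add: lower_def infty.subst_deriv)
  have "(?U * ?U) $$ (- 1 + - 1 + 1) = 2 * of_int \<sigma> * ?U $$ 0"
    unfolding lead_mult(2)[OF U(1) U(1)] by (simp add: U(2))
  moreover have "?U $$ - 2 = 0" using U(1) by (simp add: order_ge_def)
  moreover have "lower deriv_infty ?U $$ - 1 = 0" unfolding inf by (rule expand_infty_potential(2))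
  ultimately have "2 * of_int \<sigma> * ?U $$ 0 = 0" by (simp add: lower_def power2_eq_square)
  then have U0: "?U $$ 0 = 0" using \<sigma>(2) by auto
  have "(?U * ?U) $$ (- 1 + - 1 + 2) = 2 * of_int \<sigma> * ?U $$ 1"
    unfolding lead_mult(3)[OF U(1) U(1)] by (simp add: U(2) U0)
  moreover have "lower deriv_infty ?U $$ 0 = e" unfolding inf by (rule expand_infty_potential(1))
  ultimately have "2 * of_int \<sigma> * ?U $$ 1 - of_int \<sigma> = e"
    by (simp add: lower_def power2_eq_square U(2))
  then have "2 * of_int \<sigma> * (expand 0 x $$ - 1 - 2 * of_nat (card H)) = e + of_int \<sigma>"
    unfolding \<rho> by (simp add: algebra_simps)
  moreover have "expand 0 x $$ - 1 = l \<or> expand 0 x $$ - 1 = - 1 - l"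
  proof -
    have "(expand 0 x $$ - 1 - l) * (expand 0 x $$ - 1 + 1 + l) = 0"
      using res[of 0] by (simp add: algebra_simps)
    then have "expand 0 x $$ - 1 - l = 0 \<or> expand 0 x $$ - 1 + 1 + l = 0"
      by (simp only: mult_eq_0_iff)
    moreover have "expand 0 x $$ - 1 = - 1 - l" if "expand 0 x $$ - 1 + 1 + l = 0"
      using that by algebra
    ultimately show ?thesis by auto
  qed
  ultimately show ?thesis by blast
qed

text \<open>The potentials in front of and behind \<open>t + \<kappa>/t\<close> admit a rational solution with the other sign
  only for special \<open>\<kappa>\<close>: one of the two possible residues at \<open>0\<close> would require \<open>- 2\<close> poles, the other
  one requires \<open>2 n\<close> poles with \<open>n\<close> determined by \<open>\<kappa>\<close>.\<close>

lemma below_oscillator: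
  assumes "lower fract_deriv x = lower fract_deriv (oscillator \<kappa>)" "asymptotic (- 1) x"
  shows "\<exists>n. \<kappa> = of_nat n + 1 / 2"
proof -
  have "\<exists>n r. (r = \<kappa> \<or> r = - 1 - \<kappa>)
      \<and> 2 * of_int (- 1) * (r - 2 * of_nat n) = (2 * \<kappa> - 1) + of_int (- 1)"
    using assms unfolding lower_oscillator by (rule riccati_pole_count) simp
  then obtain n r where r: "r = \<kappa> \<or> r = - 1 - \<kappa>"
    and n: "2 * of_int (- 1) * (r - 2 * of_nat n) = (2 * \<kappa> - 1) + of_int (- 1)"
    by (elim exE conjE)
  have n: "- 2 * (r - 2 * of_nat n) = 2 * \<kappa> - 2" using n by simp
  have four: "(4 :: complex) \<noteq> 0" by simp
  from r show ?thesis
  proof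
    assume "r = \<kappa>"
    then have "2 * \<kappa> - 2 = - 2 * (\<kappa> - 2 * of_nat n)" using n by simp
    moreover have "4 * \<kappa> = (2 * \<kappa> - 2) + (2 * \<kappa> + 2)" by simp
    ultimately have "4 * \<kappa> = - 2 * (\<kappa> - 2 * of_nat n) + (2 * \<kappa> + 2)" by (simp only:)
    also have "\<dots> = 4 * of_nat n + 2" by (simp add: algebra_simps)
    finally have "4 * \<kappa> = 4 * of_nat n + 2" .
    then have "4 * \<kappa> = 4 * (of_nat n + 1 / 2)" by (simp add: distrib_left)
    then have "\<kappa> = of_nat n + 1 / 2" by (simp only: mult_left_cancel[OF four])
    then show ?thesis by (rule exI)
  next
    assume "r = - 1 - \<kappa>"
    then have "4 * of_nat n + 4 = (0 :: complex)" using n by algebra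
    then have "of_nat (4 * n + 4) = (0 :: complex)" by simp
    then have "4 * n + 4 = 0" unfolding of_nat_eq_0_iff .
    then show ?thesis by simp
  qed
qed

lemma above_oscillator:
  assumes "lower fract_deriv x = upper fract_deriv (oscillator \<kappa>)" "asymptotic 1 x"
  shows "\<exists>n. \<kappa> = - of_nat n - 1 / 2"
proof -
  have "\<exists>n r. (r = - \<kappa> \<or> r = - 1 - (- \<kappa>))
      \<and> 2 * of_int 1 * (r - 2 * of_nat n) = (2 * \<kappa> + 1) + of_int 1"
    using assms unfolding upper_oscillator by (rule riccati_pole_count) simp
  then obtain n r where r: "r = - \<kappa> \<or> r = - 1 - (- \<kappa>)"
    and n: "2 * of_int 1 * (r - 2 * of_nat n) = (2 * \<kappa> + 1) + of_int 1"
    by (elim exE conjE)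
  have n: "2 * (r - 2 * of_nat n) = 2 * \<kappa> + 2" using n by simp
  have four: "(4 :: complex) \<noteq> 0" by simp
  from r show ?thesis
  proof
    assume "r = - \<kappa>"
    then have "4 * \<kappa> = - 4 * of_nat n - 2" using n by algebra
    then have "4 * \<kappa> = 4 * (- of_nat n - 1 / 2)" by (simp add: right_diff_distrib)
    then have "\<kappa> = - of_nat n - 1 / 2" by (simp only: mult_left_cancel[OF four])
    then show ?thesis by (rule exI)
  next
    assume "r = - 1 - (- \<kappa>)"
    then have "4 * of_nat n + 4 = (0 :: complex)" using n by algebra
    then have "of_nat (4 * n + 4) = (0 :: complex)" by simp
    then have "4 * n + 4 = 0" unfolding of_nat_eq_0_iff .
    then show ?thesis by simp
  qed
qed

lemma riccati_unique:
  assumes "lower fract_deriv x = lower fract_deriv y" "asymptotic \<sigma> x" "asymptotic \<sigma> y" "\<sigma> \<noteq> 0"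
  shows "x = y"
proof -
  have "lower fract_deriv x = upper fract_deriv (- y)"
    using assms(1) by (simp add: lower_def upper_def fract_deriv_minus)
  then have "x = - (- y)"
    by (rule opposite_at_infinity[where \<sigma> = "- \<sigma>"]) (use assms asymptotic_minus in auto)
  then show ?thesis by simp
qed

section \<open>Chains with vanishing parameters\<close>

definition signed :: "ratfun \<Rightarrow> bool" where
  "signed x \<longleftrightarrow> asymptotic 1 x \<or> asymptotic (- 1) x"

definition sign_at_infinity :: "ratfun \<Rightarrow> int" where
  "sign_at_infinity x = (if asymptotic 1 x then 1 else - 1)"

lemma asymptotic_inj: "asymptotic s x \<Longrightarrow> asymptotic t x \<Longrightarrow> s = t"
  unfolding asymptotic_iff by (metis of_int_eq_iff)

lemma sign_at_infinity:
  "\<sigma> = 1 \<or> \<sigma> = - 1 \<Longrightarrow> asymptotic \<sigma> x \<Longrightarrow> signed x \<and> sign_at_infinity x = \<sigma>"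
  unfolding signed_def sign_at_infinity_def using asymptotic_inj[of 1 x "- 1"] by auto

text \<open>Since the signs at infinity of a cancelled pair are opposite, a list with net sign \<open>n > 0\<close> reduces
  to \<open>n\<close> functions of positive sign.\<close>

lemma cancel_signs:
  assumes us: "linked (=) (lower fract_deriv) (upper fract_deriv) X us Y" "\<forall>x\<in>set us. signed x"
    and net: "sum_list (map sign_at_infinity us) = int n" "n > 0"
  obtains us' where "linked (=) (lower fract_deriv) (upper fract_deriv) X us' Y"
    "\<forall>x\<in>set us'. asymptotic 1 x" "sum_list us' = sum_list us" "length us' = n"
proof -
  let ?S = "{x. signed x}" and ?opp = "\<lambda>x y. sign_at_infinity x + sign_at_infinity y = 0"
  have "\<exists>us'. linked (=) (lower fract_deriv) (upper fract_deriv) X us' Y \<and> set us' \<subseteq> ?S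
    \<and> sum_list us - sum_list us' = 0 \<and> (even (length us') \<longleftrightarrow> even (length us))
    \<and> successively (\<lambda>x y. \<not> ?opp x y) us'
    \<and> sum_list (map sign_at_infinity us') = sum_list (map sign_at_infinity us)"
  proof (rule cancel_opposites[where I = "\<lambda>x. x = 0", OF _ _ _ _ us(1)])
    show "equivp ((=) :: ratfun \<Rightarrow> ratfun \<Rightarrow> bool)" by (rule identity_equivp)
    fix x y assume xy: "x \<in> ?S" "y \<in> ?S" "upper fract_deriv x = lower fract_deriv y" "?opp x y"
    have "asymptotic (sign_at_infinity x) x" "asymptotic (sign_at_infinity y) y"
      using xy(1,2) by (auto simp: signed_def sign_at_infinity_def)
    moreover have "sign_at_infinity y = - sign_at_infinity x" "sign_at_infinity x \<noteq> 0"
      using xy(4) by (simp_all add: sign_at_infinity_def split: if_splits)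
    ultimately have "y = - x"
      using opposite_at_infinity[OF xy(3)[symmetric], of "sign_at_infinity x"] by simp
    then show "x + y = 0 \<and> upper fract_deriv y = lower fract_deriv x \<and> ?opp x y"
      using xy(4) by (simp add: lower_def upper_def fract_deriv_minus)
  qed (use us(2) in auto)
  then obtain us' where us': "linked (=) (lower fract_deriv) (upper fract_deriv) X us' Y" "set us' \<subseteq> ?S"
    "sum_list us' = sum_list us" "successively (\<lambda>x y. \<not> ?opp x y) us'"
    "sum_list (map sign_at_infinity us') = int n"
    using net(1) by auto
  have const: "\<exists>a. (a = 1 \<or> a = - 1) \<and> (\<forall>x\<in>set us'. sign_at_infinity x = a)"
    using us'(4)
  proof (induction us')
    case (Cons x xs)
    have "successively (\<lambda>x y. \<not> ?opp x y) xs" using Cons.prems by (auto simp: successively_Cons)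
    from Cons.IH[OF this] obtain a where a: "a = 1 \<or> a = - 1" "\<forall>x\<in>set xs. sign_at_infinity x = a"
      by blast
    show ?case
    proof (cases xs)
      case Nil
      then show ?thesis
        by (intro exI[of _ "sign_at_infinity x"]) (simp add: sign_at_infinity_def)
    next
      case (Cons y ys)
      then have "sign_at_infinity x = sign_at_infinity y"
        using Cons.prems by (auto simp: sign_at_infinity_def split: if_splits)
      then show ?thesis using a Cons by auto
    qed
  qed auto
  then obtain a where a: "a = 1 \<or> a = - 1" "\<forall>x\<in>set us'. sign_at_infinity x = a" by blast
  have "sum_list (map sign_at_infinity us') = int (length us') * a"
    using a(2) by (induction us') (auto simp: algebra_simps)
  then have "int (length us') * a = int n" using us'(5) by simp
  then have "a = 1" "length us' = n" using a(1) net(2) by auto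
  then show thesis
    using us' a(2) by (intro that[of us']) (auto simp: sign_at_infinity_def split: if_splits)
qed

text \<open>Two neighbours with sum \<open>2t\<close> are determined by the equation between them.\<close>

lemma oscillator_pair:
  assumes sum: "y + z = 2 * tvar" and link: "lower fract_deriv z = upper fract_deriv y - 4 * rconst a"
  shows "y = oscillator (a - 1 / 2)" "z = oscillator (1 / 2 - a)"
proof -
  have "fract_deriv (y + z) = 2" unfolding sum by (simp add: fract_deriv_mult)
  then have d: "fract_deriv y + fract_deriv z = 2" by (simp only: fract_deriv_add)
  have "2 * (2 * (tvar * (y - tvar))) = 2 * (2 * rconst a - 1)"
    using link d sum unfolding lower_def upper_def by algebra
  then have "2 * (tvar * (y - tvar)) = 2 * rconst a - 1"
    by (simp only: mult_left_cancel[OF numeral_ratfun_neq_0])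
  then have "tvar * (y - tvar) = (2 * rconst a - 1) / 2" by (simp add: eq_divide_eq mult.commute)
  also have "\<dots> = rconst (a - 1 / 2)"
    by (simp add: rconst_diff rconst_divide diff_divide_distrib)
  finally have h: "tvar * (y - tvar) = rconst (a - 1 / 2)" .
  have "y - tvar = inverse tvar * (tvar * (y - tvar))"
    by (simp only: mult.assoc[symmetric] left_inverse[OF tvar_nonzero] mult_1_left)
  then have y: "y - tvar = rconst (a - 1 / 2) * inverse tvar" by (simp only: h mult.commute)
  then show "y = oscillator (a - 1 / 2)" by (simp add: oscillator_def diff_eq_eq add.commute)
  have "z = 2 * tvar - y" using sum by (simp add: eq_diff_eq add.commute)
  also have "\<dots> = tvar - (y - tvar)" by simp
  also have "\<dots> = oscillator (1 / 2 - a)"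
    unfolding y oscillator_def by (simp add: rconst_diff algebra_simps)
  finally show "z = oscillator (1 / 2 - a)" .
qed

lemma upper_minus: "upper fract_deriv (- y) = lower fract_deriv y"
  by (simp add: lower_def upper_def fract_deriv_minus)

lemma next_after_lower:
  assumes "lower fract_deriv x = lower fract_deriv (oscillator \<kappa>)" "signed x"
    "\<And>n. \<kappa> \<noteq> of_nat n + 1 / 2"
  shows "x = oscillator \<kappa>"
proof -
  have "\<not> asymptotic (- 1) x" using below_oscillator[OF assms(1)] assms(3) by blast
  then have "asymptotic 1 x" using assms(2) by (simp add: signed_def)
  then show ?thesis using riccati_unique[OF assms(1)] asymptotic_oscillator by simp
qed

lemma next_after_upper:
  assumes "lower fract_deriv x = upper fract_deriv (oscillator \<kappa>)" "signed x"
    "\<And>n. \<kappa> \<noteq> - of_nat n - 1 / 2"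
  shows "x = - oscillator \<kappa>"
proof -
  have "\<not> asymptotic 1 x" using above_oscillator[OF assms(1)] assms(3) by blast
  then have "asymptotic (- 1) x" using assms(2) by (simp add: signed_def)
  then show ?thesis using opposite_at_infinity[OF assms(1) asymptotic_oscillator] by simp
qed

lemma nonintegral_oscillator:
  fixes a :: complex
  assumes "a \<notin> \<int>"
  shows "a - 1 / 2 \<noteq> of_nat n + 1 / 2" "a - 1 / 2 \<noteq> - of_nat n - 1 / 2"
    "1 / 2 - a \<noteq> of_nat n + 1 / 2" "1 / 2 - a \<noteq> - of_nat n - 1 / 2"
proof -
  have no: False if "a = of_int k" for k using assms that by simp
  have e: "of_nat n + 1 / 2 + 1 / 2 = (of_int (int n + 1) :: complex)"
    "- of_nat n - 1 / 2 + 1 / 2 = (of_int (- int n) :: complex)"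
    "1 / 2 - (of_nat n + 1 / 2) = (of_int (- int n) :: complex)"
    "1 / 2 - (- of_nat n - 1 / 2) = (of_int (int n + 1) :: complex)"
    by simp_all
  show "a - 1 / 2 \<noteq> of_nat n + 1 / 2" "a - 1 / 2 \<noteq> - of_nat n - 1 / 2"
    using no[of "int n + 1"] no[of "- int n"] unfolding e[symmetric] diff_eq_eq by blast+
  have swap: "1 / 2 - a = c \<longleftrightarrow> a = 1 / 2 - c" for c :: complex by (auto simp: algebra_simps)
  show "1 / 2 - a \<noteq> of_nat n + 1 / 2" "1 / 2 - a \<noteq> - of_nat n - 1 / 2"
    unfolding swap e using no by blast+
qed

text \<open>Along a block with vanishing parameters the potential alternates between those in front of and
  behind \<open>t + \<kappa>/t\<close>, and each of them admits one continuation only.\<close>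

lemma alternating_block:
  assumes \<kappa>: "\<And>n. \<kappa> \<noteq> of_nat n + 1 / 2" "\<And>n. \<kappa> \<noteq> - of_nat n - 1 / 2"
    and xyz: "lower fract_deriv x = lower fract_deriv (oscillator \<kappa>)"
      "lower fract_deriv y = upper fract_deriv x" "lower fract_deriv z = upper fract_deriv y"
    and signed: "signed x" "signed y" "signed z"
  shows "x = oscillator \<kappa>" "y = - oscillator \<kappa>" "z = oscillator \<kappa>"
proof -
  show x: "x = oscillator \<kappa>" by (rule next_after_lower[OF xyz(1) signed(1) \<kappa>(1)])
  show y: "y = - oscillator \<kappa>" by (rule next_after_upper[OF xyz(2)[unfolded x] signed(2) \<kappa>(2)])
  show "z = oscillator \<kappa>"
    by (rule next_after_lower[OF xyz(3)[unfolded y upper_minus] signed(3) \<kappa>(1)])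
qed

section \<open>Solutions at the seed parameters\<close>

lemma zero_link:
  assumes "dressing_chain \<alpha> u" "\<alpha> i = 0"
  shows "lower fract_deriv (u (i+1)) = upper fract_deriv (u i)"
  using chain_link[OF assms(1), of i] assms(2) by simp

lemma infinity_signs_signed:
  assumes "infinity_signs \<sigma> u"
  shows "signed (u i)" "sign_at_infinity (u i) = \<sigma> i"
  using sign_at_infinity[of "\<sigma> i" "u i"] assms unfolding infinity_signs_def by blast+

lemma single_survivor:
  assumes "linked (=) (lower fract_deriv) (upper fract_deriv) X us Y" "\<forall>x\<in>set us. signed x"
    "sum_list (map sign_at_infinity us) = 1"
  obtains y where "X = lower fract_deriv y" "upper fract_deriv y = Y" "sum_list us = y"
proof -
  obtain us' where us': "linked (=) (lower fract_deriv) (upper fract_deriv) X us' Y"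
    "sum_list us' = sum_list us" "length us' = 1"
    by (rule cancel_signs[OF assms(1,2), of 1]) (use assms(3) in auto)
  then obtain y where "us' = [y]" by (metis One_nat_def length_0_conv length_Suc_conv)
  then show thesis using us' by (intro that[of y]) simp_all
qed

lemma pattern_link:
  fixes \<sigma> \<tau> :: "6 \<Rightarrow> int"
  assumes "2 * x \<notin> (\<int> :: complex set)" "\<And>i. s i = 1 \<or> s i = (- 1 :: int)"
    "\<alpha> - of_int (s i - s j) * x \<in> \<int>" "\<alpha> \<in> \<int>"
  shows "s i = s j"
proof (rule ccontr)
  assume "s i \<noteq> s j"
  then have d: "s i - s j = 2 \<or> s i - s j = - 2" using assms(2)[of i] assms(2)[of j] by auto
  have I: "of_int (s i - s j) * x \<in> \<int>" using Ints_diff[OF assms(4,3)] by simp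
  from d show False
  proof
    assume "s i - s j = 2"
    from I[unfolded this] show False using assms(1) by simp
  next
    assume "s i - s j = - 2"
    from I[unfolded this] have "- (2 * x) \<in> \<int>" by simp
    then show False using assms(1) unfolding minus_in_Ints_iff by blast
  qed
qed

text \<open>If some parameter is not an integer, there are two different classes modulo integers, and \<open>s\<close>,
  which names the classes, is constant along vanishing parameters.  Together with the sum condition
  this determines the net sign at infinity of a block of vanishing parameters.\<close>

lemma nonintegral_signs:
  assumes chain: "dressing_chain \<alpha> u" and \<sigma>: "infinity_signs \<sigma> u" and a: "\<alpha> k \<notin> \<int>"
  obtains s where "\<And>i. s i = 1 \<or> s i = (- 1 :: int)" "(\<Sum>i\<in>UNIV. s i * \<sigma> i) = 0" "s k \<noteq> s (k+1)"
    "\<And>i. \<alpha> i = 0 \<Longrightarrow> s (i+1) = s i"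
proof -
  obtain x \<tau> where x: "2 * x \<notin> \<int>" and \<tau>: "\<And>i. \<tau> i = 1 \<or> \<tau> i = - 1" "(\<Sum>i\<in>UNIV. \<tau> i) = (0::int)"
    and I: "\<And>i. \<alpha> i - of_int (\<sigma> i * \<tau> i - \<sigma> (i+1) * \<tau> (i+1)) * x \<in> \<int>"
    using chain_sign_pattern[OF chain \<sigma>] a by blast
  define s where "s i = \<sigma> i * \<tau> i" for i
  have \<sigma>1: "\<sigma> i = 1 \<or> \<sigma> i = - 1" for i by (rule infinity_signsD(1)[OF \<sigma>])
  have s: "s i = 1 \<or> s i = - 1" for i using \<sigma>1[of i] \<tau>(1)[of i] by (auto simp: s_def)
  have "s i * \<sigma> i = \<tau> i" for i using \<sigma>1[of i] by (auto simp: s_def)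
  then have "(\<Sum>i\<in>UNIV. s i * \<sigma> i) = 0" using \<tau>(2) by simp
  moreover have "s k \<noteq> s (k+1)"
  proof
    assume "s k = s (k+1)"
    then show False using I[of k] a by (simp add: s_def)
  qed
  moreover have "s (i+1) = s i" if "\<alpha> i = 0" for i
    using pattern_link[OF x s I[of i, folded s_def]] that by simp
  ultimately show thesis using s that by blast
qed

lemma sols_eqs:
  assumes "sols u 0 = a" "sols u 1 = b" "sols u 2 = c" "sols u 3 = d" "sols u 4 = e" "sols u 5 = f"
  shows "sols u = hexad a b c d e f"
  unfolding eq_hexad_iff using assms by simp

text \<open>All but \<open>u 1\<close> form a block with vanishing parameters and net sign 1.  Its survivor \<open>y\<close> and \<open>u 1\<close>
  add up to \<open>2 t\<close>, so both are known.\<close>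

lemma adjacent_solution:
  assumes chain: "dressing_chain (adjacent_params a) u" and \<sigma>: "infinity_signs \<sigma> u" and a: "a \<notin> \<int>"
  shows "sols u = hexad tvar tvar 0 0 0 0"
proof -
  let ?\<alpha> = "adjacent_params a"
  have \<alpha>: "?\<alpha> 0 = a" "?\<alpha> 2 = 0" "?\<alpha> 3 = 0" "?\<alpha> 4 = 0" "?\<alpha> 5 = 0" by (simp_all add: adjacent_params_def)
  have a0: "?\<alpha> 0 \<notin> \<int>" using a \<alpha>(1) by simp
  obtain s where s: "\<And>i. s i = 1 \<or> s i = (- 1 :: int)" "(\<Sum>i\<in>UNIV. s i * \<sigma> i) = 0" "s 0 \<noteq> s (0+1)"
    "\<And>i. ?\<alpha> i = 0 \<Longrightarrow> s (i+1) = s i"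
    by (rule nonintegral_signs[OF chain \<sigma> a0]) (rule that)
  have e: "s 3 = s 2" "s 4 = s 2" "s 5 = s 2" "s 0 = s 2" "s 1 = - s 2"
    using s(4)[of 2] s(4)[of 3] s(4)[of 4] s(4)[of 5] \<alpha> s(3) s(1)[of 0] s(1)[of 1] by auto
  have sum: "\<sigma> 0 + \<sigma> 1 + \<sigma> 2 + \<sigma> 3 + \<sigma> 4 + \<sigma> 5 = 2"
    using sum_signs[OF chain \<sigma>] unfolding sum_6 .
  have "s 2 * (\<sigma> 0 - \<sigma> 1 + \<sigma> 2 + \<sigma> 3 + \<sigma> 4 + \<sigma> 5) = 0"
    using s(2) unfolding sum_6 e by (simp add: algebra_simps)
  then have net: "\<sigma> 2 + \<sigma> 3 + \<sigma> 4 + \<sigma> 5 + \<sigma> 0 = 1" using s(1)[of 2] sum by auto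
  have l: "lower fract_deriv (u 3) = upper fract_deriv (u 2)" "lower fract_deriv (u 4) = upper fract_deriv (u 3)"
    "lower fract_deriv (u 5) = upper fract_deriv (u 4)" "lower fract_deriv (u 0) = upper fract_deriv (u 5)"
    using zero_link[OF chain, of 2] zero_link[OF chain, of 3] zero_link[OF chain, of 4]
      zero_link[OF chain, of 5] \<alpha> by simp_all
  let ?us = "[u 2, u 3, u 4, u 5, u 0]"
  have "linked (=) (lower fract_deriv) (upper fract_deriv) (lower fract_deriv (u 2)) ?us
    (upper fract_deriv (u 0))" using l by simp
  moreover have "\<forall>x\<in>set ?us. signed x" using infinity_signs_signed[OF \<sigma>] by simp
  moreover have "sum_list (map sign_at_infinity ?us) = 1"
    using net by (simp add: infinity_signs_signed[OF \<sigma>])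
  ultimately obtain y where y: "lower fract_deriv (u 2) = lower fract_deriv y"
    "upper fract_deriv y = upper fract_deriv (u 0)" "sum_list ?us = y"
    by (rule single_survivor)
  have yz: "y + u 1 = 2 * tvar"
    using y(3) chain_sum[OF chain] unfolding sum_6 by (simp add: ac_simps)
  have "lower fract_deriv (u 1) = upper fract_deriv y - 4 * rconst a"
    using chain_link[OF chain, of 0] y(2) \<alpha>(1) by simp
  then have yo: "y = oscillator (a - 1 / 2)" using oscillator_pair(1)[OF yz] by simp
  note no = nonintegral_oscillator(1,2)[OF a]
  note S = infinity_signs_signed(1)[OF \<sigma>]
  have u: "u 2 = y" "u 3 = - y" "u 4 = y"
    using alternating_block[OF no y(1)[unfolded yo] l(1,2) S S S] unfolding yo by blast+
  have "lower fract_deriv (u 4) = lower fract_deriv (oscillator (a - 1 / 2))"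
    unfolding u(3) yo ..
  then have u': "u 4 = y" "u 5 = - y" "u 0 = y"
    using alternating_block[OF no _ l(3,4) S S S] unfolding yo by blast+
  have idx: "(0::6) + 1 = 1" "(1::6) + 1 = 2" "(2::6) + 1 = 3" "(3::6) + 1 = 4" "(4::6) + 1 = 5" "(5::6) + 1 = 0"
    by simp_all
  show ?thesis
    by (rule sols_eqs; unfold sols_def idx u u'; simp add: yz add.commute)
qed

text \<open>Here the parameters vanish on two blocks of three, with one survivor each.\<close>

lemma opposite_solution:
  assumes chain: "dressing_chain (opposite_params a) u" and \<sigma>: "infinity_signs \<sigma> u" and a: "a \<notin> \<int>"
  shows "sols u = hexad tvar 0 0 tvar 0 0"
proof -
  let ?\<alpha> = "opposite_params a"
  have \<alpha>: "?\<alpha> 0 = a" "?\<alpha> 1 = 0" "?\<alpha> 2 = 0" "?\<alpha> 3 = 1 - a" "?\<alpha> 4 = 0" "?\<alpha> 5 = 0"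
    by (simp_all add: opposite_params_def)
  have a0: "?\<alpha> 0 \<notin> \<int>" using a \<alpha>(1) by simp
  obtain s where s: "\<And>i. s i = 1 \<or> s i = (- 1 :: int)" "(\<Sum>i\<in>UNIV. s i * \<sigma> i) = 0" "s 0 \<noteq> s (0+1)"
    "\<And>i. ?\<alpha> i = 0 \<Longrightarrow> s (i+1) = s i"
    by (rule nonintegral_signs[OF chain \<sigma> a0]) (rule that)
  have e: "s 2 = s 1" "s 3 = s 1" "s 0 = - s 1" "s 4 = - s 1" "s 5 = - s 1"
    using s(4)[of 1] s(4)[of 2] s(4)[of 4] s(4)[of 5] \<alpha> s(3) s(1)[of 0] s(1)[of 1] by auto
  have sum: "\<sigma> 0 + \<sigma> 1 + \<sigma> 2 + \<sigma> 3 + \<sigma> 4 + \<sigma> 5 = 2"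
    using sum_signs[OF chain \<sigma>] unfolding sum_6 .
  have "s 1 * ((\<sigma> 1 + \<sigma> 2 + \<sigma> 3) - (\<sigma> 4 + \<sigma> 5 + \<sigma> 0)) = 0"
    using s(2) unfolding sum_6 e by (simp add: algebra_simps)
  then have net: "\<sigma> 1 + \<sigma> 2 + \<sigma> 3 = 1" "\<sigma> 4 + \<sigma> 5 + \<sigma> 0 = 1" using s(1)[of 1] sum by auto
  have l: "lower fract_deriv (u 2) = upper fract_deriv (u 1)" "lower fract_deriv (u 3) = upper fract_deriv (u 2)"
    "lower fract_deriv (u 5) = upper fract_deriv (u 4)" "lower fract_deriv (u 0) = upper fract_deriv (u 5)"
    using zero_link[OF chain, of 1] zero_link[OF chain, of 2] zero_link[OF chain, of 4]
      zero_link[OF chain, of 5] \<alpha> by simp_all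
  note S = infinity_signs_signed(1)[OF \<sigma>]
  obtain y where y: "lower fract_deriv (u 1) = lower fract_deriv y"
    "upper fract_deriv y = upper fract_deriv (u 3)" "sum_list [u 1, u 2, u 3] = y"
    by (rule single_survivor[of "lower fract_deriv (u 1)" "[u 1, u 2, u 3]" "upper fract_deriv (u 3)"])
      (use l S net infinity_signs_signed(2)[OF \<sigma>] in simp_all)
  obtain z where z: "lower fract_deriv (u 4) = lower fract_deriv z"
    "upper fract_deriv z = upper fract_deriv (u 0)" "sum_list [u 4, u 5, u 0] = z"
    by (rule single_survivor[of "lower fract_deriv (u 4)" "[u 4, u 5, u 0]" "upper fract_deriv (u 0)"])
      (use l S net infinity_signs_signed(2)[OF \<sigma>] in simp_all)
  have "z + y = (\<Sum>i\<in>UNIV. u i)"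
    unfolding y(3)[symmetric] z(3)[symmetric] sum_6 by (simp add: ac_simps)
  then have zy: "z + y = 2 * tvar" unfolding chain_sum[OF chain] .
  have "lower fract_deriv y = upper fract_deriv z - 4 * rconst a"
    using chain_link[OF chain, of 0] y(1) z(2) \<alpha>(1) by simp
  then have zo: "z = oscillator (a - 1 / 2)" and yo: "y = oscillator (1 / 2 - a)"
    using oscillator_pair[OF zy] by simp_all
  have u: "u 1 = y" "u 2 = - y" "u 3 = y"
    using alternating_block[OF nonintegral_oscillator(3,4)[OF a] y(1)[unfolded yo] l(1,2) S S S]
    unfolding yo by blast+
  have u': "u 4 = z" "u 5 = - z" "u 0 = z"
    using alternating_block[OF nonintegral_oscillator(1,2)[OF a] z(1)[unfolded zo] l(3,4) S S S]
    unfolding zo by blast+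
  have idx: "(0::6) + 1 = 1" "(1::6) + 1 = 2" "(2::6) + 1 = 3" "(3::6) + 1 = 4" "(4::6) + 1 = 5" "(5::6) + 1 = 0"
    by simp_all
  show ?thesis
    by (rule sols_eqs; unfold sols_def idx u u'; simp add: zy zy[unfolded add.commute[of z]])
qed

text \<open>At the parameters \<open>(0, 1, 0, 0, 0, 0)\<close> two elements \<open>p, q\<close> survive.  Reading the signs of
  \<open>u 2, u 3, u 4, u 5, u 0, u 1\<close> as a walk starting at height 0, the potential depends on the height
  only, and by the pole count it admits no step below 0 and none above 2. Four walks with four
  up-steps and two down-steps stay in this strip.\<close>

lemma integral_solution:
  assumes chain: "dressing_chain (adjacent_params 0) u" and \<sigma>: "infinity_signs \<sigma> u"
  shows "sols u \<in> {hexad tvar tvar 0 0 0 0, hexad 0 tvar tvar 0 0 0, hexad 0 tvar 0 0 tvar 0,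
    hexad tvar tvar tvar 0 (- tvar) 0}"
proof -
  let ?\<alpha> = "adjacent_params 0"
  have \<alpha>: "?\<alpha> 0 = 0" "?\<alpha> 2 = 0" "?\<alpha> 3 = 0" "?\<alpha> 4 = 0" "?\<alpha> 5 = 0" by (simp_all add: adjacent_params_def)
  have l: "lower fract_deriv (u 3) = upper fract_deriv (u 2)" "lower fract_deriv (u 4) = upper fract_deriv (u 3)"
    "lower fract_deriv (u 5) = upper fract_deriv (u 4)" "lower fract_deriv (u 0) = upper fract_deriv (u 5)"
    "lower fract_deriv (u 1) = upper fract_deriv (u 0)"
    using zero_link[OF chain, of 2] zero_link[OF chain, of 3] zero_link[OF chain, of 4]
      zero_link[OF chain, of 5] zero_link[OF chain, of 0] \<alpha> by simp_all
  note S = infinity_signs_signed(1)[OF \<sigma>]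
  have sum: "\<sigma> 0 + \<sigma> 1 + \<sigma> 2 + \<sigma> 3 + \<sigma> 4 + \<sigma> 5 = 2"
    using sum_signs[OF chain \<sigma>] unfolding sum_6 .
  let ?us = "[u 2, u 3, u 4, u 5, u 0, u 1]"
  have total: "sum_list ?us = 2 * tvar"
    using chain_sum[OF chain] unfolding sum_6 by (simp add: ac_simps)
  have "linked (=) (lower fract_deriv) (upper fract_deriv) (lower fract_deriv (u 2)) ?us
    (upper fract_deriv (u 1))" using l by simp
  moreover have "\<forall>x\<in>set ?us. signed x" using S by simp
  moreover have "sum_list (map sign_at_infinity ?us) = int 2"
    using sum by (simp add: infinity_signs_signed[OF \<sigma>])
  ultimately obtain us' where us': "linked (=) (lower fract_deriv) (upper fract_deriv) (lower fract_deriv (u 2)) us' (upper fract_deriv (u 1))"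
    "sum_list us' = sum_list ?us" "length us' = 2"
    by (rule cancel_signs) simp_all
  then obtain p q where "us' = [p, q]"
    by (metis One_nat_def Suc_1 length_0_conv length_Suc_conv)
  then have pq: "lower fract_deriv (u 2) = lower fract_deriv p" "lower fract_deriv q = upper fract_deriv p"
    "p + q = 2 * tvar"
    using us' total by simp_all
  have po: "p = oscillator (- 1 / 2)" and qo: "q = oscillator (1 / 2)"
    using oscillator_pair[OF pq(3), of 0] pq(2) by simp_all
  have neq: "(- 1 / 2 :: complex) \<noteq> of_nat n + 1 / 2" "(1 / 2 :: complex) \<noteq> - of_nat n - 1 / 2" for n
  proof -
    have N: "(of_nat (n + 1) :: complex) \<noteq> 0" unfolding of_nat_eq_0_iff by simp
    show "(- 1 / 2 :: complex) \<noteq> of_nat n + 1 / 2"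
    proof
      assume h: "(- 1 / 2 :: complex) = of_nat n + 1 / 2"
      have "of_nat (n + 1) = (of_nat n + 1 / 2) + (1 / 2 :: complex)" by simp
      also have "\<dots> = 0" unfolding h[symmetric] by simp
      finally show False using N by blast
    qed
    show "(1 / 2 :: complex) \<noteq> - of_nat n - 1 / 2"
    proof
      assume h: "(1 / 2 :: complex) = - of_nat n - 1 / 2"
      have "of_nat (n + 1) = 1 / 2 - (- of_nat n - 1 / 2 :: complex)" by simp
      also have "\<dots> = 0" unfolding h[symmetric] by simp
      finally show False using N by blast
    qed
  qed
  have bottom: "x = p" if "lower fract_deriv x = lower fract_deriv p" "signed x" for x
    using next_after_lower[OF _ that(2) neq(1)] that(1) unfolding po by blast
  have top: "x = - q" if "lower fract_deriv x = upper fract_deriv q" "signed x" for x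
    using next_after_upper[OF _ that(2) neq(2)] that(1) unfolding qo by blast
  have middle: "x = q \<or> x = - p" if "lower fract_deriv x = upper fract_deriv p" "signed x" for x
  proof (cases "asymptotic 1 x")
    case True
    then have "x = q"
      using riccati_unique[of x q 1] that(1) pq(2) asymptotic_oscillator unfolding qo by simp
    then show ?thesis by blast
  next
    case False
    then have "asymptotic (- 1) x" using that(2) by (simp add: signed_def)
    then have "x = - p"
      using opposite_at_infinity[OF that(1), of 1] asymptotic_oscillator unfolding po by simp
    then show ?thesis by blast
  qed
  have two_steps: "upper fract_deriv y = upper fract_deriv p \<and> (x = q \<and> y = - q \<or> x = - p \<and> y = p)"
    if x: "lower fract_deriv x = upper fract_deriv p" "signed x"
      and y: "lower fract_deriv y = upper fract_deriv x" "signed y" for x y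
    using middle[OF x]
  proof
    assume "x = q"
    then show ?thesis using top[of y] y by (simp add: upper_minus pq(2))
  next
    assume "x = - p"
    then show ?thesis using bottom[of y] y by (simp add: upper_minus)
  qed
  have u2: "u 2 = p" by (rule bottom[OF pq(1) S])
  have t: "upper fract_deriv (u 4) = upper fract_deriv p" "u 3 = q \<and> u 4 = - q \<or> u 3 = - p \<and> u 4 = p"
    using two_steps[OF l(1)[unfolded u2] S l(2) S] by blast+
  have t': "upper fract_deriv (u 0) = upper fract_deriv p" "u 5 = q \<and> u 0 = - q \<or> u 5 = - p \<and> u 0 = p"
    using two_steps[OF l(3)[unfolded t(1)] S l(4) S] by blast+
  have "u 3 + u 4 = 0" "u 5 + u 0 = 0" using t(2) t'(2) by auto
  moreover have "u 2 + (u 3 + u 4) + (u 5 + u 0) + u 1 = 2 * tvar" using total by (simp add: ac_simps)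
  ultimately have "p + u 1 = p + q" unfolding pq(3) u2 by simp
  then have u1: "u 1 = q" by simp
  have idx: "(0::6) + 1 = 1" "(1::6) + 1 = 2" "(2::6) + 1 = 3" "(3::6) + 1 = 4" "(4::6) + 1 = 5" "(5::6) + 1 = 0"
    by simp_all
  have h: "(p + q) / 2 = tvar" "(q + p) / 2 = tvar" "(- q + - p) / 2 = - tvar"
  proof -
    show 1: "(p + q) / 2 = tvar" unfolding pq(3) by simp
    then show 2: "(q + p) / 2 = tvar" by (simp only: add.commute)
    have "- q + - p = - (q + p)" by simp
    then show "(- q + - p) / 2 = - tvar" using 2 by (simp only: minus_divide_left[symmetric])
  qed
  have z: "(x + - x) / 2 = (0::ratfun)" "(- x + x) / 2 = (0::ratfun)" for x by simp_all
  from t(2) t'(2) show ?thesis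
  proof (elim disjE conjE)
    assume v: "u 3 = q" "u 4 = - q" "u 5 = q" "u 0 = - q"
    have "sols u = hexad 0 tvar tvar 0 0 0"
      by (rule sols_eqs) (simp_all only: sols_def idx u1 u2 v h z)
    then show ?thesis by simp
  next
    assume v: "u 3 = q" "u 4 = - q" "u 5 = - p" "u 0 = p"
    have "sols u = hexad tvar tvar tvar 0 (- tvar) 0"
      by (rule sols_eqs) (simp_all only: sols_def idx u1 u2 v h z)
    then show ?thesis by simp
  next
    assume v: "u 3 = - p" "u 4 = p" "u 5 = q" "u 0 = - q"
    have "sols u = hexad 0 tvar 0 0 tvar 0"
      by (rule sols_eqs) (simp_all only: sols_def idx u1 u2 v h z)
    then show ?thesis by simp
  next
    assume v: "u 3 = - p" "u 4 = p" "u 5 = - p" "u 0 = p"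
    have "sols u = hexad tvar tvar 0 0 0 0"
      by (rule sols_eqs) (simp_all only: sols_def idx u1 u2 v h z)
    then show ?thesis by simp
  qed
qed

section \<open>Classification\<close>

text \<open>If \<open>K\<close> indices have \<open>\<sigma> i = \<tau> i = - 1\<close>, then \<open>\<sigma> i \<tau> i\<close> adds up to \<open>4 K - 4\<close>; and \<open>K \<le> 2\<close> as only
  two of the \<open>\<sigma> i\<close> are negative.\<close>

lemma chain_two_classes:
  assumes chain: "dressing_chain \<alpha> u" and \<sigma>: "infinity_signs \<sigma> u"
  shows "two_classes \<alpha>"
proof (cases "\<forall>i. \<alpha> i \<in> \<int>")
  case True
  let ?s = "hexad 1 (- 1) 1 1 1 1 :: 6 \<Rightarrow> int"
  have "\<forall>i. ?s i = 1 \<or> ?s i = - 1" "(\<Sum>i\<in>UNIV. ?s i) \<in> {4, - 4, 0 :: int}"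
    unfolding all_6 sum_6 by simp_all
  moreover have "\<forall>i. \<alpha> i - of_int (?s i - ?s (i+1)) * 0 \<in> \<int>" using True by simp
  ultimately show ?thesis unfolding two_classes_def by blast
next
  case False
  then obtain x \<tau> where \<tau>: "\<forall>i. \<tau> i = 1 \<or> \<tau> i = - 1" "(\<Sum>i\<in>UNIV. \<tau> i) = (0::int)"
    and I: "\<forall>i. \<alpha> i - of_int (\<sigma> i * \<tau> i - \<sigma> (i+1) * \<tau> (i+1)) * x \<in> \<int>"
    using chain_sign_pattern[OF chain \<sigma>] by blast
  have "\<sigma> i = 1 \<or> \<sigma> i = - 1" for i by (rule infinity_signsD(1)[OF \<sigma>])
  note \<sigma>1 = this
  have "\<forall>i. \<sigma> i * \<tau> i = 1 \<or> \<sigma> i * \<tau> i = - 1"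
  proof
    fix i show "\<sigma> i * \<tau> i = 1 \<or> \<sigma> i * \<tau> i = - 1" using \<sigma>1[of i] \<tau>(1)[rule_format, of i] by auto
  qed
  moreover have "(\<Sum>i\<in>UNIV. \<sigma> i * \<tau> i) \<in> {4, - 4, 0 :: int}"
  proof -
    define w :: "6 \<Rightarrow> int" where "w i = (if \<sigma> i = - 1 \<and> \<tau> i = - 1 then 1 else 0)" for i
    have w: "\<sigma> i * \<tau> i = 4 * w i - 1 + \<sigma> i + \<tau> i" "0 \<le> w i" "2 * w i \<le> 1 - \<sigma> i" for i
      using \<sigma>1[of i] \<tau>(1)[rule_format, of i] by (auto simp: w_def)
    have "0 \<le> (\<Sum>i\<in>UNIV. w i)" by (rule sum_nonneg) (rule w(2))
    moreover have "2 * (\<Sum>i\<in>UNIV. w i) \<le> (\<Sum>i\<in>(UNIV :: 6 set). 1 - \<sigma> i)"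
      unfolding sum_distrib_left by (rule sum_mono) (rule w(3))
    moreover have "(\<Sum>i\<in>(UNIV :: 6 set). 1 - \<sigma> i) = 4"
      using sum_signs[OF chain \<sigma>] unfolding sum_6 by simp
    moreover have "(\<Sum>i\<in>UNIV. \<sigma> i * \<tau> i) = 4 * (\<Sum>i\<in>UNIV. w i) - 4"
      using sum_signs[OF chain \<sigma>] \<tau>(2) unfolding w(1) sum_6 by simp
    ultimately show ?thesis by auto
  qed
  ultimately show ?thesis
    using I unfolding two_classes_def by (intro exI[of _ x] exI[of _ "\<lambda>i. \<sigma> i * \<tau> i"] conjI)
qed

lemma integral_orbit:
  assumes "a \<in> \<int>"
  shows "param_orbit (adjacent_params a) (adjacent_params 0)"
    and "param_orbit (opposite_params a) (adjacent_params 0)"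
proof -
  obtain n where n: "a = of_int n" using assms by (rule Ints_cases)
  have "adjacent_params 0 = move n 0 1 (adjacent_params a)"
    unfolding fun_eq_iff all_6 by (simp add: adjacent_params_def move_def n)
  moreover have "(\<Sum>i\<in>UNIV. adjacent_params a i) = 1" by (simp add: adjacent_params_def sum_6)
  ultimately show "param_orbit (adjacent_params a) (adjacent_params 0)"
    using param_orbit_move by metis
  have "adjacent_params 0 = move (1 - n) 3 1 (move n 0 1 (opposite_params a))"
    unfolding fun_eq_iff all_6 by (simp add: adjacent_params_def opposite_params_def move_def n)
  moreover have "(\<Sum>i\<in>UNIV. opposite_params a i) = 1" by (simp add: opposite_params_def sum_6)
  ultimately show "param_orbit (opposite_params a) (adjacent_params 0)"
    using param_orbit_move param_orbit_trans sum_move by metis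
qed

lemma reach_params:
  assumes "type_A_chain \<alpha> u" "param_orbit \<alpha> \<beta>"
  obtains W v where "W \<in> baecklund" "W (\<alpha>, sols u) = (\<beta>, sols v)" "type_A_chain \<beta> v"
proof -
  obtain w where "w \<in> weyl_param" "w \<alpha> = \<beta>" using assms(2) unfolding param_orbit_def by blast
  then show thesis using lift_to_solutions[OF _ assms(1), of w] that by blast
qed

lemma classification:
  assumes par: "\<alpha> \<in> parameters" and sol: "rational_solution \<alpha> f" and A: "type_A f"
  shows "\<exists>w\<in>baecklund. \<exists>\<beta> g. w (\<alpha>, f) = (\<beta>, g) \<and>
           ((\<exists>a. \<beta> = hexad a (1 - a) 0 0 0 0 \<and> g = hexad tvar tvar 0 0 0 0) \<or>
            (\<exists>a. \<beta> = hexad a 0 0 (1 - a) 0 0 \<and> g = hexad tvar 0 0 tvar 0 0) \<or>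
            (\<beta> = hexad 0 1 0 0 0 0 \<and>
             g \<in> {hexad tvar tvar 0 0 0 0,
                  hexad 0 tvar tvar 0 0 0,
                  hexad 0 tvar 0 0 tvar 0,
                  hexad tvar tvar tvar 0 (- tvar) 0}))"
proof -
  obtain u where u: "dressing_chain \<alpha> u" "f = sols u"
    using rational_solution_dressing_chain[OF par sol] by blast
  obtain \<sigma> where \<sigma>: "infinity_signs \<sigma> u"
    using type_A_infinity_signs[OF u(1)] A unfolding u(2) by blast
  have chain: "type_A_chain \<alpha> u" using u(1) \<sigma> unfolding type_A_chain_def by blast
  have "(\<Sum>i\<in>UNIV. \<alpha> i) = 1" using par by (simp add: parameters_def)
  then obtain a where a: "param_orbit \<alpha> (adjacent_params a) \<or> param_orbit \<alpha> (opposite_params a)"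
    using integrality_orbit two_classes_integrality[OF chain_two_classes[OF u(1) \<sigma>]] by blast
  show ?thesis
  proof (cases "a \<in> \<int>")
    case True
    then have "param_orbit \<alpha> (adjacent_params 0)"
      using a integral_orbit param_orbit_trans by blast
    then obtain W v where W: "W \<in> baecklund" "W (\<alpha>, sols u) = (adjacent_params 0, sols v)"
      "type_A_chain (adjacent_params 0) v"
      by (rule reach_params[OF chain])
    then have "sols v \<in> {hexad tvar tvar 0 0 0 0, hexad 0 tvar tvar 0 0 0, hexad 0 tvar 0 0 tvar 0,
        hexad tvar tvar tvar 0 (- tvar) 0}"
      using integral_solution unfolding type_A_chain_def by blast
    moreover have "adjacent_params 0 = hexad 0 1 0 0 0 0" by (simp add: adjacent_params_def)
    ultimately show ?thesis using W(1,2) unfolding u(2) by blast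
  next
    case False
    from a show ?thesis
    proof
      assume "param_orbit \<alpha> (adjacent_params a)"
      then obtain W v where W: "W \<in> baecklund" "W (\<alpha>, sols u) = (adjacent_params a, sols v)"
        "type_A_chain (adjacent_params a) v"
        by (rule reach_params[OF chain])
      then have "sols v = hexad tvar tvar 0 0 0 0"
        using adjacent_solution[OF _ _ False] unfolding type_A_chain_def by blast
      then show ?thesis using W(1,2) unfolding u(2) adjacent_params_def by blast
    next
      assume "param_orbit \<alpha> (opposite_params a)"
      then obtain W v where W: "W \<in> baecklund" "W (\<alpha>, sols u) = (opposite_params a, sols v)"
        "type_A_chain (opposite_params a) v"
        by (rule reach_params[OF chain])
      then have "sols v = hexad tvar 0 0 tvar 0 0"
        using opposite_solution[OF _ _ False] unfolding type_A_chain_def by blast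
      then show ?thesis using W(1,2) unfolding u(2) opposite_params_def by blast
    qed
  qed
qed

theorem theorem12p1:
  shows
    "(\<forall>\<alpha> f. \<alpha> \<in> parameters \<and> rational_solution \<alpha> f \<and> type_A f \<longrightarrow>
        (\<exists>w\<in>baecklund. \<exists>\<beta> g. w (\<alpha>, f) = (\<beta>, g) \<and>
           ((\<exists>a. \<beta> = hexad a (1 - a) 0 0 0 0 \<and> g = hexad tvar tvar 0 0 0 0) \<or>
            (\<exists>a. \<beta> = hexad a 0 0 (1 - a) 0 0 \<and> g = hexad tvar 0 0 tvar 0 0) \<or>
            (\<beta> = hexad 0 1 0 0 0 0 \<and>
             g \<in> {hexad tvar tvar 0 0 0 0,
                  hexad 0 tvar tvar 0 0 0,
                  hexad 0 tvar 0 0 tvar 0,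
                  hexad tvar tvar tvar 0 (- tvar) 0}))))
     \<and>
     (\<Union>w\<in>weyl_param. w ` (range (\<lambda>a. hexad a (1 - a) 0 0 0 0) \<union>
                           range (\<lambda>a. hexad a 0 0 (1 - a) 0 0) \<union>
                           {hexad 0 1 0 0 0 0}))
     = {\<alpha> \<in> parameters.
          (\<exists>i. \<alpha> (i+2) \<in> \<int> \<and> \<alpha> (i+3) \<in> \<int> \<and> \<alpha> (i+4) \<in> \<int> \<and> \<alpha> (i+5) \<in> \<int>) \<or>
          (\<exists>i. \<alpha> (i+1) \<in> \<int> \<and> \<alpha> (i+2) \<in> \<int> \<and> \<alpha> (i+4) \<in> \<int> \<and> \<alpha> (i+5) \<in> \<int>) \<or>
          (\<exists>i. \<alpha> (i+3) \<in> \<int> \<and> \<alpha> (i+5) \<in> \<int> \<and> \<alpha> i + \<alpha> (i+4) \<in> \<int> \<and> \<alpha> i - \<alpha> (i+2) \<in> \<int>) \<or>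
          (\<exists>i. \<alpha> (i+3) + \<alpha> (i+4) \<in> \<int> \<and> \<alpha> (i+4) + \<alpha> (i+5) \<in> \<int> \<and>
               \<alpha> i + \<alpha> (i+1) \<in> \<int> \<and> \<alpha> i - \<alpha> (i+4) \<in> \<int>) \<or>
          (\<exists>i. \<alpha> i + \<alpha> (i+1) \<in> \<int> \<and> \<alpha> i + \<alpha> (i+5) \<in> \<int> \<and> \<alpha> (i+2) + \<alpha> (i+3) \<in> \<int> \<and>
               \<alpha> (i+3) + \<alpha> (i+4) \<in> \<int> \<and> \<alpha> i + \<alpha> (i+3) \<in> \<int>)}"
proof (intro conjI allI impI, goal_cases)
  case (1 \<alpha> f)
  then show ?case by (elim conjE) (rule classification)
next
  case 2
  show ?case by (rule orbit_of_seeds[unfolded integrality_def])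
qed

end
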